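(* There is a polynomial-time approximation scheme (PTAS) for the min-max $r$-gather clustering problem on a spider, and there is a PTAS for the min-max $r$-gathering problem on a spider. That is, for each fixed $\epsilon>0$ there is a polynomial-time algorithm which, given an instance $\mathcal I$ on a spider, outputs a feasible solution of cost at most $(1+\epsilon)\mathrm{OPT}(\mathcal I)$.
   Context: A spider with center $o$ is a set $\{l_1,\dots,l_d\}$ of half-lines (legs) sharing the common endpoint $o$; the point on leg $l$ at distance $x\ge0$ from $o$ is $(l,x)$, and $\mathrm{dist}((l,x),(l',x'))=|x-x'|$ if $l=l'$ and $x+x'$ otherwise. The number of legs $d$ is part of the input. Min-max $r$-gathering problem: given users $\mathcal U$, facilities $\mathcal F$ (points of the metric space) and a positive integer $r$, find $\pi:\mathcal U\to\mathcal F$ with $|\pi^{-1}(f)|\in\{0\}\cup[r,\infty)$ for every $f$, minimizing $\max_{u}\mathrm{dist}(u,\pi(u))$. Min-max $r$-gather clustering problem: given users $\mathcal U$ and a positive integer $r$, partition $\mathcal U$ into clusters each of size at least $r$, minimizing the maximum cluster diameter. $\mathrm{OPT}(\mathcal I)$ is the optimal objective value. *)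

theory Defs
  imports
    Complex_Main
    "HOL-Library.Disjoint_Sets"
    "HOL-Library.FuncSet"
    "HOL-Library.Log_Nat"
    "HOL-Computational_Algebra.Polynomial"
begin

section \<open>A machine model with logarithmic cost\<close>

text \<open>
  Algorithms are programs of a first-order functional language with general recursion that works on
  S-expressions with natural-number atoms. Every evaluated node of an expression is charged the
  length, in binary, of the value it produces. Hence every operand of a primitive has been paid
  for, every primitive is computable in time polynomial in the length of its operands, and no value,
  environment or call stack is larger than what has been paid for. So the model is
  polynomially equivalent to Turing machines and to random access machines with logarithmic cost.
\<close>

datatype data = Atom nat | Pair data data

text \<open>The value \<open>floorlog 2 n\<close> is the number of binary digits of \<open>n\<close>.\<close>

primrec data_len :: "data \<Rightarrow> nat" where
  "data_len (Atom n) = Suc (floorlog 2 n)"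
| "data_len (Pair a b) = Suc (data_len a + data_len b)"

datatype primop = Plus | Minus | Times | Quot | Leq | MkPair | First | Second | IsPair

text \<open>Subtraction is truncated, \<open>n div 0 = 0\<close>, and ill-typed applications have no value.\<close>

fun apply_primop :: "primop \<Rightarrow> data list \<Rightarrow> data option" where
  "apply_primop Plus [Atom m, Atom n] = Some (Atom (m + n))"
| "apply_primop Minus [Atom m, Atom n] = Some (Atom (m - n))"
| "apply_primop Times [Atom m, Atom n] = Some (Atom (m * n))"
| "apply_primop Quot [Atom m, Atom n] = Some (Atom (m div n))"
| "apply_primop Leq [Atom m, Atom n] = Some (Atom (if m \<le> n then 1 else 0))"
| "apply_primop MkPair [a, b] = Some (Pair a b)"
| "apply_primop First [Pair a b] = Some a"
| "apply_primop Second [Pair a b] = Some b"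
| "apply_primop IsPair [Pair a b] = Some (Atom 1)"
| "apply_primop IsPair [Atom n] = Some (Atom 0)"
| "apply_primop _ _ = None"

text \<open>
  Variables are indices into the environment: \<open>Bind e b\<close> evaluates \<open>b\<close> with the value of \<open>e\<close> pushed
  as variable 0, and \<open>Call f es\<close> evaluates the body of function \<open>f\<close> in the environment consisting
  of the values of \<open>es\<close>. In \<open>Cond\<close>, the value \<open>Atom 0\<close> is false and every other value is true.
\<close>

datatype expr =
    Var nat
  | Const nat
  | Prim primop "expr list"
  | Cond expr expr expr
  | Bind expr expr
  | Call nat "expr list"

text \<open>A program is the list of its function bodies; execution starts with function 0.\<close>

type_synonym program = "expr list"

text \<open>\<open>eval P env e v t\<close>: in environment \<open>env\<close>, expression \<open>e\<close> has value \<open>v\<close>, computed at cost \<open>t\<close>.\<close>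

inductive eval :: "program \<Rightarrow> data list \<Rightarrow> expr \<Rightarrow> data \<Rightarrow> nat \<Rightarrow> bool" for P :: program where
  eval_Var: "i < length env \<Longrightarrow> eval P env (Var i) (env ! i) (data_len (env ! i))"
| eval_Const: "eval P env (Const n) (Atom n) (data_len (Atom n))"
| eval_Prim:
    "\<lbrakk> length vs = length es; length ts = length es;
       \<forall>i<length es. eval P env (es ! i) (vs ! i) (ts ! i);
       apply_primop p vs = Some v \<rbrakk>
     \<Longrightarrow> eval P env (Prim p es) v (sum_list ts + data_len v)"
| eval_Cond:
    "\<lbrakk> eval P env e c s; eval P env (if c = Atom 0 then e2 else e1) v t \<rbrakk>
     \<Longrightarrow> eval P env (Cond e e1 e2) v (s + t + data_len v)"
| eval_Bind:
    "\<lbrakk> eval P env e u s; eval P (u # env) b v t \<rbrakk>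
     \<Longrightarrow> eval P env (Bind e b) v (s + t + data_len v)"
| eval_Call:
    "\<lbrakk> f < length P; length vs = length es; length ts = length es;
       \<forall>i<length es. eval P env (es ! i) (vs ! i) (ts ! i);
       eval P vs (P ! f) v t \<rbrakk>
     \<Longrightarrow> eval P env (Call f es) v (sum_list ts + t + data_len v)"

definition runs :: "program \<Rightarrow> data \<Rightarrow> data \<Rightarrow> nat \<Rightarrow> bool" where
  "runs P inp out t \<longleftrightarrow> eval P [inp] (Call 0 [Var 0]) out t"

inductive_cases eval_VarE: "eval P env (Var i) v t"
inductive_cases eval_ConstE: "eval P env (Const n) v t"
inductive_cases eval_PrimE: "eval P env (Prim p es) v t"
inductive_cases eval_CondE: "eval P env (Cond e e1 e2) v t"
inductive_cases eval_BindE: "eval P env (Bind e b) v t"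
inductive_cases eval_CallE: "eval P env (Call f es) v t"

lemma eval_deterministic:
  "eval P env e v t \<Longrightarrow> eval P env e v' t' \<Longrightarrow> v' = v \<and> t' = t"
proof (induction arbitrary: v' t' rule: eval.induct)
  case (eval_Var i env)
  show ?case by (rule eval_VarE[OF eval_Var.prems]) simp
next
  case (eval_Const env n)
  show ?case by (rule eval_ConstE[OF eval_Const.prems]) simp
next
  case (eval_Prim vs es ts env p v)
  show ?case
  proof (rule eval_PrimE[OF eval_Prim.prems])
    fix vs' ts'
    assume *: "t' = sum_list ts' + data_len v'" "length vs' = length es" "length ts' = length es"
      "\<forall>i<length es. eval P env (es ! i) (vs' ! i) (ts' ! i)" "apply_primop p vs' = Some v'"
    have eq: "vs' ! i = vs ! i \<and> ts' ! i = ts ! i" if "i < length es" for i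
      using eval_Prim.IH *(4) that by blast
    have "vs' = vs" "ts' = ts"
      using eq eval_Prim.hyps *(2,3) by (simp_all add: list_eq_iff_nth_eq)
    with * eval_Prim.hyps show ?thesis by simp
  qed
next
  case (eval_Cond env e c s e2 e1 v t)
  show ?case
  proof (rule eval_CondE[OF eval_Cond.prems])
    fix c' s' t0
    assume *: "t' = s' + t0 + data_len v'" "eval P env e c' s'"
      "eval P env (if c' = Atom 0 then e2 else e1) v' t0"
    have "c' = c" "s' = s" using eval_Cond.IH(1)[OF *(2)] by simp_all
    with eval_Cond.IH(2) * show ?thesis by blast
  qed
next
  case (eval_Bind env e u s b v t)
  show ?case
  proof (rule eval_BindE[OF eval_Bind.prems])
    fix u' s' t0
    assume *: "t' = s' + t0 + data_len v'" "eval P env e u' s'" "eval P (u' # env) b v' t0"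
    have "u' = u" "s' = s" using eval_Bind.IH(1)[OF *(2)] by simp_all
    with eval_Bind.IH(2) * show ?thesis by blast
  qed
next
  case (eval_Call f vs es ts env v t)
  show ?case
  proof (rule eval_CallE[OF eval_Call.prems])
    fix vs' ts' t0
    assume *: "t' = sum_list ts' + t0 + data_len v'" "length vs' = length es" "length ts' = length es"
      "\<forall>i<length es. eval P env (es ! i) (vs' ! i) (ts' ! i)" "eval P vs' (P ! f) v' t0"
    have eq: "vs' ! i = vs ! i \<and> ts' ! i = ts ! i" if "i < length es" for i
      using eval_Call.IH(1) *(4) that by blast
    have "vs' = vs" "ts' = ts"
      using eq eval_Call.hyps *(2,3) by (simp_all add: list_eq_iff_nth_eq)
    with * eval_Call.IH(2) show ?thesis by blast
  qed
qed


section \<open>Minimization problems and approximation schemes\<close>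

text \<open>
  \<open>denotes M i v s\<close>: for instance \<open>i\<close>, the output \<open>v\<close> is a code of the solution \<open>s\<close>.
\<close>

record ('i, 's) min_problem =
  instances :: "'i set"
  encode :: "'i \<Rightarrow> data"
  denotes :: "'i \<Rightarrow> data \<Rightarrow> 's \<Rightarrow> bool"
  feasible :: "'i \<Rightarrow> 's set"
  cost :: "'i \<Rightarrow> 's \<Rightarrow> rat"

text \<open>Only meaningful if \<open>feasible M i\<close> is finite and nonempty.\<close>

definition OPT :: "('i, 's) min_problem \<Rightarrow> 'i \<Rightarrow> rat" where
  "OPT M i = Min (cost M i ` feasible M i)"

text \<open>
  The program has to stop within the time bound on every instance; its output is unconstrained
  on instances without any feasible solution.
\<close>

definition poly_time_approx :: "('i, 's) min_problem \<Rightarrow> real \<Rightarrow> program \<Rightarrow> bool" where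
  "poly_time_approx M \<rho> P \<longleftrightarrow>
     (\<exists>q :: nat poly. \<forall>i \<in> instances M. \<exists>v t.
        runs P (encode M i) v t \<and> t \<le> poly q (data_len (encode M i)) \<and>
        (feasible M i \<noteq> {} \<longrightarrow>
           (\<exists>s \<in> feasible M i. denotes M i v s \<and>
              real_of_rat (cost M i s) \<le> \<rho> * real_of_rat (OPT M i))))"

definition has_PTAS :: "('i, 's) min_problem \<Rightarrow> bool" where
  "has_PTAS M \<longleftrightarrow> (\<forall>\<epsilon>::real. \<epsilon> > 0 \<longrightarrow> (\<exists>P. poly_time_approx M (1 + \<epsilon>) P))"


section \<open>Spiders\<close>

text \<open>
  The point \<open>(l, x)\<close> lies on leg \<open>l\<close> at distance \<open>x\<close> from the center; all \<open>(l, 0)\<close> are names of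
  the center. Distances are rational, so that instances are finite objects.
\<close>

type_synonym point = "nat \<times> rat"

definition spider :: "nat \<Rightarrow> point set" where
  "spider d = {(l, x). l < d \<and> 0 \<le> x}"

fun spider_dist :: "point \<Rightarrow> point \<Rightarrow> rat" where
  "spider_dist (l, x) (l', x') = (if l = l' then \<bar>x - x'\<bar> else x + x')"

definition encode_list :: "data list \<Rightarrow> data" where
  "encode_list vs = foldr Pair vs (Atom 0)"

text \<open>A nonnegative rational is given by its reduced fraction.\<close>

definition encode_rat :: "rat \<Rightarrow> data" where
  "encode_rat x = (case quotient_of x of (a, b) \<Rightarrow> Pair (Atom (nat a)) (Atom (nat b)))"

definition encode_point :: "point \<Rightarrow> data" where
  "encode_point p = Pair (Atom (fst p)) (encode_rat (snd p))"


section \<open>Min-max r-gather clustering\<close>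

text \<open>
  Users (and, below, facilities) are the indices of the list of their locations, so several of them
  may share a location.
\<close>

record clustering_instance =
  num_legs :: nat
  users :: "point list"
  min_size :: nat

definition clusterings :: "clustering_instance \<Rightarrow> nat set set set" where
  "clusterings I = {C. partition_on {..<length (users I)} C \<and> (\<forall>A\<in>C. min_size I \<le> card A)}"

definition cluster_diameter :: "clustering_instance \<Rightarrow> nat set \<Rightarrow> rat" where
  "cluster_diameter I A = Max ((\<lambda>(u, w). spider_dist (users I ! u) (users I ! w)) ` (A \<times> A))"

text \<open>Here and below, the inserted 0 only matters if there are no users.\<close>

definition clustering_cost :: "clustering_instance \<Rightarrow> nat set set \<Rightarrow> rat" where
  "clustering_cost I C = Max (insert 0 (cluster_diameter I ` C))"

definition encode_clustering_instance :: "clustering_instance \<Rightarrow> data" where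
  "encode_clustering_instance I =
     encode_list [Atom (num_legs I), Atom (min_size I), encode_list (map encode_point (users I))]"

definition clustering_problem :: "(clustering_instance, nat set set) min_problem" where
  "clustering_problem =
     \<lparr> instances = {I. 0 < min_size I \<and> set (users I) \<subseteq> spider (num_legs I)},
       encode = encode_clustering_instance,
       denotes = (\<lambda>_ v C. \<exists>uss. v = encode_list (map (encode_list \<circ> map Atom) uss) \<and> C = set ` set uss),
       feasible = clusterings,
       cost = clustering_cost \<rparr>"

lemma finite_clusterings: "finite (clusterings I)"
  unfolding clusterings_def
  by (rule finite_subset[OF _ finitely_many_partition_on[of "{..<length (users I)}"]]) auto


section \<open>Min-max r-gathering\<close>

record gathering_instance = clustering_instance +
  facilities :: "point list"

definition gatherings :: "gathering_instance \<Rightarrow> (nat \<Rightarrow> nat) set" where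
  "gatherings I =
     {\<pi> \<in> {..<length (users I)} \<rightarrow>\<^sub>E {..<length (facilities I)}.
        \<forall>f<length (facilities I).
          card {u \<in> {..<length (users I)}. \<pi> u = f} \<in> {0} \<union> {min_size I..}}"

definition gathering_cost :: "gathering_instance \<Rightarrow> (nat \<Rightarrow> nat) \<Rightarrow> rat" where
  "gathering_cost I \<pi> =
     Max (insert 0 ((\<lambda>u. spider_dist (users I ! u) (facilities I ! \<pi> u)) ` {..<length (users I)}))"

definition encode_gathering_instance :: "gathering_instance \<Rightarrow> data" where
  "encode_gathering_instance I =
     encode_list [Atom (num_legs I), Atom (min_size I), encode_list (map encode_point (users I)),
       encode_list (map encode_point (facilities I))]"

definition gathering_problem :: "(gathering_instance, nat \<Rightarrow> nat) min_problem" where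
  "gathering_problem =
     \<lparr> instances = {I. 0 < min_size I \<and>
         set (users I) \<subseteq> spider (num_legs I) \<and> set (facilities I) \<subseteq> spider (num_legs I)},
       encode = encode_gathering_instance,
       denotes = (\<lambda>I v \<pi>. v = encode_list (map (Atom \<circ> \<pi>) [0..<length (users I)])),
       feasible = gatherings,
       cost = gathering_cost \<rparr>"

lemma finite_gatherings: "finite (gatherings I)"
  unfolding gatherings_def
  by (rule finite_subset[OF _ finite_PiE[of "{..<length (users I)}" "\<lambda>_. {..<length (facilities I)}"]]) auto

end

theory Submission
  imports Defs "HOL-Library.Product_Lexorder"
begin

text \<open>
  A spider is a tree metric, so a set of diameter \<open>2\<rho>\<close> lies in the ball of radius \<open>\<rho>\<close> around the midpoint
  of a diametral pair, and conversely. Clustering is therefore gathering with the midpoints of all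
  pairs of users as facilities, up to a factor of 2 in the objective.

  For gathering, let \<open>B\<close> run through the user-facility distances and round all positions down to
  multiples of \<open>B / N\<close>, where \<open>N\<close> is of order \<open>1 / \<epsilon>\<close>. This costs a factor \<open>1 + O(1 / N)\<close> and leaves a
  problem with integral positions and the constant radius \<open>N\<close>, which is solved exactly by a sweep over
  the legs, each from the center outwards. A user assigned to a facility of its own leg goes into one
  of \<open>2N + 1\<close> slots, given by the position of the facility modulo \<open>2N + 1\<close>; slots are not reused too
  early because the window of users reaching a facility has that width. Whether a user and a facility on
  different legs are compatible depends only on the distance of the facility from the center, which is
  one of \<open>N + 1\<close> values, so for these pairs it suffices to count the demanded and the supplied users of
  every value and to match them arbitrarily in the end. Hence only \<open>O(N)\<close> counters bounded by the number
  of users matter, and there are polynomially many states.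

  That the resulting program runs in polynomial time is read off from its definition by closure
  properties of the functions computable in polynomial time.
\<close>

section \<open>Encodings and their sizes\<close>

text \<open>A state has to carry actual users, since an assignment must be output, but what can
  still happen to it depends only on the number of items under each tag. Hence one representative
  per vector of counts is kept, and completeness can only claim that some kept state has the counts
  prescribed by a given assignment, not its users. Likewise a user counted for another leg may
  finally be matched with a facility of its own leg; this is harmless, because
  \<open>x + y \<le> T\<close> implies \<open>\<bar>x - y\<bar> \<le> T\<close>.

  The radius \<open>B\<close> is a divisor, while the optimum may be 0. So 1 is added to every
  candidate, after scaling all positions to multiples of \<open>N\<close>: a nonzero distance
  \<open>m\<close> is then at least \<open>N\<close>, and
  \<open>m + 1 \<le> (1 + 1 / N) * m\<close>. Together with two roundings of less than
  \<open>B / N\<close> each, this gives the ratio \<open>(N + 2) * (N + 1) / (N * N)\<close>. For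
  midpoints to be multiples of \<open>N\<close> as well, clustering scales by \<open>2 * N\<close>.

  Facilities in one cell are merged. As loads are bounded only from below, merging destroys no
  solution, and the merged load can be given to any one of them.\<close>

class enc =
  fixes enc :: "'a \<Rightarrow> data"

instantiation nat :: enc
begin
definition enc_nat :: "nat \<Rightarrow> data" where "enc_nat = Atom"
instance ..
end

instantiation bool :: enc
begin
definition enc_bool :: "bool \<Rightarrow> data" where "enc_bool b = Atom (if b then 1 else 0)"
instance ..
end

instantiation prod :: (enc, enc) enc
begin
definition enc_prod :: "'a \<times> 'b \<Rightarrow> data" where "enc_prod p = Pair (enc (fst p)) (enc (snd p))"
instance ..
end

instantiation list :: (enc) enc
begin
definition enc_list :: "'a list \<Rightarrow> data" where "enc_list xs = encode_list (map enc xs)"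
instance ..
end

lemma enc_simps [simp]:
  "enc (n::nat) = Atom n" "enc b = Atom (if b then 1 else 0)"
  "enc (x, y) = Pair (enc x) (enc y)"
  "enc [] = Atom 0" "enc (x # xs) = Pair (enc x) (enc xs)"
  by (simp_all add: enc_nat_def enc_bool_def enc_prod_def enc_list_def encode_list_def)

abbreviation sz :: "'a::enc \<Rightarrow> nat" where "sz x \<equiv> data_len (enc x)"

lemma floorlog_0 [simp]: "floorlog b 0 = 0"
  by (simp add: floorlog_def)

lemma data_len_pos [simp]: "0 < data_len d"
  by (cases d) auto

lemma sz_fst: "sz (fst p) \<le> sz p" and sz_snd: "sz (snd p) \<le> sz p"
  by (cases p; simp)+

lemma sz_append: "sz (xs @ ys) + 1 = sz xs + sz ys"
  by (induction xs) auto

lemma sz_list: "sz xs = 1 + (\<Sum>x\<leftarrow>xs. 1 + sz x)"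
  by (induction xs) auto

lemma sz_rev [simp]: "sz (rev xs) = sz xs"
  by (simp add: sz_list rev_map[symmetric] del: enc_simps)

lemma sz_perm: "mset xs = mset ys \<Longrightarrow> sz xs = sz ys"
  by (metis (no_types, lifting) mset_map sum_mset_sum_list sz_list)

lemma length_le_sz: "length xs < sz xs"
  by (induction xs) auto

lemma sz_member: "x \<in> set xs \<Longrightarrow> sz x < sz xs"
  by (induction xs) auto

lemma sz_list_le: "(\<And>x. x \<in> set xs \<Longrightarrow> sz x \<le> b) \<Longrightarrow> sz xs \<le> 1 + length xs * (1 + b)"
proof (induction xs)
  case (Cons a xs)
  then have "sz a \<le> b" "sz xs \<le> 1 + length xs * (1 + b)" by auto
  then show ?case by simp
qed simp

lemma sz_filter: "sz (filter P xs) \<le> sz xs"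
  by (induction xs) auto

lemma floorlog_le_self: "floorlog 2 n \<le> n"
  by (rule floorlog_leI) auto

lemma sz_nat_le: "sz (n::nat) \<le> n + 1"
  using floorlog_le_self[of n] by simp

lemma nat_less_pow_floorlog: "n < 2 ^ floorlog 2 n"
  by (cases "n = 0") (use floorlog_bounds[of n 2] in auto)

lemma floorlog_add: "floorlog 2 (m + n) \<le> 1 + floorlog 2 m + floorlog 2 n"
proof (rule floorlog_leI)
  have "m < 2 ^ (floorlog 2 m + floorlog 2 n)" "n < 2 ^ (floorlog 2 m + floorlog 2 n)"
    using nat_less_pow_floorlog[of m] nat_less_pow_floorlog[of n]
    by (smt (verit) le_add1 le_add2 less_le_trans one_le_numeral power_increasing)+
  then show "m + n < 2 ^ (1 + floorlog 2 m + floorlog 2 n)" by simp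
qed auto

lemma floorlog_mult: "floorlog 2 (m * n) \<le> floorlog 2 m + floorlog 2 n"
proof (rule floorlog_leI)
  show "m * n < 2 ^ (floorlog 2 m + floorlog 2 n)"
    unfolding power_add
    by (intro mult_strict_mono' nat_less_pow_floorlog) auto
qed auto

lemma floorlog_1 [simp]: "floorlog 2 (Suc 0) = 1"
  by (simp add: floorlog_def)

lemma sz_bool: "sz (b::bool) \<le> 2"
  by simp

section \<open>Polynomial-time functions\<close>

text \<open>A bare power of \<open>sz x + 1\<close> is enough: the base is at least 2, so a larger
  exponent absorbs constants, factors and sums, and no coefficients have to be carried
  along.\<close>

definition polybd :: "('a::enc \<Rightarrow> nat) \<Rightarrow> bool" where
  "polybd g \<longleftrightarrow> (\<exists>k. \<forall>x. g x \<le> (sz x + 1) ^ k)"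

named_theorems polybd_intros

lemma sz_ge_2: "2 \<le> sz x + 1"
  using data_len_pos[of "enc x"] by linarith

lemma polybd_mono: "polybd g \<Longrightarrow> (\<And>x. f x \<le> g x) \<Longrightarrow> polybd f"
  unfolding polybd_def by (meson le_trans)

lemma polybd_const [polybd_intros]: "polybd (\<lambda>_. c)"
  unfolding polybd_def
proof (intro exI allI)
  fix x :: 'a
  have "c \<le> 2 ^ c" by (simp add: less_imp_le_nat)
  also have "\<dots> \<le> (sz x + 1) ^ c" by (rule power_mono[OF sz_ge_2]) simp
  finally show "c \<le> (sz x + 1) ^ c" .
qed

lemma polybd_sz [polybd_intros]: "polybd sz"
  unfolding polybd_def by (intro exI[of _ 1]) simp

lemma polybd_mult [polybd_intros]:
  assumes "polybd f" "polybd g" shows "polybd (\<lambda>x. f x * g x)"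
proof -
  from assms obtain i j where "\<And>x. f x \<le> (sz x + 1) ^ i" "\<And>x. g x \<le> (sz x + 1) ^ j"
    unfolding polybd_def by metis
  then have "f x * g x \<le> (sz x + 1) ^ (i + j)" for x
    unfolding power_add by (intro mult_mono) auto
  then show ?thesis unfolding polybd_def by blast
qed

text \<open>Sums reduce to products by \<open>f x + g x \<le> (f x + 1) * (g x + 1)\<close>, and
  adding 1 at most doubles a power, that is, costs one more in the exponent.\<close>

lemma polybd_add [polybd_intros]:
  assumes "polybd f" "polybd g" shows "polybd (\<lambda>x. f x + g x)"
proof -
  have "polybd (\<lambda>x. h x + 1)" if "polybd h" for h :: "'a \<Rightarrow> nat"
  proof -
    from that obtain i where i: "\<And>x. h x \<le> (sz x + 1) ^ i" unfolding polybd_def by metis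
    have "h x + 1 \<le> (sz x + 1) ^ (Suc i)" for x
    proof -
      have "h x + 1 \<le> 2 * (sz x + 1) ^ i" using i[of x] one_le_power[of "sz x + 1" i] by linarith
      also have "\<dots> \<le> (sz x + 1) * (sz x + 1) ^ i" using sz_ge_2 by (rule mult_right_mono) simp
      finally show ?thesis by simp
    qed
    then show ?thesis unfolding polybd_def by blast
  qed
  from polybd_mult[OF this[OF assms(1)] this[OF assms(2)]]
  have "polybd (\<lambda>x. (f x + 1) * (g x + 1))" .
  then show ?thesis by (rule polybd_mono) simp
qed

lemma polybd_power [polybd_intros]: "polybd f \<Longrightarrow> polybd (\<lambda>x. f x ^ k)"
  by (induction k) (simp_all add: polybd_const polybd_mult)

text \<open>The bound on \<open>g\<close> is a power of the size of its argument and hence monotone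
  in it, even where \<open>g\<close> is not; so a polynomial bound on the size of \<open>f x\<close>
  suffices.\<close>

lemma polybd_comp:
  fixes g :: "'b::enc \<Rightarrow> nat" and f :: "'a::enc \<Rightarrow> 'b"
  assumes "polybd g" "polybd (\<lambda>x. sz (f x))" shows "polybd (\<lambda>x. g (f x))"
proof -
  from assms(1) obtain k where k: "\<And>y. g y \<le> (sz y + 1) ^ k" unfolding polybd_def by metis
  have "polybd (\<lambda>x. (sz (f x) + 1) ^ k)" by (intro polybd_intros assms)
  then show ?thesis by (rule polybd_mono) (rule k)
qed

text \<open>Relocation, needed to link programs.\<close>

primrec shift :: "nat \<Rightarrow> expr \<Rightarrow> expr" where
  "shift k (Var i) = Var i"
| "shift k (Const n) = Const n"
| "shift k (Prim p es) = Prim p (map (shift k) es)"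
| "shift k (Cond e e1 e2) = Cond (shift k e) (shift k e1) (shift k e2)"
| "shift k (Bind e b) = Bind (shift k e) (shift k b)"
| "shift k (Call f es) = Call (k + f) (map (shift k) es)"

lemma shift_0: "shift 0 e = e"
  by (induction e) (auto intro: map_idI)

lemma eval_shift:
  "eval P env e v t \<Longrightarrow> eval (Q @ map (shift (length Q)) P @ R) env (shift (length Q) e) v t"
proof (induction rule: eval.induct)
  case (eval_Const env n)
  show ?case using eval.eval_Const by simp
next
  case (eval_Prim vs es ts env p v)
  then show ?case by (auto intro!: eval.eval_Prim)
next
  case (eval_Cond env e c s e2 e1 v t)
  then show ?case by (auto intro!: eval.eval_Cond split: if_splits)
next
  case (eval_Call f vs es ts env v t)
  then show ?case by (auto intro!: eval.eval_Call simp: nth_append)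
qed (auto intro: eval.intros)

lemma eval_append_program: "eval P env e v t \<Longrightarrow> eval (P @ R) env e v t"
  using eval_shift[of P env e v t "[]" R] by (simp add: shift_0 cong: map_cong)

text \<open>Variable indices count from the front of the environment, so values appended at the back
  are invisible to an expression that already evaluates. Code made for a single argument can thus be
  the body of a \<open>Bind\<close> that supplies this argument.\<close>

lemma eval_append_env: "eval P env e v t \<Longrightarrow> eval P (env @ env') e v t"
proof (induction rule: eval.induct)
  case (eval_Const env n)
  show ?case by (rule eval.eval_Const)
next
  case (eval_Var i env)
  then show ?case using eval.eval_Var[of i "env @ env'" P] by (simp add: nth_append)
next
  case (eval_Bind env e u s b v t)
  then show ?case by (auto intro!: eval.eval_Bind)
qed (auto intro: eval.intros)

text \<open>The argument is the only entry of the environment, and \<open>P\<close> merely holds the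
  functions that \<open>e\<close> may call. Keeping the expression apart from the program makes
  composition a \<open>Bind\<close> and confines relocation to the indices of calls.\<close>

definition computes :: "program \<Rightarrow> expr \<Rightarrow> ('a::enc \<Rightarrow> nat) \<Rightarrow> ('a \<Rightarrow> 'b::enc) \<Rightarrow> bool" where
  "computes P e c f \<longleftrightarrow> polybd c \<and> (\<forall>x. \<exists>t\<le>c x. eval P [enc x] e (enc (f x)) t)"

definition polytime :: "('a::enc \<Rightarrow> 'b::enc) \<Rightarrow> bool" where
  "polytime f \<longleftrightarrow> (\<exists>P e c. computes P e c f)"

lemma computesI: "polybd c \<Longrightarrow> (\<And>x. \<exists>t\<le>c x. eval P [enc x] e (enc (f x)) t) \<Longrightarrow> computes P e c f"
  by (simp add: computes_def)

lemma computes_shift: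
  "computes P e c f \<Longrightarrow> computes (Q @ map (shift (length Q)) P @ R) (shift (length Q) e) c f"
  unfolding computes_def by (meson eval_shift)

text \<open>Every rule charges the length of the value it returns. So running time bounds output
  length, and the size bounds for later stages come for free.\<close>

lemma eval_cost_ge: "eval P env e v t \<Longrightarrow> data_len v \<le> t"
  by (induction rule: eval.induct) auto

lemma polytime_sz: "polytime f \<Longrightarrow> polybd (\<lambda>x. sz (f x))"
  unfolding polytime_def computes_def by (meson eval_cost_ge le_trans polybd_mono)

text \<open>The first program keeps its place and the second is relocated behind it, so that one
  program serves both functions.\<close>

lemma polytime_linked:
  assumes "polytime f" "polytime g"
  obtains P e c e' c' where "computes P e c f" "computes P e' c' g"
proof -
  from assms obtain P e c P' e' c' where *: "computes P e c f" "computes P' e' c' g"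
    unfolding polytime_def by blast
  have "computes (P @ map (shift (length P)) P') e c f"
    using *(1) unfolding computes_def by (meson eval_append_program)
  moreover have "computes (P @ map (shift (length P)) P') (shift (length P) e') c' g"
    using computes_shift[OF *(2), of P "[]"] by simp
  ultimately show ?thesis by (rule that)
qed

lemma eval_Prim1:
  "eval P env e v t \<Longrightarrow> apply_primop p [v] = Some w \<Longrightarrow> eval P env (Prim p [e]) w (t + data_len w)"
  using eval_Prim[of "[v]" "[e]" "[t]" P env p w] by simp

lemma eval_Prim2:
  "eval P env e v t \<Longrightarrow> eval P env e' v' t' \<Longrightarrow> apply_primop p [v, v'] = Some w \<Longrightarrow>
   eval P env (Prim p [e, e']) w (t + t' + data_len w)"
  using eval_Prim[of "[v, v']" "[e, e']" "[t, t']" P env p w] by (simp add: less_Suc_eq nth_Cons')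

lemma eval_Var0: "eval P (v # env) (Var 0) v (data_len v)"
  using eval_Var[of 0 "v # env"] by simp

lemma eval_Var1: "eval P (u # v # env) (Var 1) v (data_len v)"
  using eval_Var[of 1 "u # v # env"] by simp

lemma eval_Var2: "eval P (u # v # w # env) (Var 2) w (data_len w)"
  using eval_Var[of 2 "u # v # w # env"] by simp

section \<open>Closure properties of polynomial-time functions\<close>

named_theorems polytime_intros

lemma polytime_comp:
  assumes "polytime g" "polytime f" shows "polytime (\<lambda>x. g (f x))"
proof -
  from assms obtain P e c e' c' where *: "computes P e c f" "computes P e' c' g"
    by (rule polytime_linked)
  have "computes P (Bind e e') (\<lambda>x. c x + c' (f x) + sz (g (f x))) (\<lambda>x. g (f x))"
  proof (rule computesI)
    have sf: "polybd (\<lambda>x. sz (f x))" by (rule polytime_sz[OF assms(2)])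
    show "polybd (\<lambda>x. c x + c' (f x) + sz (g (f x)))"
      using * unfolding computes_def
      by (intro polybd_intros polybd_comp[OF polytime_sz[OF assms(1)] sf] polybd_comp[OF _ sf]) auto
  next
    fix x
    obtain t where t: "t \<le> c x" "eval P [enc x] e (enc (f x)) t"
      using *(1) unfolding computes_def by blast
    obtain t' where t': "t' \<le> c' (f x)" "eval P [enc (f x)] e' (enc (g (f x))) t'"
      using *(2) unfolding computes_def by blast
    have "eval P (enc (f x) # [enc x]) e' (enc (g (f x))) t'"
      using eval_append_env[OF t'(2), of "[enc x]"] by simp
    from eval_Bind[OF t(2) this] t(1) t'(1)
    show "\<exists>t\<le>c x + c' (f x) + sz (g (f x)). eval P [enc x] (Bind e e') (enc (g (f x))) t"
      by (intro exI conjI) auto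
  qed
  then show ?thesis unfolding polytime_def by blast
qed

lemma polytime_Pair [polytime_intros]:
  assumes "polytime f" "polytime g" shows "polytime (\<lambda>x. (f x, g x))"
proof -
  from assms obtain P e c e' c' where *: "computes P e c f" "computes P e' c' g"
    by (rule polytime_linked)
  have "computes P (Prim MkPair [e, e']) (\<lambda>x. c x + c' x + (sz (f x) + sz (g x) + 1)) (\<lambda>x. (f x, g x))"
  proof (rule computesI)
    show "polybd (\<lambda>x. c x + c' x + (sz (f x) + sz (g x) + 1))"
      using * unfolding computes_def
      by (intro polybd_intros polytime_sz[OF assms(1)] polytime_sz[OF assms(2)]) auto
  next
    fix x
    obtain t where t: "t \<le> c x" "eval P [enc x] e (enc (f x)) t"
      using *(1) unfolding computes_def by blast
    obtain t' where t': "t' \<le> c' x" "eval P [enc x] e' (enc (g x)) t'"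
      using *(2) unfolding computes_def by blast
    from eval_Prim2[OF t(2) t'(2), of MkPair "enc (f x, g x)"] t(1) t'(1)
    show "\<exists>t\<le>c x + c' x + (sz (f x) + sz (g x) + 1). eval P [enc x] (Prim MkPair [e, e']) (enc (f x, g x)) t"
      by (intro exI conjI) auto
  qed
  then show ?thesis unfolding polytime_def by blast
qed

lemma polytime_simple:
  assumes "\<And>x. eval [] [enc x] e (enc (f x)) (c x)" "polybd c"
  shows "polytime f"
  using assms unfolding polytime_def computes_def by blast

lemma polytime_id [polytime_intros]: "polytime (\<lambda>x. x)"
  by (rule polytime_simple[OF eval_Var0 polybd_sz])

lemma polytime_nat [polytime_intros]: "polytime (\<lambda>_. n::nat)"
  by (rule polytime_simple[of "Const n" _ "\<lambda>_. data_len (Atom n)"])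
    (auto simp: eval_Const simp del: data_len.simps intro: polybd_intros)

lemma polytime_basic1:
  assumes "\<And>x. apply_primop p [enc x] = Some (enc (f x))" "polybd (\<lambda>x. sz (f x))"
  shows "polytime f"
  by (rule polytime_simple[OF eval_Prim1[OF eval_Var0 assms(1)]]) (intro polybd_intros assms)

text \<open>Computable functions take a single argument here; a binary primitive is therefore
  realized on pairs and then composed with \<open>(g x, h x)\<close>.\<close>

lemma polytime_basic2:
  fixes f :: "'a::enc \<Rightarrow> 'b::enc \<Rightarrow> 'c::enc"
  assumes "\<And>x y. apply_primop p [enc x, enc y] = Some (enc (f x y))" "polybd (\<lambda>(x, y). sz (f x y))"
    and "polytime g" "polytime h"
  shows "polytime (\<lambda>x. f (g x) (h x))"
proof -
  let ?e = "Prim p [Prim First [Var 0], Prim Second [Var 0]]"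
  have "polytime (\<lambda>z. f (fst z) (snd z))"
  proof (rule polytime_simple[of ?e])
    fix z :: "'a \<times> 'b"
    show "eval [] [enc z] ?e (enc (f (fst z) (snd z)))
      ((sz z + sz (fst z)) + (sz z + sz (snd z)) + sz (f (fst z) (snd z)))"
      by (rule eval_Prim2[OF eval_Prim1[OF eval_Var0] eval_Prim1[OF eval_Var0] assms(1)]) (cases z; simp)+
  next
    have "polybd (\<lambda>z. (sz z + sz z) + (sz z + sz z) + (case z of (x, y) \<Rightarrow> sz (f x y)))"
      by (intro polybd_intros assms(2))
    then show "polybd (\<lambda>z. (sz z + sz (fst z)) + (sz z + sz (snd z)) + sz (f (fst z) (snd z)))"
      by (rule polybd_mono) (simp add: split_beta add_mono sz_fst sz_snd)
  qed
  from polytime_comp[OF this polytime_Pair[OF assms(3,4)]] show ?thesis by simp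
qed

lemma polytime_fst [polytime_intros]: "polytime f \<Longrightarrow> polytime (\<lambda>x. fst (f x))"
  by (rule polytime_comp[OF polytime_basic1[of First fst]])
    (auto intro: polybd_mono[OF polybd_sz sz_fst])

lemma polytime_snd [polytime_intros]: "polytime f \<Longrightarrow> polytime (\<lambda>x. snd (f x))"
  by (rule polytime_comp[OF polytime_basic1[of Second snd]])
    (auto intro: polybd_mono[OF polybd_sz sz_snd])

lemma polytime_add [polytime_intros]:
  fixes f g :: "'a::enc \<Rightarrow> nat" shows "polytime f \<Longrightarrow> polytime g \<Longrightarrow> polytime (\<lambda>x. f x + g x)"
  by (rule polytime_basic2[of Plus], simp, rule polybd_mono[OF polybd_sz])
    (clarsimp, rule le_trans[OF floorlog_add], simp)

lemma polytime_mult [polytime_intros]: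
  fixes f g :: "'a::enc \<Rightarrow> nat" shows "polytime f \<Longrightarrow> polytime g \<Longrightarrow> polytime (\<lambda>x. f x * g x)"
  by (rule polytime_basic2[of Times], simp, rule polybd_mono[OF polybd_sz])
    (clarsimp, rule le_trans[OF floorlog_mult], simp)

lemma polytime_diff [polytime_intros]:
  fixes f g :: "'a::enc \<Rightarrow> nat" shows "polytime f \<Longrightarrow> polytime g \<Longrightarrow> polytime (\<lambda>x. f x - g x)"
  by (rule polytime_basic2[of Minus], simp, rule polybd_mono[OF polybd_sz])
    (clarsimp, rule le_trans[OF floorlog_mono], rule diff_le_self, simp)

lemma polytime_div [polytime_intros]:
  fixes f g :: "'a::enc \<Rightarrow> nat" shows "polytime f \<Longrightarrow> polytime g \<Longrightarrow> polytime (\<lambda>x. f x div g x)"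
  by (rule polytime_basic2[of Quot], simp, rule polybd_mono[OF polybd_sz])
    (clarsimp, rule le_trans[OF floorlog_mono], rule div_le_dividend, simp)

lemma polytime_le [polytime_intros]:
  fixes f g :: "'a::enc \<Rightarrow> nat" shows "polytime f \<Longrightarrow> polytime g \<Longrightarrow> polytime (\<lambda>x. f x \<le> g x)"
  by (rule polytime_basic2[of Leq], simp, rule polybd_mono[OF polybd_const[of 2]])
    (auto intro: sz_bool)

lemma polytime_Cons [polytime_intros]:
  "polytime f \<Longrightarrow> polytime g \<Longrightarrow> polytime (\<lambda>x. f x # g x)"
  by (rule polytime_basic2[of MkPair "(#)"], simp, rule polybd_mono[OF polybd_sz]) auto

lemma polytime_mod [polytime_intros]:
  fixes f g :: "'a::enc \<Rightarrow> nat" shows "polytime f \<Longrightarrow> polytime g \<Longrightarrow> polytime (\<lambda>x. f x mod g x)"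
  unfolding modulo_nat_def by (intro polytime_intros)

lemma polytime_if [polytime_intros]:
  fixes f g :: "'a::enc \<Rightarrow> 'b::enc"
  assumes "polytime b" "polytime f" "polytime g"
  shows "polytime (\<lambda>x. if b x then f x else g x)"
proof -
  let ?e = "Cond (Prim First [Var 0]) (Prim First [Prim Second [Var 0]]) (Prim Second [Prim Second [Var 0]])"
  let ?sel = "\<lambda>p :: bool \<times> 'b \<times> 'b. if fst p then fst (snd p) else snd (snd p)"
  let ?c = "\<lambda>p :: bool \<times> 'b \<times> 'b. (sz p + sz (fst p)) + (sz p + sz (snd p) + sz (?sel p)) + sz (?sel p)"
  have "polytime ?sel"
  proof (rule polytime_simple[of ?e])
    fix p :: "bool \<times> 'b \<times> 'b"
    obtain b x y where p: "p = (b, x, y)" by (cases p) auto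
    show "eval [] [enc p] ?e (enc (?sel p)) (?c p)"
    proof (rule eval_Cond[where c = "enc (fst p)"])
      show "eval [] [enc p] (Prim First [Var 0]) (enc (fst p)) (sz p + sz (fst p))"
        by (rule eval_Prim1[OF eval_Var0]) (simp add: p)
      have *: "eval [] [enc p] (Prim Second [Var 0]) (enc (snd p)) (sz p + sz (snd p))"
        by (rule eval_Prim1[OF eval_Var0]) (simp add: p)
      show "eval [] [enc p] (if enc (fst p) = Atom 0 then Prim Second [Prim Second [Var 0]]
        else Prim First [Prim Second [Var 0]]) (enc (?sel p)) (sz p + sz (snd p) + sz (?sel p))"
        using eval_Prim1[OF *, of Second "enc y"] eval_Prim1[OF *, of First "enc x"] by (auto simp: p)
    qed
  next
    have "polybd (\<lambda>p :: bool \<times> 'b \<times> 'b. (sz p + sz p) + (sz p + sz p + sz p) + sz p)"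
      by (intro polybd_intros)
    moreover have "sz (?sel p) \<le> sz p" for p by (cases p) auto
    ultimately show "polybd ?c"
      by (elim polybd_mono) (intro add_mono sz_fst sz_snd order_refl)
  qed
  from polytime_comp[OF this polytime_Pair[OF assms(1) polytime_Pair[OF assms(2,3)]]]
  show ?thesis unfolding fst_conv snd_conv .
qed

text \<open>A total head: \<open>polytime\<close> demands a computed value on every input, and for
  \<open>hd []\<close> none is specified.\<close>

definition headd :: "'a \<Rightarrow> 'a list \<Rightarrow> 'a" where
  "headd d xs = (case xs of [] \<Rightarrow> d | x # _ \<Rightarrow> x)"

lemma headd_simps [simp]: "headd d [] = d" "headd d (x # xs) = x"
  by (simp_all add: headd_def)

lemma polytime_nonempty [polytime_intros]: "polytime xs \<Longrightarrow> polytime (\<lambda>z. xs z \<noteq> [])"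
proof (rule polytime_comp[OF polytime_basic1[of IsPair "\<lambda>xs. xs \<noteq> []"]])
  show "apply_primop IsPair [enc ys] = Some (enc (ys \<noteq> []))" for ys :: "'b list"
    by (cases ys) auto
  show "polybd (\<lambda>ys :: 'b list. sz (ys \<noteq> []))"
    by (rule polybd_mono[OF polybd_const[of 2]]) (auto intro: sz_bool)
qed

lemma polytime_headd [polytime_intros]:
  assumes "polytime d" "polytime xs"
  shows "polytime (\<lambda>z. headd (d z) (xs z))"
proof -
  let ?s = "Prim Second [Var 0]"
  have "polytime (\<lambda>p :: 'b \<times> 'b list. headd (fst p) (snd p))"
  proof (rule polytime_simple)
    fix p :: "'b \<times> 'b list"
    obtain d xs where p: "p = (d, xs)" by (cases p)
    have s: "eval [] [enc p] ?s (enc xs) (sz p + sz xs)"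
      by (rule eval_Prim1[OF eval_Var0]) (simp add: p)
    have i: "eval [] [enc p] (Prim IsPair [?s]) (enc (xs \<noteq> [])) (sz p + sz xs + sz (xs \<noteq> []))"
      by (rule eval_Prim1[OF s]) (cases xs; simp)
    have f: "eval [] [enc p] (Prim First [Var 0]) (enc d) (sz p + sz d)"
      by (rule eval_Prim1[OF eval_Var0]) (simp add: p)
    have g: "eval [] [enc p] (Prim First [?s]) (enc (hd xs)) (sz p + sz xs + sz (hd xs))" if "xs \<noteq> []"
      by (rule eval_Prim1[OF s]) (use that in \<open>cases xs; simp\<close>)
    show "eval [] [enc p] (Cond (Prim IsPair [?s]) (Prim First [?s]) (Prim First [Var 0])) (enc (headd (fst p) (snd p)))
      (sz p + sz (snd p) + sz (snd p \<noteq> []) + (if snd p = [] then sz p + sz (fst p) else sz p + sz (snd p) + sz (hd (snd p)))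
        + sz (headd (fst p) (snd p)))"
      unfolding p fst_conv snd_conv
      by (rule eval_Cond[OF i[unfolded p]]) (use f g in \<open>cases xs; auto simp: p\<close>)
  next
    show "polybd (\<lambda>p. sz (p::'b \<times> 'b list) + sz (snd p) + sz (snd p \<noteq> []) +
       (if snd p = [] then sz p + sz (fst p) else sz p + sz (snd p) + sz (hd (snd p))) + sz (headd (fst p) (snd p)))"
    proof (rule polybd_mono)
      show "polybd (\<lambda>p. 10 * sz (p::'b \<times> 'b list))" by (intro polybd_intros)
      fix p :: "'b \<times> 'b list"
      obtain d xs where p: "p = (d, xs)" by (cases p)
      have "sz (xs \<noteq> []) \<le> 2" by (rule sz_bool)
      moreover have "3 \<le> sz p" using sz_ge_2[of d] sz_ge_2[of xs] unfolding p enc_simps data_len.simps by linarith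
      ultimately show "sz p + sz (snd p) + sz (snd p \<noteq> []) +
        (if snd p = [] then sz p + sz (fst p) else sz p + sz (snd p) + sz (hd (snd p))) + sz (headd (fst p) (snd p))
        \<le> 10 * sz p" by (cases xs) (auto simp: p)
    qed
  qed
  from polytime_comp[OF this polytime_Pair[OF assms]] show ?thesis by simp
qed

lemma polytime_tl [polytime_intros]: 
  assumes "polytime xs" shows "polytime (\<lambda>z. tl (xs z))"
proof -
  have "polytime (\<lambda>xs :: 'b list. tl xs)"
  proof (rule polytime_simple)
    fix xs :: "'b list"
    have i: "eval [] [enc xs] (Prim IsPair [Var 0]) (enc (xs \<noteq> [])) (sz xs + sz (xs \<noteq> []))"
      by (rule eval_Prim1[OF eval_Var0]) (cases xs; simp)
    have g: "eval [] [enc xs] (Prim Second [Var 0]) (enc (tl xs)) (sz xs + sz (tl xs))" if "xs \<noteq> []"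
      by (rule eval_Prim1[OF eval_Var0]) (use that in \<open>cases xs; simp\<close>)
    show "eval [] [enc xs] (Cond (Prim IsPair [Var 0]) (Prim Second [Var 0]) (Var 0)) (enc (tl xs))
      (sz xs + sz (xs \<noteq> []) + (if xs = [] then sz xs else sz xs + sz (tl xs)) + sz (tl xs))"
      by (rule eval_Cond[OF i]) (use g eval_Var0[of "[]" "Atom 0" "[]"] in auto)
  next
    show "polybd (\<lambda>xs :: 'b list. sz xs + sz (xs \<noteq> []) + (if xs = [] then sz xs else sz xs + sz (tl xs)) + sz (tl xs))"
    proof (rule polybd_mono)
      show "polybd (\<lambda>xs. 6 * sz (xs::'b list))" by (intro polybd_intros)
      fix xs :: "'b list"
      have "sz (xs \<noteq> []) \<le> 2" by (rule sz_bool)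
      moreover have "1 \<le> sz xs" using data_len_pos[of "enc xs"] by linarith
      ultimately show "sz xs + sz (xs \<noteq> []) + (if xs = [] then sz xs else sz xs + sz (tl xs)) + sz (tl xs) \<le> 6 * sz xs"
        by (cases xs) auto
    qed
  qed
  from polytime_comp[OF this assms] show ?thesis .
qed

section \<open>Bounded iteration over a list\<close>

lemma eval_Call3:
  "\<lbrakk>f < length P; eval P env e1 v1 t1; eval P env e2 v2 t2; eval P env e3 v3 t3;
    eval P [v1, v2, v3] (P ! f) v t\<rbrakk> \<Longrightarrow>
   eval P env (Call f [e1, e2, e3]) v (t1 + t2 + t3 + t + data_len v)"
  using eval_Call[of f P "[v1, v2, v3]" "[e1, e2, e3]" "[t1, t2, t3]" env v t]
  by (simp add: less_Suc_eq nth_Cons' add.assoc)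

text \<open>Function 0 is a loop whose arguments are \<open>z\<close>, the remaining list and the
  accumulator. \<open>S\<close> bounds the parameter, the list and the accumulator after every
  prefix. A round then costs \<open>C\<close> for the step and a constant multiple of
  \<open>S\<close> for rebuilding the arguments and for returning the final value, which every
  enclosing call is charged again. The constant 30 is generous slack.\<close>

lemma eval_foldl:
  fixes h :: "'z::enc \<Rightarrow> 'a::enc \<Rightarrow> 'x::enc \<Rightarrow> 'a"
  assumes P: "P ! 0 = Cond (Prim IsPair [Var 1]) (Call 0 [Var 0, Prim Second [Var 1],
      Bind (Prim MkPair [Var 0, Prim MkPair [Var 2, Prim First [Var 1]]]) k]) (Var 2)"
    (is "_ = ?body") "0 < length P"
    and k: "\<And>a x. sz a \<le> S \<Longrightarrow> sz x \<le> S \<Longrightarrow> \<exists>t\<le>C. eval P [enc (z, a, x)] k (enc (h z a x)) t"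
    and S: "sz z \<le> S" "sz xs \<le> S" "\<And>ys zs. xs = ys @ zs \<Longrightarrow> sz (foldl (h z) a ys) \<le> S"
  shows "\<exists>t \<le> (length xs + 1) * (C + 30 * S + 30).
    eval P [enc z, enc xs, enc a] (P ! 0) (enc (foldl (h z) a xs)) t"
  using S
proof (induction xs arbitrary: a)
  case Nil
  have i: "eval P [enc z, enc ([]::'x list), enc a] (Prim IsPair [Var 1]) (Atom 0) (1 + data_len (Atom 0))"
    using eval_Prim1[OF eval_Var1[of P "enc z" "Atom 0" "[enc a]"], of IsPair "Atom 0"] by (simp del: One_nat_def add: numeral_2_eq_2)
  have "eval P [enc z, enc ([]::'x list), enc a] ?body (enc (foldl (h z) a [])) (1 + data_len (Atom 0) + sz a + sz a)"
    using eval_Cond[OF i] eval_Var2 by simp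
  moreover have "1 + data_len (Atom 0) + sz a + sz a \<le> (length ([]::'x list) + 1) * (C + 30 * S + 30)"
    using Nil.prems(3)[of "[]" "[]"] by simp
  ultimately show ?case unfolding P by blast
next
  case (Cons x xs)
  let ?env = "[enc z, enc (x # xs), enc a]"
  have x: "sz x \<le> S" "sz xs \<le> S" using Cons.prems(2) by auto
  have a: "sz a \<le> S" "sz (h z a x) \<le> S" "sz (foldl (h z) a (x # xs)) \<le> S"
    using Cons.prems(3)[of "[]" "x # xs"] Cons.prems(3)[of "[x]" "xs"] Cons.prems(3)[of "x # xs" "[]"]
    by auto
  have pref: "sz (foldl (h z) (h z a x) ys) \<le> S" if "xs = ys @ zs" for ys zs
    using Cons.prems(3)[of "x # ys" zs] that by simp
  obtain t where t: "t \<le> (length xs + 1) * (C + 30 * S + 30)"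
    "eval P [enc z, enc xs, enc (h z a x)] (P ! 0) (enc (foldl (h z) a (x # xs))) t"
    using Cons.IH[OF Cons.prems(1) x(2), of "h z a x"] pref unfolding foldl.simps by blast
  obtain t' where t': "t' \<le> C" "eval P [enc (z, a, x)] k (enc (h z a x)) t'"
    using k[OF a(1) x(1)] by blast
  have 1: "eval P ?env (Prim IsPair [Var 1]) (Atom 1) (sz (x # xs) + data_len (Atom 1))"
    by (rule eval_Prim1[OF eval_Var1]) simp
  have 2: "eval P ?env (Prim Second [Var 1]) (enc xs) (sz (x # xs) + sz xs)"
    by (rule eval_Prim1[OF eval_Var1]) simp
  have 3: "eval P ?env (Prim First [Var 1]) (enc x) (sz (x # xs) + sz x)"
    by (rule eval_Prim1[OF eval_Var1]) simp
  have 4: "eval P ?env (Prim MkPair [Var 2, Prim First [Var 1]]) (enc (a, x))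
    (sz a + (sz (x # xs) + sz x) + sz (a, x))"
    by (rule eval_Prim2[OF eval_Var2 3]) simp
  have 5: "eval P ?env (Prim MkPair [Var 0, Prim MkPair [Var 2, Prim First [Var 1]]]) (enc (z, a, x))
    (sz z + (sz a + (sz (x # xs) + sz x) + sz (a, x)) + sz (z, a, x))"
    by (rule eval_Prim2[OF eval_Var0 4]) simp
  \<comment> \<open>The step was compiled for the triple alone; the loop variables behind it do no
    harm.\<close>
  have "eval P (enc (z, a, x) # ?env) k (enc (h z a x)) t'"
    using eval_append_env[OF t'(2), of ?env] by simp
  note 6 = eval_Bind[OF 5 this]
  note 7 = eval_Call3[OF P(2) eval_Var0 2 6 t(2)]
  have 8: "eval P ?env ?body (enc (foldl (h z) a (x # xs))) (sz (x # xs) + data_len (Atom 1) +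
     (sz z + (sz (x # xs) + sz xs) +
      (sz z + (sz a + (sz (x # xs) + sz x) + sz (a, x)) + sz (z, a, x) + t' + sz (h z a x)) +
      t + sz (foldl (h z) a (x # xs))) + sz (foldl (h z) a (x # xs)))"
    by (rule eval_Cond[OF 1]) (use 7 in simp)
  have "sz (a, x) = 1 + sz a + sz x" "sz (z, a, x) = 2 + sz z + sz a + sz x"
    "data_len (Atom 1) = 2" by (simp_all add: floorlog_1[simplified One_nat_def])
  then have "sz (x # xs) + data_len (Atom 1) +
     (sz z + (sz (x # xs) + sz xs) +
      (sz z + (sz a + (sz (x # xs) + sz x) + sz (a, x)) + sz (z, a, x) + t' + sz (h z a x)) +
      t + sz (foldl (h z) a (x # xs))) + sz (foldl (h z) a (x # xs)) \<le> t + (C + 30 * S + 30)"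
    using a x Cons.prems(1,2) t'(1) by linarith
  also have "\<dots> \<le> (length (x # xs) + 1) * (C + 30 * S + 30)" using t(1) by simp
  finally show ?case using 8 unfolding P by blast
qed

text \<open>
  The only recursion scheme of the calculus. Without a bound on the intermediate accumulators an
  iteration of polynomial-time steps could square its value in every round.
\<close>

lemma polytime_foldl:
  fixes h :: "'z::enc \<Rightarrow> 'a::enc \<Rightarrow> 'x::enc \<Rightarrow> 'a"
  assumes h: "polytime (\<lambda>p. h (fst p) (fst (snd p)) (snd (snd p)))"
    and a: "polytime a" and xs: "polytime xs"
    and b: "polybd b" "\<And>z ys zs. xs z = ys @ zs \<Longrightarrow> sz (foldl (h z) (a z) ys) \<le> b z"
  shows "polytime (\<lambda>z. foldl (h z) (a z) (xs z))"
proof -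
  from h obtain P1 e1 c1 where 1: "computes P1 e1 c1 (\<lambda>p. h (fst p) (fst (snd p)) (snd (snd p)))"
    unfolding polytime_def by blast
  obtain P2 e2 c2 e3 c3 where 2: "computes P2 e2 c2 a" "computes P2 e3 c3 xs"
    by (rule polytime_linked[OF a xs])
  define k where "k = shift 1 e1"
  define body where "body = Cond (Prim IsPair [Var 1]) (Call 0 [Var 0, Prim Second [Var 1],
      Bind (Prim MkPair [Var 0, Prim MkPair [Var 2, Prim First [Var 1]]]) k]) (Var 2)"
  define P where "P = body # map (shift 1) P1 @ map (shift (1 + length P1)) P2"
  have k: "computes P k c1 (\<lambda>p. h (fst p) (fst (snd p)) (snd (snd p)))"
    using computes_shift[OF 1, of "[body]" "map (shift (1 + length P1)) P2"] by (simp add: P_def k_def)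
  have a': "computes P (shift (1 + length P1) e2) c2 a"
    and xs': "computes P (shift (1 + length P1) e3) c3 xs"
    using computes_shift[OF 2(1), of "body # map (shift 1) P1" "[]"]
      computes_shift[OF 2(2), of "body # map (shift 1) P1" "[]"] by (simp_all add: P_def)
  obtain m where m: "\<And>p. c1 p \<le> (sz p + 1) ^ m" using 1 unfolding computes_def polybd_def by blast
  define S where "S z = sz z + sz (xs z) + b z" for z
  define C where "C z = (3 * S z + 3) ^ m" for z
  have S: "polybd S" unfolding S_def by (intro polybd_intros polytime_sz xs b)
  define c where "c z = sz z + c3 z + c2 z + (sz (xs z) + 1) * (C z + 30 * S z + 30) + b z" for z
  let ?e = "Call 0 [Var 0, shift (1 + length P1) e3, shift (1 + length P1) e2]"
  have "computes P ?e c (\<lambda>z. foldl (h z) (a z) (xs z))"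
  proof (rule computesI)
    show "polybd c" unfolding c_def C_def
      using 2 unfolding computes_def by (intro polybd_intros S b polytime_sz xs) auto
  next
    fix z
    have "\<exists>t\<le>C z. eval P [enc (z, a', x)] k (enc (h z a' x)) t" if "sz a' \<le> S z" "sz x \<le> S z" for a' x
    proof -
      have "sz z \<le> S z" by (simp add: S_def)
      with that have "sz (z, a', x) + 1 \<le> 3 * S z + 3" by simp
      then have "c1 (z, a', x) \<le> C z" unfolding C_def
        using m[of "(z, a', x)"] power_mono[of "sz (z, a', x) + 1" "3 * S z + 3" m] by linarith
      moreover obtain t where "t \<le> c1 (z, a', x)" "eval P [enc (z, a', x)] k (enc (h z a' x)) t"
        using k unfolding computes_def by (metis fst_conv snd_conv)
      ultimately show ?thesis using le_trans by blast
    qed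
    moreover have "sz z \<le> S z" "sz (xs z) \<le> S z" by (simp_all add: S_def)
    moreover have "sz (foldl (h z) (a z) ys) \<le> S z" if "xs z = ys @ zs" for ys zs
      using b(2)[OF that] by (simp add: S_def)
    ultimately obtain t where t: "t \<le> (length (xs z) + 1) * (C z + 30 * S z + 30)"
      "eval P [enc z, enc (xs z), enc (a z)] (P ! 0) (enc (foldl (h z) (a z) (xs z))) t"
      using eval_foldl[of P k "S z" "C z" z h "xs z" "a z"] by (auto simp: P_def body_def)
    obtain t2 where t2: "t2 \<le> c2 z" "eval P [enc z] (shift (1 + length P1) e2) (enc (a z)) t2"
      using a' unfolding computes_def by blast
    obtain t3 where t3: "t3 \<le> c3 z" "eval P [enc z] (shift (1 + length P1) e3) (enc (xs z)) t3"
      using xs' unfolding computes_def by blast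
    have ev: "eval P [enc z] ?e (enc (foldl (h z) (a z) (xs z)))
      (sz z + t3 + t2 + t + sz (foldl (h z) (a z) (xs z)))"
      by (rule eval_Call3[OF _ eval_Var0 t3(2) t2(2) t(2)]) (simp add: P_def)
    have "t \<le> (sz (xs z) + 1) * (C z + 30 * S z + 30)"
      using t(1) by (rule order_trans) (intro mult_right_mono add_right_mono less_imp_le length_le_sz, simp)
    then have "sz z + t3 + t2 + t + sz (foldl (h z) (a z) (xs z)) \<le> c z"
      using t2(1) t3(1) b(2)[of z "xs z" "[]"] unfolding c_def by simp
    then show "\<exists>t\<le>c z. eval P [enc z] ?e (enc (foldl (h z) (a z) (xs z))) t"
      using ev by blast
  qed
  then show ?thesis unfolding polytime_def by blast
qed

section \<open>Polynomial-time list functions\<close>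

lemma polytime_Nil [polytime_intros]: "polytime (\<lambda>_. [] :: 'b::enc list)"
  by (rule polytime_simple[of "Const 0" _ "\<lambda>_. data_len (Atom 0)"])
    (auto simp: eval_Const simp del: data_len.simps intro: polybd_intros)

lemma polytime_bool [polytime_intros]: "polytime (\<lambda>_. b::bool)"
  by (rule polytime_simple[of "Const (if b then 1 else 0)" _ "\<lambda>_. sz b"])
    (auto simp: eval_Const simp del: data_len.simps intro: polybd_intros)

lemma polytime_not [polytime_intros]: "polytime P \<Longrightarrow> polytime (\<lambda>z. \<not> P z)"
  using polytime_if[of P "\<lambda>_. False" "\<lambda>_. True"] by (simp add: polytime_bool if_bool_eq_conj)

lemma polytime_conj [polytime_intros]:
  assumes "polytime P" "polytime Q" shows "polytime (\<lambda>z. P z \<and> Q z)"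
proof -
  have "polytime (\<lambda>z. if P z then Q z else False)" by (intro polytime_intros polytime_bool assms)
  moreover have "(\<lambda>z. if P z then Q z else False) = (\<lambda>z. P z \<and> Q z)" by auto
  ultimately show ?thesis by (simp only:)
qed

lemma polytime_disj [polytime_intros]: "polytime P \<Longrightarrow> polytime Q \<Longrightarrow> polytime (\<lambda>z. P z \<or> Q z)"
  using polytime_not[OF polytime_conj[OF polytime_not polytime_not]] by simp

lemma polytime_less [polytime_intros]:
  fixes f g :: "'a::enc \<Rightarrow> nat"
  shows "polytime f \<Longrightarrow> polytime g \<Longrightarrow> polytime (\<lambda>x. f x < g x)"
  unfolding not_le[symmetric] by (intro polytime_intros)

lemma polytime_eq_nat [polytime_intros]:
  fixes f g :: "'a::enc \<Rightarrow> nat"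
  shows "polytime f \<Longrightarrow> polytime g \<Longrightarrow> polytime (\<lambda>x. f x = g x)"
  unfolding eq_iff by (intro polytime_intros)

lemma polytime_null [polytime_intros]: "polytime xs \<Longrightarrow> polytime (\<lambda>z. xs z = [])"
  using polytime_not[OF polytime_nonempty] by simp

lemma foldl_Cons_map: "foldl (\<lambda>a x. f x # a) acc xs = rev (map f xs) @ acc"
  by (induction xs arbitrary: acc) auto

lemma foldl_Cons: "foldl (\<lambda>a x. x # a) acc xs = rev xs @ acc"
  using foldl_Cons_map[of "\<lambda>x. x"] by simp

text \<open>Consing inside a fold reverses the list. So the reversed map is the primitive case:
  \<open>rev\<close> is its instance for the identity, and the map itself follows by reversing once
  more.\<close>

lemma polytime_rev_map:
  assumes f: "polytime (\<lambda>p. f (fst p) (snd p))" and xs: "polytime xs"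
  shows "polytime (\<lambda>z. rev (map (f z) (xs z)))"
proof -
  from polytime_sz[OF f] obtain k where k: "\<And>p. sz (f (fst p) (snd p)) \<le> (sz p + 1) ^ k"
    unfolding polybd_def by blast
  define b where "b z = 1 + sz (xs z) * (1 + (sz z + sz (xs z) + 2) ^ k)" for z
  have "polytime (\<lambda>z. foldl (\<lambda>a x. f z x # a) [] (xs z))"
  proof (rule polytime_foldl[where b = b])
    show "polytime (\<lambda>p. f (fst p) (snd (snd p)) # fst (snd p))"
      using polytime_comp[OF f, of "\<lambda>p. (fst p, snd (snd p))"] by (intro polytime_intros) (simp add: polytime_intros)
    show "polybd b" unfolding b_def by (intro polybd_intros polytime_sz xs)
    fix z ys zs assume z: "xs z = ys @ zs"
    have "sz (map (f z) ys) \<le> 1 + length (map (f z) ys) * (1 + (sz z + sz (xs z) + 2) ^ k)"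
    proof (rule sz_list_le)
      fix y assume "y \<in> set (map (f z) ys)"
      then obtain x where x: "y = f z x" "x \<in> set (xs z)" using z by auto
      have "sz y \<le> (sz (z, x) + 1) ^ k" using k[of "(z, x)"] x by simp
      also have "\<dots> \<le> (sz z + sz (xs z) + 2) ^ k" using sz_member[OF x(2)] by (intro power_mono) auto
      finally show "sz y \<le> \<dots>" .
    qed
    also have "\<dots> \<le> b z" unfolding b_def using length_le_sz[of "xs z"]
      by (intro add_left_mono mult_right_mono) (auto simp: z)
    finally show "sz (foldl (\<lambda>a x. f z x # a) [] ys) \<le> b z"
      by (simp add: foldl_Cons_map)
  qed (intro polytime_intros xs)+
  then show ?thesis by (simp add: foldl_Cons_map)
qed

lemma polytime_rev [polytime_intros]: "polytime xs \<Longrightarrow> polytime (\<lambda>z. rev (xs z))"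
  using polytime_rev_map[of "\<lambda>_ x. x" xs] by (simp add: polytime_intros)

lemma polytime_map [polytime_intros]:
  "polytime (\<lambda>p. f (fst p) (snd p)) \<Longrightarrow> polytime xs \<Longrightarrow> polytime (\<lambda>z. map (f z) (xs z))"
  using polytime_rev[OF polytime_rev_map, of f xs] by simp

lemma foldl_Cons_filter: "foldl (\<lambda>a x. if P x then x # a else a) acc xs = rev (filter P xs) @ acc"
  by (induction xs arbitrary: acc) auto

lemma polytime_filter [polytime_intros]:
  assumes P: "polytime (\<lambda>p. P (fst p) (snd p))" and xs: "polytime xs"
  shows "polytime (\<lambda>z. filter (P z) (xs z))"
proof -
  have "polytime (\<lambda>z. foldl (\<lambda>a x. if P z x then x # a else a) [] (xs z))"
  proof (rule polytime_foldl[where b = "\<lambda>z. sz (xs z)"])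
    show "polytime (\<lambda>p. if P (fst p) (snd (snd p)) then snd (snd p) # fst (snd p) else fst (snd p))"
      using polytime_comp[OF P, of "\<lambda>p. (fst p, snd (snd p))"] by (intro polytime_intros) (simp add: polytime_intros)
    fix z ys zs assume z: "xs z = ys @ zs"
    have "sz (filter (P z) ys) \<le> sz ys" by (rule sz_filter)
    also have "\<dots> \<le> sz (xs z)" using sz_append[of ys zs] sz_ge_2[of zs] z by simp
    finally show "sz (foldl (\<lambda>a x. if P z x then x # a else a) [] ys) \<le> sz (xs z)"
      by (simp add: foldl_Cons_filter)
  qed (intro polytime_intros polytime_sz xs)+
  from polytime_rev[OF this] show ?thesis by (simp add: foldl_Cons_filter)
qed

lemma polytime_append [polytime_intros]:
  assumes xs: "polytime xs" and ys: "polytime ys"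
  shows "polytime (\<lambda>z. xs z @ ys z)"
proof -
  have "polytime (\<lambda>z. foldl (\<lambda>a x. x # a) (ys z) (rev (xs z)))"
  proof (rule polytime_foldl[where b = "\<lambda>z. sz (xs z) + sz (ys z)"])
    fix z us vs assume "rev (xs z) = us @ vs"
    then have "sz (xs z) + 1 = sz us + sz vs" using sz_append[of us vs] sz_rev[of "xs z"] by simp
    moreover have "sz (rev us @ ys z) + 1 = sz us + sz (ys z)"
      using sz_append[of "rev us" "ys z"] by simp
    ultimately show "sz (foldl (\<lambda>a x. x # a) (ys z) us) \<le> sz (xs z) + sz (ys z)"
      using sz_ge_2[of vs] foldl_Cons_map[of "\<lambda>x. x" "ys z" us] by simp
  qed (intro polytime_intros polybd_intros polytime_sz xs ys)+
  then show ?thesis by (simp add: foldl_Cons)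
qed

lemma foldl_append_concat: "foldl (\<lambda>a x. a @ x) acc xss = acc @ concat xss"
  by (induction xss arbitrary: acc) auto

lemma sz_concat: "sz (concat xss) \<le> sz xss"
proof (induction xss)
  case (Cons xs xss)
  then show ?case using sz_append[of xs "concat xss"] by simp
qed simp

lemma polytime_concat [polytime_intros]:
  assumes xs: "polytime xs" shows "polytime (\<lambda>z. concat (xs z))"
proof -
  have "polytime (\<lambda>z. foldl (\<lambda>a x. a @ x) [] (xs z))"
  proof (rule polytime_foldl[where b = "\<lambda>z. sz (xs z)"])
    fix z ys zs assume z: "xs z = ys @ zs"
    have "sz (concat ys) \<le> sz ys" by (rule sz_concat)
    also have "\<dots> \<le> sz (xs z)" using sz_append[of ys zs] sz_ge_2[of zs] z by simp
    finally show "sz (foldl (\<lambda>a x. a @ x) [] ys) \<le> sz (xs z)"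
      by (simp add: foldl_append_concat)
  qed (intro polytime_intros polytime_sz xs)+
  then show ?thesis by (simp add: foldl_append_concat)
qed

lemma polytime_Ball [polytime_intros]:
  assumes "polytime (\<lambda>p. P (fst p) (snd p))" "polytime xs"
  shows "polytime (\<lambda>z. \<forall>x\<in>set (xs z). P z x)"
proof -
  have "polytime (\<lambda>z. filter (\<lambda>x. \<not> P z x) (xs z) = [])" by (intro polytime_intros assms)
  then show ?thesis by (simp add: filter_empty_conv)
qed

lemma polytime_Bex [polytime_intros]:
  assumes "polytime (\<lambda>p. P (fst p) (snd p))" "polytime xs"
  shows "polytime (\<lambda>z. \<exists>x\<in>set (xs z). P z x)"
proof -
  have "polytime (\<lambda>z. \<not> (\<forall>x\<in>set (xs z). \<not> P z x))" by (intro polytime_intros assms)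
  then show ?thesis by simp
qed

lemma foldl_count: "foldl (\<lambda>a x. Suc a) n xs = n + length xs"
  by (induction xs arbitrary: n) auto

lemma polytime_Suc [polytime_intros]: "polytime f \<Longrightarrow> polytime (\<lambda>z. Suc (f z))"
  using polytime_add[of f "\<lambda>_. 1"] by (simp add: polytime_nat)

lemma polytime_length [polytime_intros]:
  assumes xs: "polytime xs" shows "polytime (\<lambda>z. length (xs z))"
proof -
  have "polytime (\<lambda>z. foldl (\<lambda>a x. Suc a) 0 (xs z))"
  proof (rule polytime_foldl[where b = "\<lambda>z. sz (xs z) + 1"])
    fix z ys zs assume z: "xs z = ys @ zs"
    have "sz (length ys) \<le> length ys + 1" by (rule sz_nat_le)
    moreover have "length ys < sz (xs z)" using length_le_sz[of "xs z"] z by simp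
    ultimately have "sz (length ys) \<le> sz (xs z) + 1" by linarith
    then show "sz (foldl (\<lambda>a x. Suc a) 0 ys) \<le> sz (xs z) + 1" by (simp add: foldl_count)
  qed (intro polytime_intros polybd_intros polytime_sz xs)+
  then show ?thesis by (simp add: foldl_count)
qed

lemma foldl_upt: "foldl (\<lambda>a x. a @ [length a]) [] xs = [0..<length xs]"
  by (induction xs rule: rev_induct) auto

text \<open>A range up to a number given in binary would be exponentially long. The length of a list
  is a unary bound, and all ranges of variable length in the algorithms have this form.\<close>

lemma polytime_upt_length [polytime_intros]:
  assumes xs: "polytime xs" shows "polytime (\<lambda>z. [0..<length (xs z)])"
proof -
  have "polytime (\<lambda>z. foldl (\<lambda>a x. a @ [length a]) [] (xs z))"
  proof (rule polytime_foldl[where b = "\<lambda>z. 1 + sz (xs z) * (1 + (sz (xs z) + 1))"])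
    fix z ys zs assume z: "xs z = ys @ zs"
    have l: "length ys \<le> sz (xs z)" using length_le_sz[of "xs z"] z by simp
    have "sz [0..<length ys] \<le> 1 + length [0..<length ys] * (1 + (sz (xs z) + 1))"
    proof (rule sz_list_le)
      fix i assume "i \<in> set [0..<length ys]"
      then have "i + 1 \<le> sz (xs z) + 1" using l by simp
      with sz_nat_le show "sz i \<le> sz (xs z) + 1" by (rule le_trans)
    qed
    also have "\<dots> \<le> 1 + sz (xs z) * (1 + (sz (xs z) + 1))"
      using l by (intro add_left_mono mult_right_mono) auto
    finally show "sz (foldl (\<lambda>a x. a @ [length a]) [] ys) \<le> 1 + sz (xs z) * (1 + (sz (xs z) + 1))"
      by (simp only: foldl_upt)
  qed (intro polytime_intros polybd_intros polytime_sz xs)+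
  then show ?thesis by (simp add: foldl_upt)
qed

lemma polytime_const_list [polytime_intros]:
  "(\<And>x. x \<in> set xs \<Longrightarrow> polytime (\<lambda>_::'z::enc. x)) \<Longrightarrow> polytime (\<lambda>_::'z. xs)"
  by (induction xs) (auto intro!: polytime_intros)

text \<open>The term \<open>headd [] (map (\<lambda>y. [y]) (fst p))\<close> is the head of the
  second list as a list of at most one element. An exhausted list thus contributes nothing, and no
  default element of its type is required.\<close>

definition zip_step :: "'b list \<times> ('a \<times> 'b) list \<Rightarrow> 'a \<Rightarrow> 'b list \<times> ('a \<times> 'b) list" where
  "zip_step p x = (tl (fst p), map (\<lambda>y. (x, y)) (headd [] (map (\<lambda>y. [y]) (fst p))) @ snd p)"

lemma foldl_zip_step: "foldl zip_step (ys, acc) xs = (drop (length xs) ys, rev (zip xs ys) @ acc)"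
proof (induction xs arbitrary: ys acc)
  case (Cons x xs)
  then show ?case by (cases ys) (auto simp: zip_step_def)
qed simp

lemma sz_zip: "sz (zip xs ys) \<le> sz xs + sz ys"
proof (induction xs arbitrary: ys)
  case (Cons x xs)
  show ?case
  proof (cases ys)
    case Nil
    then show ?thesis by simp
  next
    case (Cons y ys')
    then show ?thesis using Cons.IH[of ys'] by simp
  qed
qed simp

lemma polytime_zip [polytime_intros]:
  fixes xs :: "'z::enc \<Rightarrow> 'a::enc list" and ys :: "'z \<Rightarrow> 'b::enc list"
  assumes xs: "polytime xs" and ys: "polytime ys"
  shows "polytime (\<lambda>z. zip (xs z) (ys z))"
proof -
  have "polytime (\<lambda>z. foldl zip_step (ys z, []) (xs z))"
  proof (rule polytime_foldl[where b = "\<lambda>z. 1 + sz (ys z) + (sz (xs z) + sz (ys z))"])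
    show "polytime (\<lambda>p :: 'z \<times> ('b list \<times> ('a \<times> 'b) list) \<times> 'a. zip_step (fst (snd p)) (snd (snd p)))"
      unfolding zip_step_def by (intro polytime_intros)
    fix z us vs assume z: "xs z = us @ vs"
    have "sz (drop (length us) (ys z)) \<le> sz (ys z)"
      using sz_append[of "take (length us) (ys z)" "drop (length us) (ys z)"]
        sz_ge_2[of "take (length us) (ys z)"] by simp
    moreover have "sz us \<le> sz (xs z)" using sz_append[of us vs] sz_ge_2[of vs] z by simp
    ultimately show "sz (foldl zip_step (ys z, []) us) \<le> 1 + sz (ys z) + (sz (xs z) + sz (ys z))"
      using sz_zip[of us "ys z"] by (simp add: foldl_zip_step)
  qed (intro polytime_intros polybd_intros polytime_sz xs ys)+
  then have "polytime (\<lambda>z. rev (snd (foldl zip_step (ys z, []) (xs z))))" by (intro polytime_intros)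
  then show ?thesis by (simp add: foldl_zip_step)
qed

section \<open>Gathering cells of bounded radius\<close>

text \<open>Distance at most \<open>T\<close> on a spider with integral positions, written without
  subtraction. The different names \<open>(l, 0)\<close> of the center are harmless, since at
  position 0 both cases state the same bound.\<close>

definition compat :: "nat \<Rightarrow> nat \<times> nat \<Rightarrow> nat \<times> nat \<Rightarrow> bool" where
  "compat T c f \<longleftrightarrow> (if fst c = fst f then snd c \<le> snd f + T \<and> snd f \<le> snd c + T else snd c + snd f \<le> T)"

text \<open>
  An event is a sorting key (leg, time) together with a flag for facilities, the user index (0 for
  facilities), and the position on the leg. A facility at position \<open>j\<close> is processed at time
  \<open>2 (j + T) + 1\<close>, right after the users at \<open>j + T\<close>, which have time \<open>2 (j + T)\<close>.

  A state consists of a list of tagged items and of the list of users already assigned to facilities.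
  An item \<open>((0, s), u)\<close> is a user waiting in slot \<open>s\<close> for a facility of its own leg; \<open>((1, j), u)\<close> is a user
  to be served by some facility at position \<open>j\<close> of another leg; \<open>((2, j), l)\<close> is the demand of the
  facility \<open>(l, j)\<close> for one such user.
\<close>

type_synonym event = "(nat \<times> nat) \<times> bool \<times> nat \<times> nat"
type_synonym state = "((nat \<times> nat) \<times> nat) list \<times> (nat \<times> nat \<times> nat) list"

definition ins :: "('k::ord \<times> 'b) \<Rightarrow> ('k \<times> 'b) list \<Rightarrow> ('k \<times> 'b) list" where
  "ins x ys = filter (\<lambda>y. fst y < fst x) ys @ x # filter (\<lambda>y. \<not> fst y < fst x) ys"

definition isort :: "('k::ord \<times> 'b) list \<Rightarrow> ('k \<times> 'b) list" where
  "isort xs = foldl (\<lambda>a x. ins x a) [] xs"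

text \<open>Used in two ways: with the identity it removes duplicate cells, with
  \<open>key T\<close> it keeps one state per vector of counts.\<close>

definition dedupe :: "('a \<Rightarrow> 'k) \<Rightarrow> 'a list \<Rightarrow> 'a list" where
  "dedupe k xs = foldl (\<lambda>a x. if \<exists>y\<in>set a. k y = k x then a else x # a) [] xs"

definition user_event :: "nat \<Rightarrow> nat \<times> nat \<Rightarrow> event" where
  "user_event u c = ((fst c, 2 * snd c), False, u, snd c)"

definition fac_event :: "nat \<Rightarrow> nat \<times> nat \<Rightarrow> event" where
  "fac_event T f = ((fst f, 2 * (snd f + T) + 1), True, 0, snd f)"

definition events :: "nat \<Rightarrow> (nat \<times> nat) list \<Rightarrow> (nat \<times> nat) list \<Rightarrow> event list" where
  "events T us F = isort (map (\<lambda>p. user_event (fst p) (snd p)) (zip [0..<length us] us) @ map (fac_event T) F)"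

definition tagged :: "nat \<times> nat \<Rightarrow> state \<Rightarrow> nat list" where
  "tagged t st = map snd (filter (\<lambda>p. fst p = t) (fst st))"

definition tags :: "nat \<Rightarrow> (nat \<times> nat) list" where
  "tags T = map (\<lambda>s. (0, s)) [0..<2 * T + 1] @ map (\<lambda>j. (1, j)) [0..<T + 1] @ map (\<lambda>j. (2, j)) [0..<T + 1]"

text \<open>The only part of a state on which the availability of later moves and acceptance depend;
  the identities of waiting users and the legs of tokens are forgotten.\<close>

definition key :: "nat \<Rightarrow> state \<Rightarrow> nat list" where
  "key T st = map (\<lambda>t. length (tagged t st)) (tags T)"

text \<open>The target itself is not stored, only its slot or its distance from the center. A target
  on another leg leaves just the claim that there is demand at its position; \<open>accept\<close>
  checks these claims in the end.\<close>

definition user_moves :: "nat \<Rightarrow> (nat \<times> nat) list \<Rightarrow> nat \<Rightarrow> nat \<Rightarrow> nat \<Rightarrow> state \<Rightarrow> state list" where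
  "user_moves T F l i u st =
     map (\<lambda>f. ((if fst f = l then (0, snd f mod (2 * T + 1)) else (1, snd f), u) # fst st, snd st))
       (filter (\<lambda>f. compat T (l, i) f) F)"

text \<open>Here \<open>g\<close> guesses how many users come from other legs. With
  \<open>ns = [0..<n]\<close> as a unary form of the number of users, \<open>0 # map Suc ns\<close>
  enumerates the guesses and \<open>filter (\<lambda>k. k < g) ns\<close> has \<open>g\<close>
  entries. Beyond distance \<open>T\<close> from the center no user of another leg can arrive, hence
  \<open>g = 0 \<or> j \<le> T\<close>.\<close>

definition fac_moves :: "nat \<Rightarrow> nat list \<Rightarrow> nat \<Rightarrow> nat \<Rightarrow> nat \<Rightarrow> state \<Rightarrow> state list" where
  "fac_moves T ns r l j st =
     map (\<lambda>g. (map (\<lambda>_. ((2, j), l)) (filter (\<lambda>k. k < g) ns) @ filter (\<lambda>p. fst p \<noteq> (0, j mod (2 * T + 1))) (fst st),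
            map (\<lambda>u. (u, l, j)) (tagged (0, j mod (2 * T + 1)) st) @ snd st))
       (filter (\<lambda>g. (g = 0 \<or> j \<le> T) \<and>
           (length (tagged (0, j mod (2 * T + 1)) st) + g = 0 \<or> r \<le> length (tagged (0, j mod (2 * T + 1)) st) + g))
         (0 # map Suc ns))"

definition moves :: "nat \<Rightarrow> (nat \<times> nat) list \<Rightarrow> nat list \<Rightarrow> nat \<Rightarrow> event \<Rightarrow> state \<Rightarrow> state list" where
  "moves T F ns r e st =
     (if fst (snd e) then fac_moves T ns r (fst (fst e)) (snd (snd (snd e))) st
      else user_moves T F (fst (fst e)) (snd (snd (snd e))) (fst (snd (snd e))) st)"

definition step :: "nat \<Rightarrow> (nat \<times> nat) list \<Rightarrow> nat list \<Rightarrow> nat \<Rightarrow> state list \<Rightarrow> event \<Rightarrow> state list" where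
  "step T F ns r sts e =
     dedupe (key T) (filter (\<lambda>st. \<forall>c\<in>set (key T st). c \<le> length ns) (concat (map (moves T F ns r e) sts)))"

definition accept :: "nat \<Rightarrow> state \<Rightarrow> bool" where
  "accept T st \<longleftrightarrow> (\<forall>j\<in>set [0..<T + 1]. length (tagged (1, j) st) = length (tagged (2, j) st))"

definition result :: "nat \<Rightarrow> state \<Rightarrow> (nat \<times> nat \<times> nat) list" where
  "result T st = snd st @
     concat (map (\<lambda>j. map (\<lambda>p. (fst p, snd p, j)) (zip (tagged (1, j) st) (tagged (2, j) st))) [0..<T + 1])"

definition solve_cells :: "nat \<Rightarrow> (nat \<times> nat) list \<Rightarrow> (nat \<times> nat) list \<Rightarrow> nat \<Rightarrow> (nat \<times> nat \<times> nat) list list" where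
  "solve_cells T us F r =
     map (result T) (filter (accept T)
       (foldl (step T F [0..<length us] r) [([], [])] (events T us F)))"

section \<open>Sorting and removal of duplicates\<close>

lemma mset_ins: "mset (ins x ys) = add_mset x (mset ys)"
  by (simp add: ins_def)

lemma mset_foldl_ins: "mset (foldl (\<lambda>a x. ins x a) acc xs) = mset acc + mset xs"
  by (induction xs arbitrary: acc) (auto simp: mset_ins)

lemma mset_isort: "mset (isort xs) = mset xs"
  by (simp add: isort_def mset_foldl_ins)

lemma sorted_ins:
  fixes x :: "'k::linorder \<times> 'b"
  shows "sorted (map fst ys) \<Longrightarrow> sorted (map fst (ins x ys))"
  by (auto simp: ins_def sorted_append sorted_map intro: sorted_wrt_filter)

lemma sorted_isort:
  fixes xs :: "('k::linorder \<times> 'b) list"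
  shows "sorted (map fst (isort xs))"
proof -
  have "sorted (map fst (foldl (\<lambda>a x. ins x a) acc xs))" if "sorted (map fst acc)" for acc :: "('k \<times> 'b) list"
    using that by (induction xs arbitrary: acc) (auto simp: sorted_ins)
  then show ?thesis by (simp add: isort_def)
qed

lemma set_isort [simp]: "set (isort xs) = set xs"
  by (metis mset_isort set_mset_mset)

lemma dedupe_invariants:
  fixes k xs acc
  defines "d \<equiv> foldl (\<lambda>a x. if \<exists>y\<in>set a. k y = k x then a else x # a) acc xs"
  assumes "distinct (map k acc)"
  shows "distinct (map k d) \<and> set d \<subseteq> set acc \<union> set xs \<and> k ` set d = k ` set acc \<union> k ` set xs"
  using assms(2) unfolding d_def
proof (induction xs arbitrary: acc)
  case (Cons x xs)
  let ?acc = "if \<exists>y\<in>set acc. k y = k x then acc else x # acc"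
  have "distinct (map k ?acc)" using Cons.prems by (auto simp: image_iff) 
  from Cons.IH[OF this] show ?case by (auto split: if_splits) (metis image_eqI)+
qed auto

lemma distinct_dedupe: "distinct (map k (dedupe k xs))"
  and set_dedupe: "set (dedupe k xs) \<subseteq> set xs"
  and image_dedupe: "k ` set (dedupe k xs) = k ` set xs"
  using dedupe_invariants[of k "[]" xs] by (auto simp: dedupe_def)

lemma mset_concat_filter:
  assumes "\<And>x. x \<in> set xs \<Longrightarrow> P x \<Longrightarrow> k x < m"
  shows "mset (concat (map (\<lambda>j. filter (\<lambda>x. P x \<and> k x = j) xs) [0..<m])) = mset (filter P xs)"
proof -
  have "mset (concat (map (\<lambda>j. filter (\<lambda>x. P x \<and> k x = j) xs) [0..<m])) = mset (filter (\<lambda>x. P x \<and> k x < m) xs)" for m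
  proof (induction m)
    case (Suc m)
    have "mset (filter (\<lambda>x. P x \<and> k x < Suc m) xs)
      = mset (filter (\<lambda>x. P x \<and> k x < m) xs) + mset (filter (\<lambda>x. P x \<and> k x = m) xs)"
      by (induction xs) auto
    then show ?case using Suc by simp
  qed simp
  also have "filter (\<lambda>x. P x \<and> k x < m) xs = filter P xs"
    by (rule filter_cong) (use assms in auto)
  finally show ?thesis .
qed

lemma mem_fac_moves:
  "st' \<in> set (fac_moves T [0..<n] r l j st) \<longleftrightarrow>
    (\<exists>g\<le>n. (g = 0 \<or> j \<le> T) \<and>
      (length (tagged (0, j mod (2 * T + 1)) st) + g = 0 \<or> r \<le> length (tagged (0, j mod (2 * T + 1)) st) + g) \<and>
      st' = (map (\<lambda>_. ((2, j), l)) (filter (\<lambda>k. k < g) [0..<n]) @ filter (\<lambda>p. fst p \<noteq> (0, j mod (2 * T + 1))) (fst st),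
             map (\<lambda>u. (u, l, j)) (tagged (0, j mod (2 * T + 1)) st) @ snd st))"
proof -
  have "set (0 # map Suc [0..<n]) = {..n}"
    by (simp add: atLeast0LessThan image_Suc_lessThan) auto
  then show ?thesis unfolding fac_moves_def set_map set_filter by blast
qed

text \<open>All legs agree, since \<open>fst f\<close> is squeezed between two equal legs. The user
  comes no later than \<open>f\<close>, so its position is at most \<open>snd f + T\<close>, and
  \<open>f'\<close> is at most \<open>T\<close> beyond the user. Thus \<open>f'\<close> exceeds
  \<open>f\<close> by at most \<open>2 * T\<close>, which is less than the modulus.\<close>

lemma slot_unique:
  assumes "(fst c, 2 * snd c) \<le> (fst f, 2 * (snd f + T) + 1)"
    and "(fst f, 2 * (snd f + T) + 1) \<le> (fst f', 2 * (snd f' + T) + 1)"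
    and "compat T c f'" "fst c = fst f'" "snd f' mod (2 * T + 1) = snd f mod (2 * T + 1)"
  shows "f' = f"
proof -
  have "fst f = fst f'" using assms(1,2,4) by auto
  moreover have "snd c \<le> snd f + T" "snd f \<le> snd f'" "snd f' \<le> snd c + T"
    using assms calculation by (auto simp: compat_def)
  then have "snd f \<le> snd f'" "snd f' - snd f < 2 * T + 1" by auto
  moreover have "(2 * T + 1) dvd (snd f' - snd f)"
    using assms(5) calculation(2) by (metis mod_eq_dvd_iff_nat)
  ultimately show ?thesis using nat_dvd_not_less[of "snd f' - snd f" "2 * T + 1"]
    by (metis diff_is_0_eq le_antisym neq0_conv prod.expand)
qed

section \<open>Soundness of the sweep\<close>

locale cells =
  fixes T :: nat and us F :: "(nat \<times> nat) list" and r :: nat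
  assumes distinct_F: "distinct F"
begin

abbreviation "n \<equiv> length us"
abbreviation "W \<equiv> 2 * T + 1"

lemma events_altdef:
  "events T us F = isort (map (\<lambda>u. user_event u (us ! u)) [0..<n] @ map (fac_event T) F)"
proof -
  have "map (\<lambda>p. user_event (fst p) (snd p)) (zip [0..<n] us) = map (\<lambda>u. user_event u (us ! u)) [0..<n]"
    by (rule nth_equalityI) auto
  then show ?thesis by (simp add: events_def)
qed

lemma set_events: "set (events T us F) = (\<lambda>u. user_event u (us ! u)) ` {..<n} \<union> fac_event T ` set F"
  by (auto simp: events_altdef)

lemma fac_event_inj: "fac_event T f = fac_event T f' \<longleftrightarrow> f = f'"
  by (auto simp: fac_event_def prod_eq_iff)

lemma user_event_neq_fac_event [simp]: "user_event u c \<noteq> fac_event T f" "fac_event T f \<noteq> user_event u c"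
  by (auto simp: user_event_def fac_event_def)

lemma user_event_inj: "user_event u c = user_event u' c' \<Longrightarrow> u = u'"
  by (auto simp: user_event_def)

lemma distinct_events: "distinct (events T us F)"
proof -
  have "distinct (map (\<lambda>u. user_event u (us ! u)) [0..<n] @ map (fac_event T) F)"
    using distinct_F by (auto simp: distinct_map inj_on_def fac_event_inj dest: user_event_inj)
  then show ?thesis unfolding events_altdef
    by (metis mset_isort mset_eq_imp_distinct_iff)
qed

lemma sorted_events: "sorted (map fst (events T us F))"
  by (simp add: events_def sorted_isort)

definition users_of :: "event list \<Rightarrow> nat list" where
  "users_of P = map (\<lambda>e. fst (snd (snd e))) (filter (\<lambda>e. \<not> fst (snd e)) P)"

lemma users_of_simps [simp]:
  "users_of [] = []" "users_of (P @ [user_event u c]) = users_of P @ [u]"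
  "users_of (P @ [fac_event T f]) = users_of P"
  by (simp_all add: users_of_def user_event_def fac_event_def)

lemma mset_users_of_events: "mset (users_of (events T us F)) = mset [0..<n]"
proof -
  let ?es = "map (\<lambda>u. user_event u (us ! u)) [0..<n] @ map (fac_event T) F"
  have "mset (users_of (events T us F)) = mset (users_of ?es)"
    unfolding events_altdef users_of_def mset_map mset_filter mset_isort ..
  also have "users_of ?es = [0..<n]"
    by (simp add: users_of_def filter_map o_def user_event_def fac_event_def)
  finally show ?thesis .
qed

lemma event_order:
  assumes "events T us F = P @ e # Q"
  shows "x \<in> set P \<Longrightarrow> fst x \<le> fst e" "x \<in> set Q \<Longrightarrow> fst e \<le> fst x"
  using sorted_events unfolding assms by (auto simp: sorted_append)

lemma event_cases:
  assumes "events T us F = P @ e # Q"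
  obtains (user) u where "u < n" "e = user_event u (us ! u)"
    | (fac) f where "f \<in> set F" "e = fac_event T f"
proof -
  have "e \<in> set (events T us F)" by (simp add: assms)
  then show ?thesis using that by (auto simp: set_events)
qed

text \<open>A user at \<open>i\<close> that reaches \<open>j\<close> has
  \<open>i \<le> j + T\<close>, so its time \<open>2 * i\<close> precedes the odd time
  \<open>2 * (j + T) + 1\<close>. The added 1 makes the order strict also in the extreme
  case.\<close>

lemma own_fac_pending:
  assumes ev: "events T us F = P @ user_event u (us ! u) # Q"
    and f: "f \<in> set F" "compat T (us ! u) f" "fst f = fst (us ! u)"
  shows "fac_event T f \<in> set Q"
proof -
  have "fst (user_event u (us ! u)) < fst (fac_event T f)"
    using f by (auto simp: compat_def user_event_def fac_event_def)
  then have "fac_event T f \<notin> set P" using event_order(1)[OF ev, of "fac_event T f"] by auto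
  moreover have "fac_event T f \<in> set (events T us F)" using f by (simp add: set_events)
  ultimately show ?thesis by (simp add: ev)
qed

lemma own_user_done:
  assumes ev: "events T us F = P @ fac_event T f # Q"
    and u: "u < n" "compat T (us ! u) f" "fst f = fst (us ! u)"
  shows "user_event u (us ! u) \<in> set P"
proof -
  have "fst (user_event u (us ! u)) < fst (fac_event T f)"
    using u by (auto simp: compat_def user_event_def fac_event_def)
  then have "user_event u (us ! u) \<notin> set Q" using event_order(2)[OF ev, of "user_event u (us ! u)"] by auto
  moreover have "user_event u (us ! u) \<in> set (events T us F)" using u by (simp add: set_events)
  ultimately show ?thesis by (simp add: ev)
qed

text \<open>This makes the reuse of slots safe: when \<open>f\<close> is processed, a user waiting
  in its slot for a facility not yet processed can only be waiting for \<open>f\<close>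
  itself.\<close>

lemma slot_owner:
  assumes ev: "events T us F = P @ fac_event T f # Q"
    and u: "user_event u (us ! u) \<in> set P"
    and f': "fac_event T f' \<in> set (fac_event T f # Q)" "fst f' = fst (us ! u)" "compat T (us ! u) f'"
      "snd f' mod W = snd f mod W"
  shows "f' = f"
proof (rule slot_unique)
  show "(fst (us ! u), 2 * snd (us ! u)) \<le> (fst f, 2 * (snd f + T) + 1)"
    using event_order(1)[OF ev u] by (simp add: user_event_def fac_event_def)
  show "(fst f, 2 * (snd f + T) + 1) \<le> (fst f', 2 * (snd f' + T) + 1)"
    using event_order(2)[OF ev, of "fac_event T f'"] f'(1) by (auto simp: fac_event_def)
qed (use f' in simp_all)

text \<open>Users already attached to \<open>f\<close> together with its unmatched tokens; for an
  accepted final state this is the number of users that \<open>f\<close> receives.\<close>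

definition load :: "nat \<times> nat \<Rightarrow> state \<Rightarrow> nat" where
  "load f st = length (filter (\<lambda>p. snd p = f) (snd st)) + length (filter (\<lambda>p. p = ((2, snd f), fst f)) (fst st))"

text \<open>A slot item remembers no facility, so the invariant asserts that a fitting one is still
  to come; this excludes slot items once all events are processed. For an item counted for another
  leg only the sum of the distances to the center is kept, which fits a facility at that position on
  every leg.\<close>

definition item_ok :: "event list \<Rightarrow> event list \<Rightarrow> (nat \<times> nat) \<times> nat \<Rightarrow> bool" where
  "item_ok P Q p \<longleftrightarrow> fst p \<in> set (tags T) \<and>
    (fst (fst p) = 0 \<longrightarrow> snd p < n \<and> user_event (snd p) (us ! snd p) \<in> set P \<and>
       (\<exists>f\<in>set F. fst f = fst (us ! snd p) \<and> compat T (us ! snd p) f \<and> snd f mod W = snd (fst p) \<and>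
          fac_event T f \<in> set Q)) \<and>
    (fst (fst p) = 1 \<longrightarrow> snd p < n \<and> snd (us ! snd p) + snd (fst p) \<le> T) \<and>
    (fst (fst p) = 2 \<longrightarrow> (snd p, snd (fst p)) \<in> set F \<and> snd (fst p) \<le> T)"

text \<open>The multiset equation leaves out tokens, which stand for no particular user. A load
  changes only in the step that processes its facility, so the lower bound \<open>r\<close> is
  settled there once and for all.\<close>

definition sound :: "event list \<Rightarrow> event list \<Rightarrow> state \<Rightarrow> bool" where
  "sound P Q st \<longleftrightarrow>
    mset (map fst (snd st)) + mset (map snd (filter (\<lambda>p. fst (fst p) \<noteq> 2) (fst st))) = mset (users_of P) \<and>
    (\<forall>p\<in>set (snd st). fst p < n \<and> snd p \<in> set F \<and> compat T (us ! fst p) (snd p)) \<and>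
    (\<forall>p\<in>set (fst st). item_ok P Q p) \<and>
    (\<forall>f\<in>set F. load f st = 0 \<or> fac_event T f \<in> set P \<and> r \<le> load f st)"

lemma set_tags: "set (tags T) = {(a, b). a = 0 \<and> b < W \<or> (a = 1 \<or> a = 2) \<and> b \<le> T}"
  by (auto simp: tags_def)

lemma sound_init: "sound [] Q ([], [])"
  by (simp add: sound_def load_def)

lemma sound_user:
  assumes ev: "events T us F = P @ e # Q" and e: "e = user_event u (us ! u)" "u < n"
    and st: "sound P (e # Q) st" and st': "st' \<in> set (moves T F [0..<n] r e st)"
  shows "sound (P @ [e]) Q st'"
proof -
  from st' e obtain f where f: "f \<in> set F" "compat T (us ! u) f"
    and st'_def: "st' = ((if fst f = fst (us ! u) then (0, snd f mod W) else (1, snd f), u) # fst st, snd st)"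
    by (auto simp: moves_def user_moves_def user_event_def)
  have old: "item_ok (P @ [e]) Q p" if "p \<in> set (fst st)" for p
  proof -
    have "item_ok P (e # Q) p" using st that by (auto simp: sound_def)
    then show ?thesis unfolding item_ok_def using e by auto
  qed
  have new: "item_ok (P @ [e]) Q (if fst f = fst (us ! u) then (0, snd f mod W) else (1, snd f), u)"
  proof (cases "fst f = fst (us ! u)")
    case True
    then have "fac_event T f \<in> set Q" using own_fac_pending ev e f by blast
    then show ?thesis using True f e by (auto simp: item_ok_def set_tags)
  next
    case False
    then show ?thesis using f e by (auto simp: item_ok_def set_tags compat_def)
  qed
  have "load f' st' = load f' st" for f' by (simp add: load_def st'_def)
  with st old new e show ?thesis by (auto simp: sound_def st'_def)
qed

lemma sound_fac:
  assumes ev: "events T us F = P @ e # Q" and e: "e = fac_event T f" "f \<in> set F"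
    and st: "sound P (e # Q) st" and st': "st' \<in> set (moves T F [0..<n] r e st)"
  shows "sound (P @ [e]) Q st'"
proof -
  define s where "s = (0::nat, snd f mod W)"
  define own where "own = tagged s st"
  from st' e obtain g where g: "g = 0 \<or> snd f \<le> T" "length own + g = 0 \<or> r \<le> length own + g" "g \<le> n"
    and st'_def: "st' = (map (\<lambda>_. ((2, snd f), fst f)) (filter (\<lambda>k. k < g) [0..<n]) @ filter (\<lambda>p. fst p \<noteq> s) (fst st),
      map (\<lambda>u. (u, f)) own @ snd st)"
    by (auto simp: moves_def mem_fac_moves fac_event_def own_def s_def)
  have lg: "length (filter (\<lambda>k. k < g) [0..<n]) = g"
  proof -
    have "[0..<n] = [0..<g] @ [g..<n]" using upt_add_eq_append[of 0 g "n - g"] g(3) by simp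
    then show ?thesis by simp
  qed
  \<comment> \<open>By \<open>slot_owner\<close> the facility asserted for the item is
    \<open>f\<close>, so the program does not have to test compatibility when it empties the
    slot.\<close>
  have own: "u < n \<and> compat T (us ! u) f" if "u \<in> set own" for u
  proof -
    have "(s, u) \<in> set (fst st)" using that by (auto simp: own_def tagged_def)
    then have "item_ok P (e # Q) (s, u)" using st by (auto simp: sound_def)
    then obtain f' where "u < n" "user_event u (us ! u) \<in> set P" "fst f' = fst (us ! u)"
      "compat T (us ! u) f'" "snd f' mod W = snd f mod W" "fac_event T f' \<in> set (e # Q)"
      by (auto simp: item_ok_def s_def)
    with slot_owner[of P f Q u f'] ev e show ?thesis by auto
  qed
  have fnP: "fac_event T f \<notin> set P" using distinct_events ev e by auto
  have "mset (map fst (snd st')) + mset (map snd (filter (\<lambda>p. fst (fst p) \<noteq> 2) (fst st')))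
      = mset (map fst (snd st)) + (mset own + mset (map snd (filter (\<lambda>p. fst (fst p) \<noteq> 2 \<and> fst p \<noteq> s) (fst st))))"
    by (simp add: st'_def o_def filter_map conj_commute)
  also have "mset own + mset (map snd (filter (\<lambda>p. fst (fst p) \<noteq> 2 \<and> fst p \<noteq> s) xs)) = mset (map snd (filter (\<lambda>p. fst (fst p) \<noteq> 2) xs))"
    if "own = map snd (filter (\<lambda>p. fst p = s) xs)" for xs
    unfolding that by (induction xs) (auto simp: s_def)
  finally have 1: "mset (map fst (snd st')) + mset (map snd (filter (\<lambda>p. fst (fst p) \<noteq> 2) (fst st')))
      = mset (users_of (P @ [e]))"
    using st e by (simp add: sound_def own_def tagged_def)
  have 2: "\<forall>p\<in>set (snd st'). fst p < n \<and> snd p \<in> set F \<and> compat T (us ! fst p) (snd p)"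
    using st own e by (auto simp: sound_def st'_def)
  have 3: "item_ok (P @ [e]) Q p" if "p \<in> set (fst st')" for p
  proof (cases "p \<in> set (fst st)")
    case True
    then have ok: "item_ok P (e # Q) p" using st by (auto simp: sound_def)
    \<comment> \<open>The slot of \<open>f\<close> has been emptied, and an item in another slot
      cannot be waiting for \<open>f\<close>; so the facility asserted for it is still among the
      remaining events.\<close>
    have "fst p \<noteq> s \<or> fst (fst p) = 2" using that by (auto simp: st'_def)
    then have ns: "fst (fst p) = 0 \<Longrightarrow> snd (fst p) \<noteq> snd f mod W" by (auto simp: s_def prod_eq_iff)
    show ?thesis using ok ns unfolding item_ok_def e(1) by (auto simp: fac_event_inj)
  next
    case False
    then have "p = ((2, snd f), fst f)" "g > 0" using that by (auto simp: st'_def)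
    then show ?thesis using g e by (auto simp: item_ok_def set_tags)
  qed
  have l: "load f' st' = load f' st + (if f' = f then length own + g else 0)" for f'
  proof -
    have "filter (\<lambda>p. fst p \<noteq> s \<and> p = ((2, snd f'), fst f')) (fst st) = filter (\<lambda>p. p = ((2, snd f'), fst f')) (fst st)"
      by (rule filter_cong) (auto simp: s_def)
    then show ?thesis using lg
      by (auto simp: load_def st'_def filter_map o_def prod_eq_iff)
  qed
  \<comment> \<open>\<open>f\<close> had not been processed, so its load afterwards is exactly what
    this step adds.\<close>
  have "load f st = 0" using st fnP e by (auto simp: sound_def)
  then have 4: "\<forall>f'\<in>set F. load f' st' = 0 \<or> fac_event T f' \<in> set (P @ [e]) \<and> r \<le> load f' st'"
    using st g e unfolding l by (auto simp: sound_def)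
  show ?thesis using 1 2 3 4 by (auto simp: sound_def)
qed

definition run :: "event list \<Rightarrow> state list" where
  "run es = foldl (step T F [0..<n] r) [([], [])] es"

lemma run_snoc: "run (es @ [e]) = step T F [0..<n] r (run es) e"
  by (simp add: run_def)

lemma sound_run: "events T us F = P @ Q \<Longrightarrow> st \<in> set (run P) \<Longrightarrow> sound P Q st"
proof (induction P arbitrary: Q st rule: rev_induct)
  case Nil
  then show ?case by (simp add: run_def sound_init)
next
  case (snoc e P)
  have "st \<in> set (concat (map (moves T F [0..<n] r e) (run P)))"
    using snoc.prems(2) set_dedupe unfolding run_snoc step_def by fastforce
  then obtain st0 where st0: "st0 \<in> set (run P)" "st \<in> set (moves T F [0..<n] r e st0)" by auto
  have ev: "events T us F = P @ e # Q" using snoc.prems(1) by simp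
  then have "sound P (e # Q) st0" using snoc.IH st0(1) by blast
  with event_cases[OF ev] show ?case using sound_user[OF ev _ _ _ st0(2)] sound_fac[OF ev _ _ _ st0(2)] by metis
qed

text \<open>Both facts are established by the filter and the deduplication of the last step alone,
  so no induction is involved.\<close>

lemma run_keys:
  "distinct (map (key T) (run es))" "st \<in> set (run es) \<Longrightarrow> c \<in> set (key T st) \<Longrightarrow> c \<le> n"
proof -
  have "distinct (map (key T) (run es)) \<and> (\<forall>st\<in>set (run es). \<forall>c\<in>set (key T st). c \<le> n)"
  proof (cases es rule: rev_cases)
    case Nil
    then show ?thesis by (simp add: run_def key_def tagged_def)
  next
    case (snoc es' e)
    then show ?thesis using set_dedupe unfolding snoc run_snoc step_def by (fastforce simp: distinct_dedupe)
  qed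
  then show "distinct (map (key T) (run es))" "st \<in> set (run es) \<Longrightarrow> c \<in> set (key T st) \<Longrightarrow> c \<le> n" by auto
qed

theorem solve_cells_sound:
  assumes R: "R \<in> set (solve_cells T us F r)"
  shows "mset (map fst R) = mset [0..<n]"
    "p \<in> set R \<Longrightarrow> snd p \<in> set F \<and> compat T (us ! fst p) (snd p)"
    "f \<in> set F \<Longrightarrow> length (filter (\<lambda>p. snd p = f) R) = 0 \<or> r \<le> length (filter (\<lambda>p. snd p = f) R)"
proof -
  from R obtain st where st: "st \<in> set (run (events T us F))" and acc: "accept T st" and R_def: "R = result T st"
    by (auto simp: solve_cells_def run_def)
  have sd: "sound (events T us F) [] st" using sound_run[of "events T us F" "[]"] st by simp
  have len: "length (tagged (1, j) st) = length (tagged (2, j) st)" if "j \<le> T" for j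
    using acc that by (auto simp: accept_def)
  \<comment> \<open>No event is left, so a slot item would lack its pending facility.\<close>
  have tag: "fst (fst p) = 1 \<and> snd (fst p) \<le> T \<or> fst (fst p) = 2 \<and> snd (fst p) \<le> T" if "p \<in> set (fst st)" for p
  proof -
    have "item_ok (events T us F) [] p" using sd that by (auto simp: sound_def)
    then show ?thesis by (auto simp: item_ok_def set_tags)
  qed
  have fst_zs: "map fst (map (\<lambda>p. (fst p, snd p, j)) (zip (tagged (1, j) st) (tagged (2, j) st))) = tagged (1, j) st"
    if "j \<in> set [0..<T + 1]" for j
    using len[of j] that by (simp add: o_def map_fst_zip less_Suc_eq_le del: One_nat_def)
  have "concat (map (\<lambda>j. tagged (1, j) st) [0..<T + 1])
    = map snd (concat (map (\<lambda>j. filter (\<lambda>p. fst (fst p) = 1 \<and> snd (fst p) = j) (fst st)) [0..<T + 1]))"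
    by (simp add: tagged_def map_concat o_def prod_eq_iff)
  then have "mset (concat (map (\<lambda>j. tagged (1, j) st) [0..<T + 1]))
    = image_mset snd (mset (concat (map (\<lambda>j. filter (\<lambda>p. fst (fst p) = 1 \<and> snd (fst p) = j) (fst st)) [0..<T + 1])))"
    by (simp only: mset_map)
  also have "\<dots> = image_mset snd (mset (filter (\<lambda>p. fst (fst p) = 1) (fst st)))"
    by (subst mset_concat_filter) (use tag in \<open>fastforce simp: less_Suc_eq_le\<close>)+
  also have "filter (\<lambda>p. fst (fst p) = 1) (fst st) = filter (\<lambda>p. fst (fst p) \<noteq> 2) (fst st)"
    by (rule filter_cong) (use tag in auto)
  finally have "mset (concat (map (\<lambda>j. tagged (1, j) st) [0..<T + 1])) =
    mset (map snd (filter (\<lambda>p. fst (fst p) \<noteq> 2) (fst st)))" by simp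
  moreover have "map fst R = map fst (snd st) @ concat (map (\<lambda>j. tagged (1, j) st) [0..<T + 1])"
    unfolding R_def result_def map_append map_concat map_map o_def using fst_zs
    by (auto simp: o_def intro!: arg_cong[where f = concat])
  ultimately show "mset (map fst R) = mset [0..<n]"
    using sd mset_users_of_events by (simp add: sound_def)
  show "snd p \<in> set F \<and> compat T (us ! fst p) (snd p)" if "p \<in> set R"
  proof -
    from that consider "p \<in> set (snd st)"
      | j q where "j \<le> T" "q \<in> set (zip (tagged (1, j) st) (tagged (2, j) st))" "p = (fst q, snd q, j)"
      by (auto simp: R_def result_def)
    then show ?thesis
    proof cases
      case 1
      then show ?thesis using sd by (auto simp: sound_def)
    next
      case 2
      then have "fst q \<in> set (tagged (1, j) st)" "snd q \<in> set (tagged (2, j) st)"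
        by (metis in_set_zipE prod.collapse)+
      then have "((1, j), fst q) \<in> set (fst st)" "((2, j), snd q) \<in> set (fst st)"
        by (auto simp: tagged_def)
      then have "item_ok (events T us F) [] ((1, j), fst q)" "item_ok (events T us F) [] ((2, j), snd q)"
        using sd by (auto simp: sound_def)
      \<comment> \<open>The legs of user and token may coincide; the bound on the sum of the
        positions then yields both inequalities of the same-leg case.\<close>
      then show ?thesis using 2(3) by (auto simp: item_ok_def compat_def)
    qed
  qed
  show "length (filter (\<lambda>p. snd p = f) R) = 0 \<or> r \<le> length (filter (\<lambda>p. snd p = f) R)" if "f \<in> set F"
  proof -
    \<comment> \<open>Only the batch of position \<open>snd f\<close> can hand users to
      \<open>f\<close>, one for each of its tokens.\<close>
    have z: "length (filter (\<lambda>p. snd p = f) (map (\<lambda>p. (fst p, snd p, j)) (zip (tagged (1, j) st) (tagged (2, j) st))))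
      = (if j = snd f then length (filter (\<lambda>l. l = fst f) (tagged (2, j) st)) else 0)" if "j \<in> set [0..<T + 1]" for j
    proof (cases "j = snd f")
      case True
      have "length (filter (\<lambda>p. snd p = f) (map (\<lambda>p. (fst p, snd p, j)) (zip (tagged (1, j) st) (tagged (2, j) st))))
        = length (filter (\<lambda>l. l = fst f) (map snd (zip (tagged (1, j) st) (tagged (2, j) st))))"
        by (simp add: filter_map o_def prod_eq_iff True)
      moreover have "map snd (zip (tagged (1, j) st) (tagged (2, j) st)) = tagged (2, j) st"
        using len[of j] that by (simp add: less_Suc_eq_le del: One_nat_def)
      ultimately show ?thesis using True by (simp only: if_True simp_thms)
    next
      case False
      then show ?thesis by (simp add: filter_map o_def prod_eq_iff)
    qed
    have "length (filter (\<lambda>p. snd p = f) R) = length (filter (\<lambda>p. snd p = f) (snd st)) +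
      (\<Sum>j\<leftarrow>[0..<T + 1]. length (filter (\<lambda>p. snd p = f) (map (\<lambda>p. (fst p, snd p, j)) (zip (tagged (1, j) st) (tagged (2, j) st)))))"
      by (simp only: R_def result_def filter_append length_append filter_concat length_concat map_map o_def)
    also have "(\<Sum>j\<leftarrow>[0..<T + 1]. length (filter (\<lambda>p. snd p = f) (map (\<lambda>p. (fst p, snd p, j)) (zip (tagged (1, j) st) (tagged (2, j) st)))))
      = (\<Sum>j\<leftarrow>[0..<T + 1]. if j = snd f then length (filter (\<lambda>l. l = fst f) (tagged (2, j) st)) else 0)"
      by (intro arg_cong[where f = sum_list] map_cong refl z)
    also have "\<dots> = (\<Sum>j\<in>set [0..<T + 1]. if j = snd f then length (filter (\<lambda>l. l = fst f) (tagged (2, j) st)) else 0)"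
      by (rule sum_list_distinct_conv_sum_set) simp
    also have "\<dots> = (if snd f \<le> T then length (filter (\<lambda>l. l = fst f) (tagged (2, snd f) st)) else 0)"
      by (simp add: sum.delta)
    also have "\<dots> = length (filter (\<lambda>p. p = ((2, snd f), fst f)) (fst st))"
    proof (cases "snd f \<le> T")
      case True
      then show ?thesis by (simp add: tagged_def filter_map o_def prod_eq_iff conj_commute)
    next
      case False
      then have "filter (\<lambda>p. p = ((2, snd f), fst f)) (fst st) = []"
        using tag by (force simp: filter_empty_conv)
      then show ?thesis using False by simp
    qed
    finally have "length (filter (\<lambda>p. snd p = f) R) = load f st" by (simp add: load_def)
    then show ?thesis using sd that by (auto simp: sound_def)
  qed
qed

text \<open>
  The set of users that a state following the assignment \<open>\<pi>\<close> has filed under tag \<open>t\<close> once the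
  events \<open>P\<close> are processed; tag \<open>(2, j)\<close> holds one token per remote user of a processed facility.
\<close>

definition filed :: "(nat \<Rightarrow> nat \<times> nat) \<Rightarrow> event list \<Rightarrow> nat \<times> nat \<Rightarrow> nat set" where
  "filed \<pi> P t = {u. u < n \<and>
    (if fst t = 0 then fst (us ! u) = fst (\<pi> u) \<and> user_event u (us ! u) \<in> set P \<and>
         fac_event T (\<pi> u) \<notin> set P \<and> snd (\<pi> u) mod W = snd t
     else if fst t = 1 then fst (us ! u) \<noteq> fst (\<pi> u) \<and> user_event u (us ! u) \<in> set P \<and> snd (\<pi> u) = snd t
     else fst (us ! u) \<noteq> fst (\<pi> u) \<and> fac_event T (\<pi> u) \<in> set P \<and> snd (\<pi> u) = snd t)}"

lemma finite_filed [simp]: "finite (filed \<pi> P t)"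
  by (rule finite_subset[of _ "{..<n}"]) (auto simp: filed_def)

lemma card_filed_le: "card (filed \<pi> P t) \<le> n"
proof -
  have "filed \<pi> P t \<subseteq> {..<n}" by (auto simp: filed_def)
  from card_mono[OF _ this] show ?thesis by simp
qed

section \<open>Completeness of the sweep\<close>

context
  fixes \<pi> :: "nat \<Rightarrow> nat \<times> nat"
  assumes \<pi>: "\<And>u. u < n \<Longrightarrow> \<pi> u \<in> set F \<and> compat T (us ! u) (\<pi> u)"
    and size: "\<And>f. f \<in> set F \<Longrightarrow> card {u. u < n \<and> \<pi> u = f} = 0 \<or> r \<le> card {u. u < n \<and> \<pi> u = f}"
begin

text \<open>Only numbers of items are tracked, because after deduplication the state at hand may
  hold other users than \<pi> prescribes. The move is the one that sends \<open>u\<close> to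
  \<open>\<pi> u\<close>.\<close>

lemma follow_user:
  assumes ev: "events T us F = P @ e # Q" and e: "e = user_event u (us ! u)" "u < n"
    and st: "\<forall>t\<in>set (tags T). length (tagged t st) = card (filed \<pi> P t)"
  shows "\<exists>st'\<in>set (moves T F [0..<n] r e st). \<forall>t\<in>set (tags T). length (tagged t st') = card (filed \<pi> (P @ [e]) t)"
proof -
  define tg where "tg = (if fst (\<pi> u) = fst (us ! u) then (0::nat, snd (\<pi> u) mod W) else (1, snd (\<pi> u)))"
  define st' where "st' = ((tg, u) # fst st, snd st)"
  have mem: "st' \<in> set (moves T F [0..<n] r e st)"
    using \<pi>[OF e(2)] by (auto simp: moves_def user_moves_def e user_event_def st'_def tg_def)
  have eP: "e \<notin> set P" using distinct_events ev by auto
  have own: "fac_event T (\<pi> u) \<notin> set P" if "fst (\<pi> u) = fst (us ! u)"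
    using own_fac_pending[of P u Q "\<pi> u"] \<pi>[OF e(2)] ev e that distinct_events by auto
  have eu: "user_event v (us ! v) = e \<longleftrightarrow> v = u" for v
    using e(1) user_event_inj by blast
  have fe: "fac_event T f \<noteq> e" for f using e(1) by simp
  have "v \<in> filed \<pi> (P @ [e]) t \<longleftrightarrow> v \<in> filed \<pi> P t \<or> t = tg \<and> v = u" if "t \<in> set (tags T)" for t v
  proof (cases "v = u")
    case True
    have "fst t = 0 \<or> fst t = 1 \<or> fst t = 2" using that by (auto simp: set_tags)
    then show ?thesis using True e(2) own eP e(1)
      by (cases t; elim disjE) (auto simp: filed_def tg_def fe eu)
  next
    case False
    then show ?thesis by (simp add: filed_def fe eu)
  qed
  then have "filed \<pi> (P @ [e]) t = (if t = tg then insert u (filed \<pi> P t) else filed \<pi> P t)"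
    if "t \<in> set (tags T)" for t
    using that by (intro set_eqI) (simp, blast)
  moreover have "u \<notin> filed \<pi> P tg" using eP e(1) by (auto simp: filed_def tg_def)
  moreover have "length (tagged t st') = (if t = tg then 1 else 0) + length (tagged t st)" for t
    by (simp add: tagged_def st'_def)
  ultimately show ?thesis using mem st by (intro bexI[of _ st']) auto
qed

text \<open>The guess is the number of users that \<pi> sends to \<open>f\<close> from other legs,
  and the slot of \<open>f\<close> holds as many users as \<pi> sends there from its own leg. So the
  size test in \<open>fac_moves\<close> becomes the assumption on \<pi>.\<close>

lemma follow_fac:
  assumes ev: "events T us F = P @ e # Q" and e: "e = fac_event T f" "f \<in> set F"
    and st: "\<forall>t\<in>set (tags T). length (tagged t st) = card (filed \<pi> P t)"
  shows "\<exists>st'\<in>set (moves T F [0..<n] r e st). \<forall>t\<in>set (tags T). length (tagged t st') = card (filed \<pi> (P @ [e]) t)"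
proof -
  define s where "s = (0::nat, snd f mod W)"
  define G where "G = {u. u < n \<and> \<pi> u = f \<and> fst (us ! u) \<noteq> fst f}"
  define g where "g = card G"
  define st' where "st' = (map (\<lambda>_. ((2::nat, snd f), fst f)) (filter (\<lambda>k. k < g) [0..<n]) @ filter (\<lambda>p. fst p \<noteq> s) (fst st),
             map (\<lambda>u. (u, f)) (tagged s st) @ snd st)"
  have eP: "e \<notin> set P" using distinct_events ev by auto
  have finG: "finite G" by (rule finite_subset[of _ "{..<n}"]) (auto simp: G_def)
  have g: "g \<le> n" unfolding g_def using card_mono[of "{..<n}" G] by (auto simp: G_def)
  have gT: "g = 0 \<or> snd f \<le> T"
  proof (cases "G = {}")
    case False
    then obtain u where "u < n" "\<pi> u = f" "fst (us ! u) \<noteq> fst f" by (auto simp: G_def)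
    then show ?thesis using \<pi>[of u] by (auto simp: compat_def)
  qed (simp add: g_def)
  \<comment> \<open>No other facility can own the slot now, by \<open>slot_owner\<close>, and all
    users of \<open>f\<close> on its leg have passed, by \<open>own_user_done\<close>.\<close>
  have own': "filed \<pi> P s = {u. u < n \<and> \<pi> u = f \<and> fst (us ! u) = fst f}"
  proof (intro set_eqI iffI)
    fix u assume u: "u \<in> filed \<pi> P s"
    then have un: "u < n" by (simp add: filed_def)
    have "fac_event T (\<pi> u) \<in> set (events T us F)" using \<pi>[OF un] by (simp add: set_events)
    then have "fac_event T (\<pi> u) \<in> set (fac_event T f # Q)" using u ev e(1) by (auto simp: filed_def s_def)
    then have "\<pi> u = f" using slot_owner[of P f Q u "\<pi> u"] ev e(1) u \<pi>[OF un] by (auto simp: filed_def s_def)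
    then show "u \<in> {u. u < n \<and> \<pi> u = f \<and> fst (us ! u) = fst f}" using u by (auto simp: filed_def s_def)
  next
    fix u assume u: "u \<in> {u. u < n \<and> \<pi> u = f \<and> fst (us ! u) = fst f}"
    then show "u \<in> filed \<pi> P s"
      using own_user_done[of P f Q u] \<pi>[of u] ev e(1) eP by (auto simp: filed_def s_def)
  qed
  have s_tag: "s \<in> set (tags T)" by (simp add: s_def set_tags)
  have "{u. u < n \<and> \<pi> u = f} = filed \<pi> P s \<union> G" unfolding own' G_def by auto
  moreover have "filed \<pi> P s \<inter> G = {}" unfolding own' G_def by auto
  ultimately have "card {u. u < n \<and> \<pi> u = f} = length (tagged s st) + g"
    using st s_tag finG by (simp add: card_Un_disjoint g_def)
  then have sz: "length (tagged s st) + g = 0 \<or> r \<le> length (tagged s st) + g" using size[OF e(2)] by simp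
  have mem: "st' \<in> set (moves T F [0..<n] r e st)"
    using g gT sz unfolding moves_def e(1) fac_event_def fst_conv snd_conv if_True mem_fac_moves st'_def s_def prod.collapse
    by blast
  have lg: "length (filter (\<lambda>k. k < g) [0..<n]) = g"
  proof -
    have "[0..<n] = [0..<g] @ [g..<n]" using upt_add_eq_append[of 0 g "n - g"] g by simp
    then show ?thesis by simp
  qed
  have fe: "fac_event T f' = e \<longleftrightarrow> f' = f" for f' using e(1) fac_event_inj by simp
  have ue: "user_event u c \<noteq> e" for u c using e(1) by simp
  have "length (tagged t st') = card (filed \<pi> (P @ [e]) t)" if t: "t \<in> set (tags T)" for t
  proof -
    have len: "length (tagged t st') = (if t = (2, snd f) then g else 0) + (if t = s then 0 else length (tagged t st))"
      using lg by (auto simp: tagged_def st'_def filter_map o_def conj_commute cong: conj_cong)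
    consider (own) "t = s" | (slot) "fst t = 0" "t \<noteq> s" | (user) "fst t = 1" | (token) "fst t = 2" "t = (2, snd f)"
      | (other) "fst t = 2" "t \<noteq> (2, snd f)"
      using t by (force simp: set_tags)
    then show ?thesis
    proof cases
      case own
      have "filed \<pi> (P @ [e]) s = {}"
      proof -
        have "filed \<pi> (P @ [e]) s \<subseteq> filed \<pi> P s" by (auto simp: filed_def s_def ue)
        then show ?thesis using own' by (auto simp: filed_def s_def fe)
      qed
      then show ?thesis using own len by (auto simp: s_def)
    next
      case slot
      then have "filed \<pi> (P @ [e]) t = filed \<pi> P t"
        by (cases t) (auto simp: filed_def ue fe s_def)
      then show ?thesis using slot len st t by auto
    next
      case user
      then have "filed \<pi> (P @ [e]) t = filed \<pi> P t" by (auto simp: filed_def ue)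
      then show ?thesis using user len st t by (auto simp: s_def)
    next
      case token
      then have "filed \<pi> (P @ [e]) t = filed \<pi> P t \<union> G" by (auto simp: filed_def fe G_def)
      moreover have "filed \<pi> P t \<inter> G = {}" using eP e(1) token by (auto simp: filed_def G_def)
      ultimately show ?thesis using token len st t finG by (simp add: card_Un_disjoint g_def s_def)
    next
      case other
      then have "filed \<pi> (P @ [e]) t = filed \<pi> P t" by (cases t) (auto simp: filed_def fe)
      then show ?thesis using other len st t by (auto simp: s_def)
    qed
  qed
  then show ?thesis using mem by blast
qed

lemma follow_run:
  "events T us F = P @ Q \<Longrightarrow> \<exists>st\<in>set (run P). \<forall>t\<in>set (tags T). length (tagged t st) = card (filed \<pi> P t)"
proof (induction P arbitrary: Q rule: rev_induct)
  case Nil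
  have "filed \<pi> [] t = {}" for t by (auto simp: filed_def)
  then show ?case by (simp add: run_def tagged_def)
next
  case (snoc e P)
  then have ev: "events T us F = P @ e # Q" by simp
  from snoc.IH[OF ev] obtain st where st: "st \<in> set (run P)"
    "\<forall>t\<in>set (tags T). length (tagged t st) = card (filed \<pi> P t)" by blast
  obtain st' where st': "st' \<in> set (moves T F [0..<n] r e st)"
    "\<forall>t\<in>set (tags T). length (tagged t st') = card (filed \<pi> (P @ [e]) t)"
    using event_cases[OF ev] follow_user[OF ev _ _ st(2)] follow_fac[OF ev _ _ st(2)] by metis
  \<comment> \<open>Numbers of users never exceed \<open>n\<close>, so the state passes the filter
    in \<open>step\<close>. Deduplication may replace it, but only by a state with the same
    key.\<close>
  have "\<forall>c\<in>set (key T st'). c \<le> n" using st'(2) card_filed_le by (auto simp: key_def)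
  then have "key T st' \<in> key T ` set (run (P @ [e]))"
    using st(1) st'(1) unfolding run_snoc step_def image_dedupe by auto
  then obtain st'' where st'': "st'' \<in> set (run (P @ [e]))" "key T st'' = key T st'" by force
  then have "\<forall>t\<in>set (tags T). length (tagged t st'') = length (tagged t st')"
    by (simp add: key_def)
  with st''(1) st'(2) show ?case by (intro bexI[of _ st'']) auto
qed

text \<open>When all events are processed, the users counted for position \<open>j\<close> of
  another leg and the users for whom there is a token at \<open>j\<close> form the same set. So the
  state with these counts is accepted.\<close>

theorem solve_cells_complete: "solve_cells T us F r \<noteq> []"
proof -
  obtain st where st: "st \<in> set (run (events T us F))"
    "\<forall>t\<in>set (tags T). length (tagged t st) = card (filed \<pi> (events T us F) t)"
    using follow_run[of "events T us F" "[]"] by auto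
  have "filed \<pi> (events T us F) (1, j) = filed \<pi> (events T us F) (2, j)" for j
    using \<pi> by (auto simp: filed_def set_events)
  then have "accept T st" using st(2) by (auto simp: accept_def set_tags)
  then show ?thesis using st(1) by (force simp: solve_cells_def run_def filter_empty_conv)
qed

end

end

section \<open>Running time of the sweep\<close>

lemma polytime_eq_pair [polytime_intros]:
  fixes f g :: "'a::enc \<Rightarrow> nat \<times> nat"
  shows "polytime f \<Longrightarrow> polytime g \<Longrightarrow> polytime (\<lambda>z. f z = g z)"
  unfolding prod_eq_iff by (intro polytime_intros)

lemma polytime_less_pair [polytime_intros]:
  fixes f g :: "'a::enc \<Rightarrow> nat \<times> nat"
  shows "polytime f \<Longrightarrow> polytime g \<Longrightarrow> polytime (\<lambda>z. f z < g z)"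
  unfolding less_prod_def by (intro polytime_intros)

lemma polytime_const_pair [polytime_intros]: "polytime (\<lambda>_. c :: nat \<times> nat)"
  by (cases c) (auto intro: polytime_intros)

lemma polytime_eq_nat_list [polytime_intros]:
  fixes f g :: "'a::enc \<Rightarrow> nat list"
  assumes "polytime f" "polytime g" shows "polytime (\<lambda>z. f z = g z)"
proof -
  have "polytime (\<lambda>z. length (f z) = length (g z) \<and> (\<forall>p\<in>set (zip (f z) (g z)). fst p = snd p))"
    by (intro polytime_intros assms)
  then show ?thesis by (simp add: list_eq_iff_zip_eq split_beta)
qed

lemma sz_dedupe_aux: "sz (foldl (\<lambda>a x. if \<exists>y\<in>set a. k y = k x then a else x # a) acc xs) \<le> sz acc + sz xs"
proof (induction xs arbitrary: acc)
  case (Cons x xs)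
  let ?acc = "if \<exists>y\<in>set acc. k y = k x then acc else x # acc"
  have "sz ?acc \<le> sz acc + sz x + 1" by simp
  then show ?case using Cons.IH[of ?acc] by simp
qed simp

text \<open>Only equality of keys has to be decided, which is why the key type carries no
  encoding.\<close>

lemma polytime_dedupe [polytime_intros]:
  fixes k :: "'z::enc \<Rightarrow> 'a::enc \<Rightarrow> 'k"
  assumes "polytime (\<lambda>p. k (fst p) (fst (snd p)) = k (fst p) (snd (snd p)))" and xs: "polytime xs"
  shows "polytime (\<lambda>z. dedupe (k z) (xs z))"
  unfolding dedupe_def
proof (rule polytime_foldl[where b = "\<lambda>z. 1 + sz (xs z)"])
  have "polytime (\<lambda>q::('z \<times> 'a list \<times> 'a) \<times> 'a. k (fst (fst q)) (snd q) = k (fst (fst q)) (snd (snd (fst q))))"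
    using polytime_comp[OF assms(1), of "\<lambda>q::('z \<times> 'a list \<times> 'a) \<times> 'a. (fst (fst q), snd q, snd (snd (fst q)))"]
    by (simp add: polytime_intros)
  then show "polytime (\<lambda>p. if \<exists>y\<in>set (fst (snd p)). k (fst p) y = k (fst p) (snd (snd p)) then fst (snd p) else snd (snd p) # fst (snd p))"
    by (intro polytime_intros)
  fix z ys zs assume "xs z = ys @ zs"
  then show "sz (foldl (\<lambda>a x. if \<exists>y\<in>set a. k z y = k z x then a else x # a) [] ys) \<le> 1 + sz (xs z)"
    using sz_dedupe_aux[of "k z" "[]" ys] sz_append[of ys zs] sz_ge_2[of zs] by simp
qed (intro polytime_intros polybd_intros polytime_sz xs)+

lemma polytime_isort [polytime_intros]:
  fixes xs :: "'z::enc \<Rightarrow> ((nat \<times> nat) \<times> 'b::enc) list"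
  assumes xs: "polytime xs"
  shows "polytime (\<lambda>z. isort (xs z))"
  unfolding isort_def
proof (rule polytime_foldl[where b = "\<lambda>z. sz (xs z)"])
  show "polytime (\<lambda>p :: 'z \<times> ((nat \<times> nat) \<times> 'b) list \<times> ((nat \<times> nat) \<times> 'b). ins (snd (snd p)) (fst (snd p)))"
    unfolding ins_def by (intro polytime_intros)
  fix z ys zs assume z: "xs z = ys @ zs"
  have "sz (foldl (\<lambda>a x. ins x a) [] ys) = sz ys" by (rule sz_perm) (simp add: mset_foldl_ins)
  then show "sz (foldl (\<lambda>a x. ins x a) [] ys) \<le> sz (xs z)"
    using sz_append[of ys zs] sz_ge_2[of zs] z by simp
qed (intro polytime_intros polytime_sz xs)+

lemma polytime_tagged [polytime_intros]:
  assumes "polytime t" "polytime st"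
  shows "polytime (\<lambda>z. tagged (t z) (st z))"
  unfolding tagged_def by (intro polytime_intros assms[THEN polytime_comp])

lemma polytime_key [polytime_intros]:
  assumes "polytime st"
  shows "polytime (\<lambda>z. key T (st z))"
  unfolding key_def by (intro polytime_intros assms[THEN polytime_comp])

lemma polytime_compat [polytime_intros]:
  assumes "polytime c" "polytime f"
  shows "polytime (\<lambda>z. compat T (c z) (f z))"
  unfolding compat_def by (intro polytime_intros assms[THEN polytime_comp])

lemma polytime_user_moves [polytime_intros]:
  assumes "polytime F" "polytime l" "polytime i" "polytime u" "polytime st"
  shows "polytime (\<lambda>z. user_moves T (F z) (l z) (i z) (u z) (st z))"
  unfolding user_moves_def by (intro polytime_intros assms[THEN polytime_comp])

lemma polytime_fac_moves [polytime_intros]: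
  assumes "polytime ns" "polytime r" "polytime l" "polytime j" "polytime st"
  shows "polytime (\<lambda>z. fac_moves T (ns z) (r z) (l z) (j z) (st z))"
  unfolding fac_moves_def by (intro polytime_intros assms[THEN polytime_comp])

lemma polytime_moves [polytime_intros]:
  assumes "polytime F" "polytime ns" "polytime r" "polytime e" "polytime st"
  shows "polytime (\<lambda>z. moves T (F z) (ns z) (r z) (e z) (st z))"
  unfolding moves_def by (intro polytime_intros assms[THEN polytime_comp])

lemma polytime_step [polytime_intros]:
  assumes "polytime F" "polytime ns" "polytime r" "polytime sts" "polytime e"
  shows "polytime (\<lambda>z. step T (F z) (ns z) (r z) (sts z) (e z))"
  unfolding step_def by (intro polytime_intros assms[THEN polytime_comp])

lemma polytime_events [polytime_intros]:
  assumes "polytime us" "polytime F"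
  shows "polytime (\<lambda>z. events T (us z) (F z))"
  unfolding events_def user_event_def fac_event_def by (intro polytime_intros assms[THEN polytime_comp])

lemma polytime_accept [polytime_intros]:
  assumes "polytime st"
  shows "polytime (\<lambda>z. accept T (st z))"
  unfolding accept_def by (intro polytime_intros assms[THEN polytime_comp])

lemma polytime_result [polytime_intros]:
  assumes "polytime st"
  shows "polytime (\<lambda>z. result T (st z))"
  unfolding result_def by (intro polytime_intros assms[THEN polytime_comp])

text \<open>Turns the bound on the counters into a bound on the number of items in a state, all of
  whose tags occur in \<open>tags T\<close>.\<close>

lemma length_le_classes:
  "(\<And>x. x \<in> set xs \<Longrightarrow> f x \<in> set ts) \<Longrightarrow> length xs \<le> (\<Sum>t\<leftarrow>ts. length (filter (\<lambda>x. f x = t) xs))"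
proof (induction xs)
  case (Cons x xs)
  have "f x \<in> set ts" using Cons.prems by simp
  then have "1 \<le> (\<Sum>t\<leftarrow>ts. if f x = t then 1 else 0::nat)" by (induction ts) auto
  moreover have "(\<Sum>t\<leftarrow>ts. length (filter (\<lambda>x. f x = t) (x # xs)))
    = (\<Sum>t\<leftarrow>ts. length (filter (\<lambda>x. f x = t) xs)) + (\<Sum>t\<leftarrow>ts. if f x = t then 1 else 0)"
    by (induction ts) auto
  moreover have "length xs \<le> (\<Sum>t\<leftarrow>ts. length (filter (\<lambda>x. f x = t) xs))" using Cons by auto
  ultimately show ?case by simp
qed simp

context cells
begin

definition item_size :: nat where
  "item_size = 10 + 2 * T + sz us + sz F"

definition state_size :: nat where
  "state_size = 3 + length (tags T) * n * (1 + item_size) + n * (1 + item_size)"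

text \<open>The soundness invariant serves a second purpose here: it confines tags, user indices and
  legs, and it bounds the number of attached users by the number of processed ones.\<close>

lemma sz_state_le:
  assumes ev: "events T us F = P @ Q" and st: "st \<in> set (run P)"
  shows "sz st \<le> state_size"
proof -
  have sd: "sound P Q st" by (rule sound_run[OF ev st])
  have user_size: "sz u \<le> sz us" if "u < n" for u :: nat
    using sz_nat_le[of u] that length_le_sz[of us] by linarith
  have tag: "fst p \<in> set (tags T)" and ok: "item_ok P Q p" if "p \<in> set (fst st)" for p
    using sd that by (auto simp: sound_def item_ok_def)
  have "length (fst st) \<le> (\<Sum>t\<leftarrow>tags T. length (tagged t st))"
    unfolding tagged_def length_map by (rule length_le_classes) (rule tag)
  also have "\<dots> = sum_list (key T st)" by (simp add: key_def)
  also have "\<dots> \<le> length (key T st) * n"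
    using sum_list_mono[of "key T st" "\<lambda>x. x" "\<lambda>_. n"] run_keys(2)[OF st] by (simp add: sum_list_triv)
  finally have li: "length (fst st) \<le> length (tags T) * n" by (simp add: key_def)
  have "sz p \<le> item_size" if "p \<in> set (fst st)" for p
  proof -
    obtain a b c where p: "p = ((a, b), c)" by (cases p) auto
    have "a \<le> 2" "b \<le> 2 * T" using tag[OF that] by (auto simp: p set_tags)
    then have ab: "sz a \<le> 3" "sz b \<le> 2 * T + 1" using sz_nat_le[of a] sz_nat_le[of b] by linarith+
    have "sz c \<le> sz us + sz F"
    proof (cases "a = 2")
      case True
      then have "(c, b) \<in> set F" using ok[OF that] by (simp add: item_ok_def p)
      then have "sz (c, b) < sz F" by (rule sz_member)
      then show ?thesis by simp
    next
      case False
      then have "c < n" using ok[OF that] tag[OF that] by (auto simp: item_ok_def p set_tags)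
      then show ?thesis using user_size[of c] by linarith
    qed
    with ab show ?thesis unfolding p item_size_def enc_simps(3) data_len.simps(2) by linarith
  qed
  then have "sz (fst st) \<le> 1 + length (fst st) * (1 + item_size)" by (rule sz_list_le)
  also have "\<dots> \<le> 1 + length (tags T) * n * (1 + item_size)"
    using li by (intro add_left_mono mult_right_mono) auto
  finally have 1: "sz (fst st) \<le> 1 + length (tags T) * n * (1 + item_size)" .
  have "size (mset (map fst (snd st))) \<le> size (mset (users_of P))"
    using sd by (intro size_mset_mono) (metis sound_def mset_subset_eq_add_left)
  also have "\<dots> \<le> size (mset (users_of (events T us F)))"
    by (simp add: ev users_of_def)
  finally have ld: "length (snd st) \<le> n" by (simp only: mset_users_of_events) simp
  have "sz p \<le> item_size" if "p \<in> set (snd st)" for p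
  proof -
    have "fst p < n" "snd p \<in> set F" using sd that by (auto simp: sound_def)
    then have "sz (fst p) \<le> sz us" "sz (snd p) < sz F" using user_size sz_member by auto
    then show ?thesis by (cases p) (simp add: item_size_def)
  qed
  then have "sz (snd st) \<le> 1 + length (snd st) * (1 + item_size)" by (rule sz_list_le)
  also have "\<dots> \<le> 1 + n * (1 + item_size)"
    using ld by (intro add_left_mono mult_right_mono) auto
  finally have 2: "sz (snd st) \<le> 1 + n * (1 + item_size)" .
  have "sz st = 1 + sz (fst st) + sz (snd st)" by (cases st) simp
  with 1 2 show ?thesis unfolding state_size_def by linarith
qed

text \<open>The keys are pairwise distinct vectors over \<open>{..n}\<close> with one entry per tag.
  As \<open>T\<close> is fixed, the exponent is a constant.\<close>

lemma length_run_le: "length (run P) \<le> (n + 1) ^ length (tags T)"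
proof -
  have "length (run P) = card (key T ` set (run P))"
    using distinct_card[OF run_keys(1)[of P]] by simp
  also have "\<dots> \<le> card {ks. set ks \<subseteq> {..n} \<and> length ks = length (tags T)}"
    using run_keys(2)[of _ P] by (intro card_mono finite_lists_length_eq) (auto simp: key_def)
  also have "\<dots> = (n + 1) ^ length (tags T)" by (simp add: card_lists_length_eq)
  finally show ?thesis .
qed

lemma sz_run_le:
  assumes "events T us F = P @ Q"
  shows "sz (run P) \<le> 1 + (n + 1) ^ length (tags T) * (1 + state_size)"
proof -
  have "sz (run P) \<le> 1 + length (run P) * (1 + state_size)"
    by (rule sz_list_le) (rule sz_state_le[OF assms])
  also have "\<dots> \<le> 1 + (n + 1) ^ length (tags T) * (1 + state_size)"
    by (intro add_left_mono mult_right_mono length_run_le) simp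
  finally show ?thesis .
qed

end

lemma polytime_solve_cells [polytime_intros]:
  assumes us: "polytime us" and F: "polytime F" and r: "polytime r" and dist: "\<And>z. distinct (F z)"
  shows "polytime (\<lambda>z. solve_cells T (us z) (F z) (r z))"
proof -
  \<comment> \<open>The bound of \<open>sz_run_le\<close> with \<open>n\<close> replaced by the size
    of \<open>us\<close>. The number \<open>T\<close> is built into the program, so the power is
    polynomial.\<close>
  define b where "b z = 1 + (sz (us z) + 1) ^ length (tags T) *
    (1 + (3 + length (tags T) * sz (us z) * (1 + (10 + 2 * T + sz (us z) + sz (F z)))
      + sz (us z) * (1 + (10 + 2 * T + sz (us z) + sz (F z)))))" for z
  have "polytime (\<lambda>z. foldl (step T (F z) [0..<length (us z)] (r z)) [([], [])] (events T (us z) (F z)))"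
  proof (rule polytime_foldl[where b = b])
    show "polytime (\<lambda>p. step T (F (fst p)) [0..<length (us (fst p))] (r (fst p)) (fst (snd p)) (snd (snd p)))"
      by (intro polytime_intros us[THEN polytime_comp] F[THEN polytime_comp] r[THEN polytime_comp])
    show "polybd b" unfolding b_def by (intro polybd_intros polytime_sz us F)
    fix z ys zs assume z: "events T (us z) (F z) = ys @ zs"
    interpret cells T "us z" "F z" "r z" by unfold_locales (rule dist)
    have n: "n \<le> sz (us z)" using length_le_sz[of "us z"] by linarith
    have "sz (foldl (step T (F z) [0..<length (us z)] (r z)) [([], [])] ys)
      \<le> 1 + (n + 1) ^ length (tags T) * (1 + state_size)"
      using sz_run_le[OF z] by (simp add: run_def)
    also have "\<dots> \<le> b z" unfolding b_def state_size_def item_size_def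
      by (intro add_mono mult_mono power_mono n) simp_all
    finally show "sz (foldl (step T (F z) [0..<length (us z)] (r z)) [([], [])] ys) \<le> b z" .
  qed (intro polytime_intros us F)+
  then show ?thesis unfolding solve_cells_def by (intro polytime_intros)
qed

section \<open>Gathering with integral positions\<close>

definition idist :: "nat \<times> nat \<Rightarrow> nat \<times> nat \<Rightarrow> nat" where
  "idist p q = (if fst p = fst q then (snd p - snd q) + (snd q - snd p) else snd p + snd q)"

text \<open>Position in units of \<open>B / N\<close>, rounded down; multiplying before dividing
  keeps everything integral.\<close>

definition cell :: "nat \<Rightarrow> nat \<Rightarrow> nat \<times> nat \<Rightarrow> nat \<times> nat" where
  "cell N B p = (fst p, snd p * N div B)"

text \<open>Rounding down respects shifts by the integer \<open>N\<close>, and the sum of two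
  rounded numbers is at most their rounded sum. So rounding loses no solution of radius
  \<open>B\<close>.\<close>

lemma compat_cell:
  assumes "idist p q \<le> B" "0 < B" shows "compat N (cell N B p) (cell N B q)"
proof (cases "fst p = fst q")
  case True
  have "x * N div B \<le> y * N div B + N" if "x \<le> y + B" for x y
  proof -
    have "x * N \<le> y * N + N * B" using mult_right_mono[OF that, of N] by (simp add: algebra_simps)
    then have "x * N div B \<le> (y * N + N * B) div B" by (rule div_le_mono)
    then show ?thesis using assms(2) by simp
  qed
  then show ?thesis using assms(1) True by (simp add: compat_def cell_def idist_def)
next
  case False
  then have "snd p * N + snd q * N \<le> N * B"
    using assms(1) by (simp add: idist_def) (metis add_mult_distrib mult.commute mult_le_mono1)
  then have "(snd p * N + snd q * N) div B \<le> N * B div B" by (rule div_le_mono)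
  then have "(snd p * N) div B + (snd q * N) div B \<le> N"
    using assms(2) div_add1_eq[of "snd p * N" "snd q * N" B] by simp
  then show ?thesis using False by (simp add: compat_def cell_def)
qed

text \<open>Each of the two roundings discards less than one unit \<open>B / N\<close>, so the true
  distance is at most \<open>N + 2\<close> units.\<close>

lemma idist_le_if_compat_cell:
  assumes "compat N (cell N B p) (cell N B q)" "0 < B"
  shows "idist p q * N \<le> (N + 2) * B"
proof -
  have up: "x * N \<le> (x * N div B + 1) * B" for x
    using dividend_less_div_times[OF assms(2), of "x * N"] by (simp add: algebra_simps)
  have lo: "(x * N div B) * B \<le> x * N" for x by (rule div_times_less_eq_dividend)
  show ?thesis
  proof (cases "fst p = fst q")
    case True
    have "(x - y) * N \<le> (N + 2) * B" if "x * N div B \<le> y * N div B + N" for x y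
    proof -
      have "x * N \<le> (y * N div B + N + 1) * B"
        using up[of x] mult_right_mono[of "x * N div B + 1" "y * N div B + N + 1" B] that by linarith
      also have "\<dots> \<le> y * N + (N + 2) * B"
        using lo[of y] by (simp only: add_mult_distrib)
      finally show ?thesis by (simp add: diff_mult_distrib)
    qed
    moreover have "idist p q = snd p - snd q \<or> idist p q = snd q - snd p"
      using True by (auto simp: idist_def)
    ultimately show ?thesis using assms(1) True by (auto simp: compat_def cell_def)
  next
    case False
    then have "snd p * N div B + snd q * N div B \<le> N" using assms(1) by (simp add: compat_def cell_def)
    then have "(snd p * N div B + 1 + (snd q * N div B + 1)) * B \<le> (N + 2) * B" by (intro mult_right_mono) auto
    with up[of "snd p"] up[of "snd q"] False show ?thesis by (simp add: idist_def algebra_simps)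
  qed
qed

text \<open>
  Adding 1 to the distances makes every candidate radius positive; the zeros only pad the candidates
  to the type of entries that \<open>isort\<close> handles in polynomial time.
\<close>

definition candidates :: "(nat \<times> nat) list \<Rightarrow> (nat \<times> nat) list \<Rightarrow> ((nat \<times> nat) \<times> nat) list" where
  "candidates us fs = isort (concat (map (\<lambda>u. map (\<lambda>f. ((idist u f + 1, 0), 0)) fs) us))"

text \<open>The radius accompanies each solution because \<open>decode\<close> has to recompute the
  cells. All radii are tried, since folds have no early exit.\<close>

definition attempts :: "nat \<Rightarrow> (nat \<times> nat) list \<Rightarrow> (nat \<times> nat) list \<Rightarrow> nat \<Rightarrow> (nat \<times> (nat \<times> nat \<times> nat) list) list" where
  "attempts N us fs r = concat (map (\<lambda>c. map (\<lambda>R. (fst (fst c), R))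
     (solve_cells N (map (cell N (fst (fst c))) us) (dedupe (\<lambda>x. x) (map (cell N (fst (fst c))) fs)) r)) (candidates us fs))"

text \<open>All users of a cell go to the first facility in it; splitting them among its facilities
  could violate the lower bound \<open>r\<close>. The default 0 is reached only if no solution was
  found.\<close>

definition decode :: "nat \<Rightarrow> (nat \<times> nat) list \<Rightarrow> (nat \<times> nat) list \<Rightarrow> nat \<times> (nat \<times> nat \<times> nat) list \<Rightarrow> nat list" where
  "decode N us fs s = map (\<lambda>u. headd 0 (map fst (filter (\<lambda>q. \<exists>p\<in>set (snd s). fst p = u \<and> snd p = cell N (fst s) (snd q))
     (zip [0..<length fs] fs)))) [0..<length us]"

definition gather :: "nat \<Rightarrow> (nat \<times> nat) list \<Rightarrow> (nat \<times> nat) list \<Rightarrow> nat \<Rightarrow> nat list" where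
  "gather N us fs r = decode N us fs (headd (0, []) (attempts N us fs r))"

text \<open>No radius has to be shown infeasible: the first success has a radius at most that of any
  known success.\<close>

lemma headd_concat_sorted:
  assumes "sorted (map fst xs)" "x \<in> set xs" "g x \<noteq> []"
  shows "\<exists>y\<in>set xs. fst y \<le> fst x \<and> headd d (concat (map g xs)) \<in> set (g y)"
  using assms
proof (induction xs)
  case (Cons z xs)
  show ?case
  proof (cases "g z")
    case Nil
    then show ?thesis using Cons by (auto dest: Cons.IH)
  next
    case (Cons a as)
    then show ?thesis using Cons.prems by (intro bexI[of _ z]) auto
  qed
qed simp

lemma headd_filter_zip:
  assumes "k < length fs" "Q (fs ! k)"
  shows "\<exists>i<length fs. headd d (map fst (filter (\<lambda>q. Q (snd q)) (zip [0..<length fs] fs))) = i \<and> Q (fs ! i)"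
proof -
  let ?ys = "map fst (filter (\<lambda>q. Q (snd q)) (zip [0..<length fs] fs))"
  have "k \<in> set ?ys" using assms by (force simp: set_zip)
  then obtain y ys where "?ys = y # ys" by (cases ?ys) auto
  moreover from this have "y \<in> set ?ys" by simp
  then have "y < length fs \<and> Q (fs ! y)" by (auto simp: set_zip)
  ultimately show ?thesis by simp
qed

definition gathers :: "nat \<Rightarrow> nat \<Rightarrow> nat \<Rightarrow> (nat \<Rightarrow> nat) \<Rightarrow> bool" where
  "gathers n m r \<sigma> \<longleftrightarrow> (\<forall>u<n. \<sigma> u < m) \<and> (\<forall>f<m. card {u. u < n \<and> \<sigma> u = f} = 0 \<or> r \<le> card {u. u < n \<and> \<sigma> u = f})"

text \<open>A facility either is the first of its cell and gets the whole load of the cell, or gets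
  nothing; both satisfy the size condition.\<close>

lemma decode_correct:
  assumes B: "0 < B"
    and R: "R \<in> set (solve_cells N (map (cell N B) us) (dedupe (\<lambda>x. x) (map (cell N B) fs)) r)"
  shows "gathers (length us) (length fs) r ((!) (decode N us fs (B, R)))"
    and "u < length us \<Longrightarrow> idist (us ! u) (fs ! (decode N us fs (B, R) ! u)) * N \<le> (N + 2) * B"
proof -
  define F where "F = dedupe (\<lambda>x. x) (map (cell N B) fs)"
  define \<rho> where "\<rho> = (!) (decode N us fs (B, R))"
  have setF: "set F = cell N B ` set fs" using image_dedupe[of "\<lambda>x. x" "map (cell N B) fs"] by (simp add: F_def)
  interpret cells N "map (cell N B) us" F r
    by unfold_locales (use distinct_dedupe[of "\<lambda>x. x"] in \<open>simp add: F_def\<close>)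
  note sound = solve_cells_sound[OF R[folded F_def]]
  have sound1: "mset (map fst R) = mset [0..<length us]" using sound(1) by simp
  note sound2 = sound(2) and sound3 = sound(3)
  have dist: "distinct (map fst R)" using sound1 by (metis distinct_upt mset_eq_imp_distinct_iff)
  have setR: "fst ` set R = {..<length us}" using arg_cong[OF sound1, of set_mset] by (simp add: lessThan_atLeast0)
  have inj: "inj_on fst (set R)" using dist by (simp add: distinct_map)
  define first where "first c = headd 0 (map fst (filter (\<lambda>q. c = cell N B (snd q)) (zip [0..<length fs] fs)))" for c
  have first: "first c < length fs \<and> cell N B (fs ! first c) = c" if "c \<in> set F" for c
  proof -
    from that obtain k where "k < length fs" "c = cell N B (fs ! k)" unfolding setF by (auto simp: in_set_conv_nth)
    from headd_filter_zip[of k fs "\<lambda>q. c = cell N B q" 0] this show ?thesis by (auto simp: first_def)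
  qed
  have \<rho>: "\<rho> (fst p) = first (snd p)" if "p \<in> set R" for p
  proof -
    have "fst p < length us" using that setR by auto
    moreover have "(\<exists>q\<in>set R. fst q = fst p \<and> snd q = c) \<longleftrightarrow> snd p = c" for c
      using that inj by (metis inj_onD)
    ultimately show ?thesis by (simp add: \<rho>_def decode_def first_def)
  qed
  have ex: "\<exists>p\<in>set R. fst p = u" if "u < length us" for u using that setR by (metis imageE lessThan_iff)
  show "gathers (length us) (length fs) r ((!) (decode N us fs (B, R)))"
    unfolding gathers_def \<rho>_def[symmetric]
  proof (intro conjI allI impI)
    fix u assume "u < length us"
    with ex obtain p where "p \<in> set R" "fst p = u" by blast
    then show "\<rho> u < length fs" using \<rho> first sound2 by metis
  next
    fix f assume f: "f < length fs"
    show "card {u. u < length us \<and> \<rho> u = f} = 0 \<or> r \<le> card {u. u < length us \<and> \<rho> u = f}"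
    proof (cases "f = first (cell N B (fs ! f))")
      case True
      have cF: "cell N B (fs ! f) \<in> set F" using f setF by auto
      have "{u. u < length us \<and> \<rho> u = f} = fst ` {p \<in> set R. snd p = cell N B (fs ! f)}"
      proof (intro set_eqI iffI)
        fix u assume u: "u \<in> {u. u < length us \<and> \<rho> u = f}"
        with ex obtain p where p: "p \<in> set R" "fst p = u" by blast
        then have "f = first (snd p)" using \<rho>[OF p(1)] u by simp
        then have "snd p = cell N B (fs ! f)" using first sound2 p by metis
        then show "u \<in> fst ` {p \<in> set R. snd p = cell N B (fs ! f)}" using p by auto
      next
        fix u assume "u \<in> fst ` {p \<in> set R. snd p = cell N B (fs ! f)}"
        then show "u \<in> {u. u < length us \<and> \<rho> u = f}" using \<rho> True setR by auto
      qed
      also have "card \<dots> = card {p \<in> set R. snd p = cell N B (fs ! f)}"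
        by (rule card_image) (rule inj_on_subset[OF inj], auto)
      also have "\<dots> = length (filter (\<lambda>p. snd p = cell N B (fs ! f)) R)"
        using distinct_card[of "filter (\<lambda>p. snd p = cell N B (fs ! f)) R"] dist by (simp add: distinct_map)
      finally show ?thesis using sound3[OF cF] by simp
    next
      case False
      have "\<rho> u \<noteq> f" if "u < length us" for u
      proof -
        from ex that obtain p where p: "p \<in> set R" "fst p = u" by blast
        then have "\<rho> u = first (snd p)" "cell N B (fs ! first (snd p)) = snd p"
          using \<rho>[OF p(1)] first sound2[OF p(1)] by simp_all
        then show ?thesis using False by metis
      qed
      then have "{u. u < length us \<and> \<rho> u = f} = {}" by auto
      then show ?thesis by simp
    qed
  qed
  show "idist (us ! u) (fs ! (decode N us fs (B, R) ! u)) * N \<le> (N + 2) * B" if u: "u < length us"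
  proof -
    from ex u obtain p where p: "p \<in> set R" "fst p = u" by blast
    then have "cell N B (fs ! \<rho> u) = snd p"
      using \<rho>[OF p(1)] first sound2[OF p(1)] by simp
    moreover have "compat N (cell N B (us ! u)) (snd p)" using sound2[OF p(1)] p(2) u by simp
    ultimately show ?thesis using idist_le_if_compat_cell B unfolding \<rho>_def by metis
  qed
qed

text \<open>Merging the facilities of a cell adds up their loads, so the lower bound on loads
  survives; compatibility survives by \<open>compat_cell\<close>.\<close>

lemma solve_cells_nonempty:
  assumes B: "0 < B" and \<sigma>: "gathers (length us) (length fs) r \<sigma>"
    and d: "\<And>u. u < length us \<Longrightarrow> idist (us ! u) (fs ! \<sigma> u) \<le> B"
  shows "solve_cells N (map (cell N B) us) (dedupe (\<lambda>x. x) (map (cell N B) fs)) r \<noteq> []"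
proof -
  define F where "F = dedupe (\<lambda>x. x) (map (cell N B) fs)"
  have setF: "set F = cell N B ` set fs" using image_dedupe[of "\<lambda>x. x" "map (cell N B) fs"] by (simp add: F_def)
  interpret cells N "map (cell N B) us" F r
    by unfold_locales (use distinct_dedupe[of "\<lambda>x. x"] in \<open>simp add: F_def\<close>)
  have "solve_cells N (map (cell N B) us) F r \<noteq> []"
  proof (rule solve_cells_complete[where \<pi> = "\<lambda>u. cell N B (fs ! \<sigma> u)"])
    fix u assume "u < length (map (cell N B) us)"
    then have u: "u < length us" by simp
    then have "\<sigma> u < length fs" using \<sigma> by (simp add: gathers_def)
    then show "cell N B (fs ! \<sigma> u) \<in> set F \<and> compat N (map (cell N B) us ! u) (cell N B (fs ! \<sigma> u))"
      using u d[OF u] B by (auto simp: setF intro: compat_cell)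
  next
    fix c assume "c \<in> set F"
    show "card {u. u < length (map (cell N B) us) \<and> cell N B (fs ! \<sigma> u) = c} = 0 \<or>
         r \<le> card {u. u < length (map (cell N B) us) \<and> cell N B (fs ! \<sigma> u) = c}"
    proof (cases "{u. u < length us \<and> cell N B (fs ! \<sigma> u) = c} = {}")
      case False
      then obtain v where v: "v < length us" "cell N B (fs ! \<sigma> v) = c" by auto
      have "{u. u < length us \<and> \<sigma> u = \<sigma> v} \<noteq> {}" using v by auto
      then have "card {u. u < length us \<and> \<sigma> u = \<sigma> v} \<noteq> 0" by simp
      moreover have "\<sigma> v < length fs" using \<sigma> v(1) by (simp add: gathers_def)
      then have "card {u. u < length us \<and> \<sigma> u = \<sigma> v} = 0 \<or> r \<le> card {u. u < length us \<and> \<sigma> u = \<sigma> v}"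
        using \<sigma> by (simp only: gathers_def)
      ultimately have "r \<le> card {u. u < length us \<and> \<sigma> u = \<sigma> v}" by (simp only: simp_thms)
      also have "\<dots> \<le> card {u. u < length us \<and> cell N B (fs ! \<sigma> u) = c}"
        by (rule card_mono) (use v in auto)
      finally show ?thesis by simp
    qed simp
  qed
  then show ?thesis by (simp add: F_def)
qed

text \<open>The user \<open>v\<close> attains \<open>d\<close>, so \<open>d + 1\<close> is among the
  candidates. It succeeds by \<open>solve_cells_nonempty\<close>, hence the first successful radius
  is at most \<open>d + 1\<close>.\<close>

lemma gather_correct:
  assumes \<sigma>: "gathers (length us) (length fs) r \<sigma>"
    and d: "\<And>u. u < length us \<Longrightarrow> idist (us ! u) (fs ! \<sigma> u) \<le> d"
    and v: "v < length us" "idist (us ! v) (fs ! \<sigma> v) = d"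
  shows "gathers (length us) (length fs) r ((!) (gather N us fs r))"
    and "u < length us \<Longrightarrow> idist (us ! u) (fs ! (gather N us fs r ! u)) * N \<le> (N + 2) * (d + 1)"
proof -
  let ?g = "\<lambda>c. map (\<lambda>R. (fst (fst c), R))
     (solve_cells N (map (cell N (fst (fst c))) us) (dedupe (\<lambda>x. x) (map (cell N (fst (fst c))) fs)) r)"
  have c: "((d + 1, 0), 0) \<in> set (candidates us fs)"
    using v \<sigma> by (force simp: candidates_def gathers_def)
  have "?g ((d + 1, 0), 0) \<noteq> []"
    using solve_cells_nonempty[OF _ \<sigma>, of "d + 1"] d by (simp add: le_SucI)
  have "sorted (map fst (candidates us fs))" by (simp add: candidates_def sorted_isort)
  from headd_concat_sorted[where g = ?g and d = "(0, [])", OF this c \<open>?g ((d + 1, 0), 0) \<noteq> []\<close>]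
  obtain y where y: "y \<in> set (candidates us fs)" "fst y \<le> (d + 1, 0)"
    "headd (0, []) (attempts N us fs r) \<in> set (?g y)"
    unfolding attempts_def by auto
  obtain R where R: "headd (0, []) (attempts N us fs r) = (fst (fst y), R)"
    "R \<in> set (solve_cells N (map (cell N (fst (fst y))) us) (dedupe (\<lambda>x. x) (map (cell N (fst (fst y))) fs)) r)"
    using y(3) by auto
  have B: "0 < fst (fst y)" using y(1) by (auto simp: candidates_def)
  have le: "fst (fst y) \<le> d + 1" using y(2) by (cases "fst y") auto
  show "gathers (length us) (length fs) r ((!) (gather N us fs r))"
    unfolding gather_def R(1) by (rule decode_correct(1)[OF B R(2)])
  assume "u < length us"
  from decode_correct(2)[OF B R(2) this]
  have "idist (us ! u) (fs ! (gather N us fs r ! u)) * N \<le> (N + 2) * fst (fst y)"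
    by (simp add: gather_def R(1))
  also have "\<dots> \<le> (N + 2) * (d + 1)" using le by (rule mult_left_mono) simp
  finally show "idist (us ! u) (fs ! (gather N us fs r ! u)) * N \<le> (N + 2) * (d + 1)" .
qed

lemma length_gather [simp]: "length (gather N us fs r) = length us"
  by (simp add: gather_def decode_def)

lemma dvd_idist: "N dvd snd p \<Longrightarrow> N dvd snd q \<Longrightarrow> N dvd idist p q"
  by (auto simp: idist_def intro!: dvd_diff_nat dvd_add)

text \<open>Since all distances are multiples of \<open>N\<close>, the slack of 1 in the candidate radius is absorbed.\<close>

lemma gather_approx:
  assumes N: "2 < N" and dvd: "\<forall>p\<in>set us \<union> set fs. N dvd snd p"
    and \<sigma>: "gathers (length us) (length fs) r \<sigma>"
    and d: "\<And>u. u < length us \<Longrightarrow> idist (us ! u) (fs ! \<sigma> u) \<le> d" and u: "u < length us"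
  shows "gathers (length us) (length fs) r ((!) (gather N us fs r))"
    and "N * N * idist (us ! u) (fs ! (gather N us fs r ! u)) \<le> (N + 2) * (N + 1) * d"
proof -
  let ?D = "(\<lambda>v. idist (us ! v) (fs ! \<sigma> v)) ` {..<length us}"
  \<comment> \<open>\<open>d\<close> is an arbitrary upper bound; only an attained maximum gives a
    candidate radius.\<close>
  define m where "m = Max ?D"
  have ne: "?D \<noteq> {}" "finite ?D" using u by auto
  have m: "idist (us ! v) (fs ! \<sigma> v) \<le> m" if "v < length us" for v
    unfolding m_def using that by (intro Max_ge) auto
  from Max_in[OF ne(2,1)] obtain v where v: "v < length us" "idist (us ! v) (fs ! \<sigma> v) = m"
    by (auto simp: m_def)
  have *: "gathers (length us) (length fs) r ((!) (gather N us fs r))"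
    "idist (us ! u) (fs ! (gather N us fs r ! u)) * N \<le> (N + 2) * (m + 1)" if "u < length us" for u
    by (rule gather_correct[OF \<sigma>], erule m, rule v, rule v, (rule that)?)+
  show g: "gathers (length us) (length fs) r ((!) (gather N us fs r))" by (rule *(1)[OF u])
  define x where "x = idist (us ! u) (fs ! (gather N us fs r ! u))"
  have x: "x * N \<le> (N + 2) * (m + 1)" unfolding x_def by (rule *(2)[OF u])
  have "N dvd m" using v \<sigma> dvd by (metis UnCI dvd_idist gathers_def nth_mem)
  have "N dvd x" unfolding x_def using g u dvd by (intro dvd_idist) (auto simp: gathers_def)
  have "N * N * x \<le> (N + 2) * (N + 1) * m"
  proof (cases "m = 0")
    case True
    \<comment> \<open>Radius 0 has to be met exactly: \<open>2 < N\<close> forces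
      \<open>x < 2\<close>, and a multiple of \<open>N\<close> this small is 0.\<close>
    have "x * N \<le> N + 2" using x True by simp
    then have "x * N < 2 * N" using N by linarith
    then have "x < N" using N by simp
    then have "x = 0" using \<open>N dvd x\<close> by (auto dest: dvd_imp_le)
    then show ?thesis by simp
  next
    case False
    then have "N \<le> m" using \<open>N dvd m\<close> by (auto dest: dvd_imp_le)
    then have "N * (m + 1) \<le> (N + 1) * m" by simp
    then have "(N + 2) * (N * (m + 1)) \<le> (N + 2) * ((N + 1) * m)" by (rule mult_left_mono) simp
    moreover have "N * (x * N) \<le> N * ((N + 2) * (m + 1))" using x by (rule mult_left_mono) simp
    ultimately show ?thesis by (simp only: ac_simps)
  qed
  also have "\<dots> \<le> (N + 2) * (N + 1) * d" using d[OF v(1)] v(2) by (intro mult_left_mono) auto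
  finally show "N * N * idist (us ! u) (fs ! (gather N us fs r ! u)) \<le> (N + 2) * (N + 1) * d" by (simp add: x_def)
qed

section \<open>Running time of the search over radii\<close>

lemma polytime_idist [polytime_intros]:
  assumes "polytime p" "polytime q" shows "polytime (\<lambda>z. idist (p z) (q z))"
  unfolding idist_def by (intro polytime_intros assms)

lemma polytime_cell [polytime_intros]:
  assumes "polytime B" "polytime p" shows "polytime (\<lambda>z. cell N (B z) (p z))"
  unfolding cell_def by (intro polytime_intros assms)

lemma polytime_gather [polytime_intros]:
  assumes "polytime us" "polytime fs" "polytime r"
  shows "polytime (\<lambda>z. gather N (us z) (fs z) (r z))"
proof -
  have c: "polytime (\<lambda>z. candidates (us z) (fs z))"
    unfolding candidates_def by (intro polytime_intros assms[THEN polytime_comp])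
  have "polytime (\<lambda>z. attempts N (us z) (fs z) (r z))"
    unfolding attempts_def
    by (intro polytime_intros c assms[THEN polytime_comp])
      (use distinct_dedupe[of "\<lambda>x. x"] in simp)
  note a = this[THEN polytime_comp]
  show ?thesis
    unfolding gather_def decode_def by (intro polytime_intros a assms[THEN polytime_comp])
qed

section \<open>From rational to integral positions\<close>

definition raw :: "point \<Rightarrow> nat \<times> nat \<times> nat" where
  "raw p = (fst p, nat (fst (quotient_of (snd p))), nat (snd (quotient_of (snd p))))"

lemma encode_point: "encode_point = (\<lambda>p. enc (raw p))"
  by (simp add: fun_eq_iff encode_point_def encode_rat_def raw_def split_beta)

text \<open>The product takes the place of the least common multiple: no gcd has to be computed, and
  the binary length of the product is at most the total length of the factors.\<close>

definition denom :: "(nat \<times> nat \<times> nat) list \<Rightarrow> nat" where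
  "denom ps = foldl (*) 1 (map (\<lambda>p. snd (snd p)) ps)"

text \<open>The factor \<open>D\<close> makes positions integral. The factor \<open>K\<close>, which
  is \<open>N\<close> or \<open>2 * N\<close> below, provides the divisibility that absorbs the
  slack in the radius and makes midpoints exact.\<close>

definition scaled :: "nat \<Rightarrow> nat \<Rightarrow> nat \<times> nat \<times> nat \<Rightarrow> nat \<times> nat" where
  "scaled K D p = (fst p, fst (snd p) * (D div snd (snd p)) * K)"

lemma foldl_mult: "foldl (*) a xs = a * prod_list xs" for a :: nat
  by (induction xs arbitrary: a) (simp_all add: ac_simps)

lemma denom_dvd: "p \<in> set ps \<Longrightarrow> snd (snd p) dvd denom ps"
  by (induction ps) (auto simp: denom_def foldl_mult)

lemma denom_raw_pos: "0 < snd (snd (raw p))"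
  by (simp add: raw_def quotient_of_denom_pos')

lemma denom_pos: "0 < denom (map raw ps)"
  by (induction ps) (auto simp: denom_def foldl_mult denom_raw_pos)

lemma scaled_raw:
  assumes "0 \<le> snd p" "snd (snd (raw p)) dvd D"
  shows "fst (scaled K D (raw p)) = fst p"
    "rat_of_nat (snd (scaled K D (raw p))) = snd p * rat_of_nat (D * K)"
proof -
  obtain a b where q: "quotient_of (snd p) = (a, b)" by fastforce
  have b: "0 < b" using quotient_of_denom_pos[OF q] .
  have ab: "snd p = of_int a / of_int b" using quotient_of_div[OF q] .
  then have a: "0 \<le> a" using assms(1) b by (simp add: zero_le_divide_iff)
  obtain c where c: "D = nat b * c" using assms(2) by (auto simp: raw_def q)
  have s: "snd (scaled K D (raw p)) = nat a * c * K" using b by (simp add: scaled_def raw_def q c)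
  have "rat_of_nat (nat a) = of_int a" "rat_of_nat (nat b) = of_int b" using a b by simp_all
  then show "rat_of_nat (snd (scaled K D (raw p))) = snd p * rat_of_nat (D * K)"
    using b unfolding s ab of_nat_mult by (simp add: c)
  show "fst (scaled K D (raw p)) = fst p" by (simp add: scaled_def raw_def)
qed

lemma spider_dist_eq: "spider_dist p q = (if fst p = fst q then \<bar>snd p - snd q\<bar> else snd p + snd q)"
  by (cases p; cases q) simp

lemma idist_scaled:
  assumes "0 \<le> snd p" "snd (snd (raw p)) dvd D" "0 \<le> snd q" "snd (snd (raw q)) dvd D"
  shows "rat_of_nat (idist (scaled K D (raw p)) (scaled K D (raw q))) = spider_dist p q * rat_of_nat (D * K)"
proof -
  let ?x = "snd (scaled K D (raw p))" and ?y = "snd (scaled K D (raw q))"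
  note x = scaled_raw(2)[OF assms(1,2), of K] and y = scaled_raw(2)[OF assms(3,4), of K]
  have "rat_of_nat ((?x - ?y) + (?y - ?x)) = \<bar>rat_of_nat ?x - rat_of_nat ?y\<bar>"
    by (cases "?x \<le> ?y") (simp_all add: of_nat_diff)
  also have "\<dots> = \<bar>(snd p - snd q) * rat_of_nat (D * K)\<bar>" unfolding x y by (simp only: left_diff_distrib)
  also have "\<dots> = \<bar>snd p - snd q\<bar> * rat_of_nat (D * K)" by (simp only: abs_mult abs_of_nat)
  finally show ?thesis
    using scaled_raw(1)[OF assms(1,2), of K] scaled_raw(1)[OF assms(3,4), of K]
    by (simp only: idist_def spider_dist_eq of_nat_add x y distrib_right if_distrib[of rat_of_nat]
        if_distrib[of "\<lambda>a. a * rat_of_nat (D * K)"])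
qed

lemma dvd_scaled: "M dvd K \<Longrightarrow> M dvd snd (scaled K D p)"
  by (simp add: scaled_def)

lemma polytime_scaled [polytime_intros]:
  assumes "polytime D" "polytime p" shows "polytime (\<lambda>z. scaled K (D z) (p z))"
  unfolding scaled_def by (intro polytime_intros assms)

lemma floorlog_foldl_mult: "floorlog 2 (foldl (*) a xs) \<le> floorlog 2 a + sz xs"
proof (induction xs arbitrary: a)
  case (Cons x xs)
  have "floorlog 2 (foldl (*) (a * x) xs) \<le> floorlog 2 (a * x) + sz xs" by (rule Cons.IH)
  also have "\<dots> \<le> floorlog 2 a + floorlog 2 x + sz xs" using floorlog_mult[of a x] by simp
  finally show ?case by simp
qed simp

lemma polytime_denom [polytime_intros]:
  assumes "polytime ps" shows "polytime (\<lambda>z. denom (ps z))"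
proof -
  have p: "polytime (\<lambda>z. map (\<lambda>p. snd (snd p)) (ps z))" by (intro polytime_intros assms)
  have "polytime (\<lambda>z. foldl (\<lambda>a x. a * x) 1 (map (\<lambda>p. snd (snd p)) (ps z)))"
  proof (rule polytime_foldl[where b = "\<lambda>z. 2 + sz (map (\<lambda>p. snd (snd p)) (ps z))"])
    fix z ys zs assume z: "map (\<lambda>p. snd (snd p)) (ps z) = ys @ zs"
    have "sz (foldl (\<lambda>a x. a * x) 1 ys) \<le> 2 + sz ys" using floorlog_foldl_mult[of 1 ys] by simp
    also have "\<dots> \<le> 2 + sz (map (\<lambda>p. snd (snd p)) (ps z))"
      using sz_append[of ys zs] sz_ge_2[of zs] unfolding z by linarith
    finally show "sz (foldl (\<lambda>a x. a * x) 1 ys) \<le> 2 + sz (map (\<lambda>p. snd (snd p)) (ps z))" .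
  qed (intro polytime_intros polybd_intros polytime_sz[OF p] p)+
  then show ?thesis by (simp add: denom_def)
qed

section \<open>Approximation schemes\<close>

text \<open>Execution starts with function 0, so the main expression becomes its body and all other
  functions move up by one.\<close>

lemma polytime_program:
  assumes "polytime f"
  shows "\<exists>P q. \<forall>x. \<exists>t. runs P (enc x) (enc (f x)) t \<and> t \<le> poly q (sz x)"
proof -
  from assms obtain P e c where 1: "computes P e c f" unfolding polytime_def by blast
  define P' where "P' = shift 1 e # map (shift 1) P"
  have e: "computes P' (shift 1 e) c f"
    using computes_shift[OF 1, of "[shift 1 e]" "[]"] by (simp add: P'_def)
  have "polybd (\<lambda>x. sz x + c x + sz (f x))"
    using 1 unfolding computes_def by (intro polybd_intros polytime_sz[OF assms]) auto
  then obtain k where k: "\<And>x. sz x + c x + sz (f x) \<le> (sz x + 1) ^ k" unfolding polybd_def by blast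
  have "\<exists>t. runs P' (enc x) (enc (f x)) t \<and> t \<le> poly ([:1, 1:] ^ k) (sz x)" for x
  proof -
    obtain t where t: "t \<le> c x" "eval P' [enc x] (shift 1 e) (enc (f x)) t"
      using e unfolding computes_def by blast
    have "runs P' (enc x) (enc (f x)) (sz x + t + sz (f x))"
      unfolding runs_def
      using eval_Call[of 0 P' "[enc x]" "[Var 0]" "[sz x]" "[enc x]" "enc (f x)" t] t(2) eval_Var0
      by (simp add: P'_def)
    moreover have "sz x + t + sz (f x) \<le> poly ([:1, 1:] ^ k) (sz x)"
      using k[of x] t(1) by (simp add: poly_power add.commute)
    ultimately show ?thesis by blast
  qed
  then show ?thesis by blast
qed

text \<open>The ratio is stated with integers, so that everything specific to a problem stays within
  the rationals; the real number \<epsilon> enters only here.\<close>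

lemma has_PTASI:
  fixes g :: "'i \<Rightarrow> 'a::enc" and f :: "nat \<Rightarrow> 'a \<Rightarrow> 'b::enc"
  assumes enc: "\<And>i. i \<in> instances M \<Longrightarrow> encode M i = enc (g i)"
    and f: "\<And>N. polytime (f N)"
    and approx: "\<And>N i. 2 < N \<Longrightarrow> i \<in> instances M \<Longrightarrow> feasible M i \<noteq> {} \<Longrightarrow>
      \<exists>s\<in>feasible M i. denotes M i (enc (f N (g i))) s \<and>
        of_nat (N * N) * cost M i s \<le> of_nat ((N + 2) * (N + 1)) * OPT M i"
    and nonneg: "\<And>i. i \<in> instances M \<Longrightarrow> feasible M i \<noteq> {} \<Longrightarrow> 0 \<le> OPT M i"
  shows "has_PTAS M"
  unfolding has_PTAS_def
proof (intro allI impI)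
  fix \<epsilon> :: real assume \<epsilon>: "0 < \<epsilon>"
  \<comment> \<open>With \<open>5 / \<epsilon> \<le> N\<close>, the excess of
    \<open>(N + 2) * (N + 1)\<close> over \<open>N * N\<close> is
    \<open>3 * N + 2 \<le> 5 * N \<le> \<epsilon> * N * N\<close>. The summand 3 secures
    \<open>2 < N\<close>.\<close>
  define N where "N = nat \<lceil>5 / \<epsilon>\<rceil> + 3"
  have "5 / \<epsilon> \<le> real N" unfolding N_def by linarith
  then have N: "2 < N" "5 \<le> \<epsilon> * real N" using \<epsilon> by (simp_all add: N_def field_simps)
  obtain P q where P: "\<And>x. \<exists>t. runs P (enc x) (enc (f N x)) t \<and> t \<le> poly q (sz x)"
    using polytime_program[OF f] by metis
  have "real_of_rat c \<le> (1 + \<epsilon>) * real_of_rat opt"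
    if "of_nat (N * N) * c \<le> of_nat ((N + 2) * (N + 1)) * opt" "0 \<le> opt" for c opt :: rat
  proof -
    have "real_of_rat (of_nat (N * N) * c) \<le> real_of_rat (of_nat ((N + 2) * (N + 1)) * opt)"
      using that(1) by (simp only: of_rat_less_eq)
    then have "real (N * N) * real_of_rat c \<le> real ((N + 2) * (N + 1)) * real_of_rat opt"
      by (simp only: of_rat_mult of_rat_of_nat_eq)
    also have "\<dots> \<le> real (N * N) * (1 + \<epsilon>) * real_of_rat opt"
    proof (rule mult_right_mono)
      have "real ((N + 2) * (N + 1)) = real N * real N + 3 * real N + 2" by (simp add: algebra_simps)
      also have "\<dots> \<le> real N * real N + real N * 5" using N(1) by simp
      also have "\<dots> \<le> real N * real N + real N * (\<epsilon> * real N)"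
        by (intro add_left_mono mult_left_mono N(2)) simp
      finally show "real ((N + 2) * (N + 1)) \<le> real (N * N) * (1 + \<epsilon>)" by (simp add: algebra_simps)
      show "0 \<le> real_of_rat opt" using that(2) by simp
    qed
    finally show ?thesis using N(1) by (simp add: mult.assoc)
  qed
  note ratio = this
  have "poly_time_approx M (1 + \<epsilon>) P"
    unfolding poly_time_approx_def
  proof (rule exI[of _ q], rule ballI)
    fix i assume i: "i \<in> instances M"
    from P[of "g i"] obtain t where t: "runs P (enc (g i)) (enc (f N (g i))) t" "t \<le> poly q (sz (g i))" by blast
    have "feasible M i \<noteq> {} \<longrightarrow> (\<exists>s\<in>feasible M i. denotes M i (enc (f N (g i))) s \<and>
      real_of_rat (cost M i s) \<le> (1 + \<epsilon>) * real_of_rat (OPT M i))"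
      using approx[OF N(1) i] ratio nonneg[OF i] by blast
    with t show "\<exists>v t. runs P (encode M i) v t \<and> t \<le> poly q (data_len (encode M i)) \<and>
      (feasible M i \<noteq> {} \<longrightarrow> (\<exists>s\<in>feasible M i. denotes M i v s \<and>
        real_of_rat (cost M i s) \<le> (1 + \<epsilon>) * real_of_rat (OPT M i)))"
      unfolding enc[OF i] by blast
  qed
  then show "\<exists>P. poly_time_approx M (1 + \<epsilon>) P" by blast
qed

lemma OPT_attained:
  assumes "finite (feasible M i)" "feasible M i \<noteq> {}"
  obtains s where "s \<in> feasible M i" "cost M i s = OPT M i"
proof -
  have "OPT M i \<in> cost M i ` feasible M i" unfolding OPT_def using assms by (intro Min_in) auto
  then show ?thesis using that by auto
qed

subsection \<open>Gathering\<close>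

definition gathering_alg :: "nat \<Rightarrow> nat \<times> nat \<times> (nat \<times> nat \<times> nat) list \<times> (nat \<times> nat \<times> nat) list \<times> nat \<Rightarrow> nat list" where
  "gathering_alg N z = gather N
     (map (scaled N (denom (fst (snd (snd z)) @ fst (snd (snd (snd z)))))) (fst (snd (snd z))))
     (map (scaled N (denom (fst (snd (snd z)) @ fst (snd (snd (snd z)))))) (fst (snd (snd (snd z)))))
     (fst (snd z))"

lemma polytime_gathering_alg: "polytime (gathering_alg N)"
  unfolding gathering_alg_def by (intro polytime_intros)

text \<open>The final 0 is the end marker of \<open>encode_list\<close>: a list of entries of
  different types is encoded like a nested tuple that ends in 0.\<close>

definition gathering_input :: "gathering_instance \<Rightarrow> nat \<times> nat \<times> (nat \<times> nat \<times> nat) list \<times> (nat \<times> nat \<times> nat) list \<times> nat" where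
  "gathering_input I = (num_legs I, min_size I, map raw (users I), map raw (facilities I), 0)"

lemma gatherings_iff:
  "\<pi> \<in> gatherings I \<longleftrightarrow> \<pi> \<in> extensional {..<length (users I)} \<and>
    gathers (length (users I)) (length (facilities I)) (min_size I) \<pi>"
  by (auto simp: gatherings_def gathers_def PiE_iff)

lemma gathering_approx:
  assumes N: "2 < N" and I: "I \<in> instances gathering_problem" and \<sigma>: "\<sigma> \<in> gatherings I"
  shows "\<exists>\<pi>\<in>gatherings I. denotes gathering_problem I (enc (gathering_alg N (gathering_input I))) \<pi> \<and>
     of_nat (N * N) * gathering_cost I \<pi> \<le> of_nat ((N + 2) * (N + 1)) * gathering_cost I \<sigma>"
proof -
  define n where "n = length (users I)"
  define m where "m = length (facilities I)"
  define D where "D = denom (map raw (users I @ facilities I))"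
  define us where "us = map (scaled N D) (map raw (users I))"
  define fs where "fs = map (scaled N D) (map raw (facilities I))"
  define \<rho> where "\<rho> = gather N us fs (min_size I)"
  define \<pi> where "\<pi> = restrict ((!) \<rho>) {..<n}"
  define S where "S = rat_of_nat (D * N)"
  have len: "length us = n" "length fs = m" "length \<rho> = n" by (simp_all add: us_def fs_def \<rho>_def n_def m_def)
  have "0 < D" unfolding D_def by (rule denom_pos)
  then have S: "0 < S" using N by (simp add: S_def)
  have pos: "0 \<le> snd p" if "p \<in> set (users I) \<union> set (facilities I)" for p
    using I that by (auto simp: gathering_problem_def spider_def)
  have dvdD: "snd (snd (raw p)) dvd D" if "p \<in> set (users I) \<union> set (facilities I)" for p
    unfolding D_def by (rule denom_dvd) (use that in auto)
  have dist: "rat_of_nat (idist (us ! u) (fs ! f)) = spider_dist (users I ! u) (facilities I ! f) * S"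
    if "u < n" "f < m" for u f
    using that unfolding us_def fs_def S_def n_def m_def by (simp add: idist_scaled pos dvdD)
  have out: "gathering_alg N (gathering_input I) = \<rho>"
    by (simp add: gathering_alg_def gathering_input_def \<rho>_def us_def fs_def D_def)
  have dvd: "\<forall>p\<in>set us \<union> set fs. N dvd snd p" by (auto simp: us_def fs_def dvd_scaled)
  have g\<sigma>: "gathers (length us) (length fs) (min_size I) \<sigma>" and ext: "\<sigma> u < m" if "u < n" for u
    using \<sigma> that by (auto simp: gatherings_iff len n_def[symmetric] m_def[symmetric]) (simp add: gathers_def)
  \<comment> \<open>Scaled distances are integers, so rounding down the scaled cost keeps it an
    upper bound for all of them.\<close>
  define d where "d = nat \<lfloor>gathering_cost I \<sigma> * S\<rfloor>"
  have cost_ge: "spider_dist (users I ! u) (facilities I ! \<sigma> u) \<le> gathering_cost I \<sigma>" if "u < n" for u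
    unfolding gathering_cost_def using that by (intro Max_ge) (auto simp: n_def)
  have cost0: "0 \<le> gathering_cost I \<sigma>" unfolding gathering_cost_def by (intro Max_ge) auto
  have d: "idist (us ! u) (fs ! \<sigma> u) \<le> d" if "u < n" for u
  proof -
    have "rat_of_nat (idist (us ! u) (fs ! \<sigma> u)) \<le> gathering_cost I \<sigma> * S"
      unfolding dist[OF that ext[OF that]] using cost_ge[OF that] S by (simp add: mult_right_mono)
    then show ?thesis unfolding d_def by (simp add: le_nat_iff le_floor_iff)
  qed
  have dS: "rat_of_nat d \<le> gathering_cost I \<sigma> * S"
    unfolding d_def using cost0 S by simp
  have g\<pi>: "gathers n m (min_size I) ((!) \<rho>)"
  proof (cases "n = 0")
    case True
    then show ?thesis by (simp add: gathers_def)
  next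
    case False
    then show ?thesis using gather_approx(1)[OF N dvd g\<sigma>, of 0 d 0] d by (simp add: len \<rho>_def)
  qed
  have "\<pi> \<in> gatherings I"
  proof -
    have "{u. u < n \<and> \<pi> u = f} = {u. u < n \<and> \<rho> ! u = f}" for f by (auto simp: \<pi>_def)
    then have "gathers n m (min_size I) \<pi>" using g\<pi> by (simp add: gathers_def \<pi>_def)
    then show ?thesis by (simp add: gatherings_iff n_def m_def \<pi>_def)
  qed
  moreover have "denotes gathering_problem I (enc (gathering_alg N (gathering_input I))) \<pi>"
  proof -
    have "\<rho> = map \<pi> [0..<n]" by (rule nth_equalityI) (simp_all add: len \<pi>_def)
    then have "map enc \<rho> = map (Atom \<circ> \<pi>) [0..<n]" by simp
    then show ?thesis by (simp add: gathering_problem_def out enc_list_def n_def)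
  qed
  moreover have "of_nat (N * N) * gathering_cost I \<pi> \<le> of_nat ((N + 2) * (N + 1)) * gathering_cost I \<sigma>"
  proof -
    have "gathering_cost I \<pi> \<in> insert 0 ((\<lambda>u. spider_dist (users I ! u) (facilities I ! \<pi> u)) ` {..<n})"
      unfolding gathering_cost_def n_def[symmetric] by (rule Max_in) auto
    then consider "gathering_cost I \<pi> = 0"
      | u where "u < n" "gathering_cost I \<pi> = spider_dist (users I ! u) (facilities I ! (\<rho> ! u))"
      by (auto simp: \<pi>_def)
    then show ?thesis
    proof cases
      case 1
      then show ?thesis using cost0 by simp
    next
      case 2
      have "N * N * idist (us ! u) (fs ! (\<rho> ! u)) \<le> (N + 2) * (N + 1) * d"
        using gather_approx(2)[OF N dvd g\<sigma>, of u d u] d 2(1) by (simp add: len \<rho>_def)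
      then have "rat_of_nat (N * N * idist (us ! u) (fs ! (\<rho> ! u))) \<le> rat_of_nat ((N + 2) * (N + 1) * d)"
        by (simp only: of_nat_le_iff)
      then have "of_nat (N * N) * (gathering_cost I \<pi> * S) \<le> of_nat ((N + 2) * (N + 1)) * rat_of_nat d"
        using g\<pi> 2 dist[of u "\<rho> ! u"] by (simp only: of_nat_mult gathers_def)
      also have "\<dots> \<le> of_nat ((N + 2) * (N + 1)) * (gathering_cost I \<sigma> * S)"
        by (rule mult_left_mono[OF dS]) simp
      finally show ?thesis using S by (simp only: mult.assoc[symmetric] mult_le_cancel_right)
    qed
  qed
  ultimately show ?thesis by blast
qed

lemma has_PTAS_gathering: "has_PTAS gathering_problem"
proof (rule has_PTASI[where g = gathering_input and f = gathering_alg])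
  show "encode gathering_problem I = enc (gathering_input I)" for I
    by (simp add: gathering_problem_def encode_gathering_instance_def gathering_input_def encode_list_def
        enc_list_def encode_point o_def)
  show "polytime (gathering_alg N)" for N by (rule polytime_gathering_alg)
  fix I assume I: "I \<in> instances gathering_problem" and ne: "feasible gathering_problem I \<noteq> {}"
  from OPT_attained[OF _ ne] obtain \<sigma> where \<sigma>: "\<sigma> \<in> gatherings I" "gathering_cost I \<sigma> = OPT gathering_problem I"
    by (auto simp: gathering_problem_def finite_gatherings)
  then show "0 \<le> OPT gathering_problem I"
    unfolding \<sigma>(2)[symmetric] gathering_cost_def by (intro Max_ge) auto
  show "\<exists>s\<in>feasible gathering_problem I. denotes gathering_problem I (enc (gathering_alg N (gathering_input I))) s \<and>
        of_nat (N * N) * cost gathering_problem I s \<le> of_nat ((N + 2) * (N + 1)) * OPT gathering_problem I"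
    if "2 < N" for N
    using gathering_approx[OF that I \<sigma>(1)] unfolding \<sigma>(2)[symmetric] by (simp add: gathering_problem_def)
qed

subsection \<open>Clustering\<close>

text \<open>Midpoint of the path from \<open>p\<close> to \<open>q\<close>. If the path crosses the
  center, the midpoint lies on the leg of the farther end, at half the difference of the
  positions.\<close>

definition mid :: "nat \<times> nat \<Rightarrow> nat \<times> nat \<Rightarrow> nat \<times> nat" where
  "mid p q = (if fst p = fst q then (fst p, (snd p + snd q) div 2)
    else if snd q \<le> snd p then (fst p, (snd p - snd q) div 2) else (fst q, (snd q - snd p) div 2))"

lemma idist_commute: "idist p q = idist q p"
  by (simp add: idist_def)

lemma idist_triangle: "idist p q \<le> idist p s + idist s q"
  by (auto simp: idist_def)

text \<open>The reason for scaling by \<open>2 * N\<close>: halving leaves multiples of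
  \<open>N\<close>.\<close>

lemma dvd_mid:
  assumes "2 * N dvd snd p" "2 * N dvd snd q" shows "N dvd snd (mid p q)"
proof -
  from assms obtain a b where "snd p = 2 * N * a" "snd q = 2 * N * b" by (auto simp: dvd_def)
  moreover have "(2 * N * a + 2 * N * b) div 2 = N * (a + b)" for a b :: nat by (simp add: algebra_simps)
  moreover have "(2 * N * a - 2 * N * b) div 2 = N * (a - b)" for a b :: nat
    using nonzero_mult_div_cancel_left[of 2 "N * (a - b)"] by (simp only: diff_mult_distrib2 mult.assoc)
  ultimately show ?thesis by (simp only: mid_def) (auto simp del: mult.assoc)
qed

text \<open>In a tree, the path from \<open>v\<close> to the midpoint continues to one of the two
  ends, and this continuation has length \<open>idist u w / 2\<close>. So the bound on the distance
  to that end leaves at most half for the midpoint. Even positions make the halves exact.\<close>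

lemma idist_mid:
  assumes "even (snd u)" "even (snd w)" "idist v u \<le> idist u w" "idist v w \<le> idist u w"
  shows "2 * idist v (mid u w) \<le> idist u w"
proof -
  from assms(1,2) obtain x y where xy: "snd u = 2 * x" "snd w = 2 * y" by (auto elim!: evenE)
  have "(2 * x + 2 * y) div 2 = x + y" "(2 * x - 2 * y) div 2 = x - y" "(2 * y - 2 * x) div 2 = y - x" by linarith+
  then have mid: "mid u w = (if fst u = fst w then (fst u, x + y)
    else if y \<le> x then (fst u, x - y) else (fst w, y - x))"
    by (simp add: mid_def xy)
  show ?thesis using assms(3,4) unfolding mid by (auto simp: idist_def xy split: if_splits)
qed

text \<open>A cluster consists of the users sent to one midpoint. Midpoints without users are
  filtered out, since a partition has no empty member.\<close>

definition clustering_alg :: "nat \<Rightarrow> nat \<times> nat \<times> (nat \<times> nat \<times> nat) list \<times> nat \<Rightarrow> nat list list" where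
  "clustering_alg N z =
    (let us = map (scaled (2 * N) (denom (fst (snd (snd z))))) (fst (snd (snd z)));
         fs = concat (map (\<lambda>u. map (mid u) us) us);
         \<rho> = gather N us fs (fst (snd z))
     in filter (\<lambda>A. A \<noteq> []) (map (\<lambda>k. map fst (filter (\<lambda>q. snd q = k) (zip [0..<length \<rho>] \<rho>))) [0..<length fs]))"

lemma polytime_mid [polytime_intros]:
  assumes "polytime p" "polytime q" shows "polytime (\<lambda>z. mid (p z) (q z))"
  unfolding mid_def by (intro polytime_intros assms)

lemma polytime_clustering_alg: "polytime (clustering_alg N)"
  unfolding clustering_alg_def Let_def by (intro polytime_intros)

definition clustering_input :: "clustering_instance \<Rightarrow> nat \<times> nat \<times> (nat \<times> nat \<times> nat) list \<times> nat" where
  "clustering_input I = (num_legs I, min_size I, map raw (users I), 0)"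

lemma clustering_cost_nonneg: "C \<in> clusterings I \<Longrightarrow> 0 \<le> clustering_cost I C"
  unfolding clustering_cost_def
  by (intro Max_ge) (auto simp: clusterings_def intro: finite_elements)

lemma clustering_cost_ge:
  assumes "C \<in> clusterings I" "A \<in> C" "u \<in> A" "w \<in> A"
  shows "spider_dist (users I ! u) (users I ! w) \<le> clustering_cost I C"
proof -
  have C: "partition_on {..<length (users I)} C" using assms(1) by (simp add: clusterings_def)
  then have "A \<subseteq> {..<length (users I)}" using assms(2) by (auto simp: partition_on_def)
  then have "finite A" by (rule finite_subset) simp
  then have "spider_dist (users I ! u) (users I ! w) \<le> cluster_diameter I A"
    unfolding cluster_diameter_def using assms(3,4) by (intro Max_ge) (auto intro!: image_eqI[of _ _ "(u, w)"])
  also have "\<dots> \<le> clustering_cost I C"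
    unfolding clustering_cost_def using assms(2) finite_elements[OF _ C] by (intro Max_ge) auto
  finally show ?thesis .
qed

lemma clustering_cost_attained:
  assumes C: "C \<in> clusterings I" and "clustering_cost I C \<noteq> 0"
  obtains A u w where "A \<in> C" "u \<in> A" "w \<in> A" "clustering_cost I C = spider_dist (users I ! u) (users I ! w)"
proof -
  have P: "partition_on {..<length (users I)} C" using C by (simp add: clusterings_def)
  have "clustering_cost I C \<in> insert 0 (cluster_diameter I ` C)"
    unfolding clustering_cost_def using finite_elements[OF _ P] by (intro Max_in) auto
  with assms(2) obtain A where A: "A \<in> C" "clustering_cost I C = cluster_diameter I A" by auto
  have "finite A" "A \<noteq> {}" using A(1) P by (auto simp: partition_on_def intro: finite_subset[of A "{..<length (users I)}"])
  then have "cluster_diameter I A \<in> (\<lambda>(u, w). spider_dist (users I ! u) (users I ! w)) ` (A \<times> A)"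
    unfolding cluster_diameter_def by (intro Max_in) auto
  with A that show ?thesis by auto
qed

lemma clusters_of_gathers:
  assumes \<rho>: "length \<rho> = length (users I)" "gathers (length (users I)) m (min_size I) ((!) \<rho>)"
    and uss: "uss = filter (\<lambda>A. A \<noteq> []) (map (\<lambda>k. map fst (filter (\<lambda>q. snd q = k) (zip [0..<length \<rho>] \<rho>))) [0..<m])"
  shows "set ` set uss \<in> clusterings I"
    and "A \<in> set ` set uss \<Longrightarrow> \<exists>k<m. A = {u. u < length (users I) \<and> \<rho> ! u = k}"
proof -
  let ?A = "\<lambda>k. {u. u < length (users I) \<and> \<rho> ! u = k}"
  define L where "L k = map fst (filter (\<lambda>q. snd q = k) (zip [0..<length \<rho>] \<rho>))" for k
  have s: "set (L k) = ?A k" for k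
    using \<rho>(1) by (force simp: L_def set_zip)
  have "set ` set uss = (\<lambda>k. set (L k)) ` {..<m} - {{}}"
    unfolding uss L_def[symmetric] by auto
  then have eq: "set ` set uss = ?A ` {..<m} - {{}}" unfolding s .
  show "\<exists>k<m. A = ?A k" if "A \<in> set ` set uss" using that unfolding eq by auto
  have "partition_on {..<length (users I)} (?A ` {..<m} - {{}})"
  proof (rule partition_onI)
    show "\<Union> (?A ` {..<m} - {{}}) = {..<length (users I)}" using \<rho>(2) by (auto simp: gathers_def)
  qed (auto simp: disjnt_def)
  moreover have "min_size I \<le> card A" if "A \<in> ?A ` {..<m} - {{}}" for A
  proof -
    from that obtain k where k: "k < m" "A = ?A k" "A \<noteq> {}" by auto
    then have "finite A" by simp
    with k(3) have "card (?A k) \<noteq> 0" unfolding k(2)[symmetric] by simp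
    moreover have "card (?A k) = 0 \<or> min_size I \<le> card (?A k)" using \<rho>(2) k(1) by (simp add: gathers_def)
    ultimately show ?thesis unfolding k(2) by (simp only: simp_thms)
  qed
  ultimately show "set ` set uss \<in> clusterings I" unfolding eq by (simp add: clusterings_def)
qed

text \<open>Each cluster is sent as a whole to its \<open>k\<close>. Clusters may share a target,
  but a union of clusters is still large enough.\<close>

lemma gathers_of_clusters:
  assumes C: "C \<in> clusterings I"
    and k: "\<And>A. A \<in> C \<Longrightarrow> \<exists>k<m. \<forall>v\<in>A. Q v k"
  shows "\<exists>\<sigma>. gathers (length (users I)) m (min_size I) \<sigma> \<and> (\<forall>u<length (users I). Q u (\<sigma> u))"
proof -
  have P: "partition_on {..<length (users I)} C" and r: "\<And>A. A \<in> C \<Longrightarrow> min_size I \<le> card A"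
    using C by (simp_all add: clusterings_def)
  obtain c where c: "\<And>A. A \<in> C \<Longrightarrow> c A < m \<and> (\<forall>v\<in>A. Q v (c A))" using k by metis
  have "\<forall>u. u < length (users I) \<longrightarrow> (\<exists>A\<in>C. u \<in> A)" using partition_onD1[OF P] by auto
  then obtain a where a: "\<And>u. u < length (users I) \<Longrightarrow> a u \<in> C \<and> u \<in> a u" by metis
  have sub: "A \<subseteq> {..<length (users I)}" if "A \<in> C" for A using partition_onD1[OF P] that by auto
  have uniq: "a w = A" if "A \<in> C" "w \<in> A" for w A
  proof -
    have w: "w < length (users I)" using sub[OF that(1)] that(2) by auto
    show ?thesis
    proof (rule ccontr)
      assume "a w \<noteq> A"
      then have "a w \<inter> A = {}" using disjointD[OF partition_onD2[OF P]] a[OF w] that(1) by blast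
      then show False using a[OF w] that(2) by blast
    qed
  qed
  have "card {u. u < length (users I) \<and> c (a u) = f} = 0 \<or> min_size I \<le> card {u. u < length (users I) \<and> c (a u) = f}" for f
  proof (cases "{u. u < length (users I) \<and> c (a u) = f} = {}")
    case False
    then obtain v where v: "v < length (users I)" "c (a v) = f" by auto
    have av: "a v \<in> C" using a[OF v(1)] by simp
    have "a v \<subseteq> {u. u < length (users I) \<and> c (a u) = f}"
    proof
      fix w assume w: "w \<in> a v"
      have "w < length (users I)" using sub[OF av] w by auto
      moreover have "c (a w) = f" unfolding uniq[OF av w] by (rule v(2))
      ultimately show "w \<in> {u. u < length (users I) \<and> c (a u) = f}" by simp
    qed
    then have "card (a v) \<le> card {u. u < length (users I) \<and> c (a u) = f}" by (rule card_mono[rotated]) simp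
    then show ?thesis using r[of "a v"] a[of v] v(1) by linarith
  qed simp
  then have "gathers (length (users I)) m (min_size I) (\<lambda>u. c (a u))" using a c by (simp add: gathers_def)
  moreover have "\<forall>u<length (users I). Q u (c (a u))" using a c by blast
  ultimately show ?thesis by blast
qed

lemma clustering_approx:
  assumes N: "2 < N" and I: "I \<in> instances clustering_problem" and C: "C \<in> clusterings I"
  shows "\<exists>C'\<in>clusterings I. denotes clustering_problem I (enc (clustering_alg N (clustering_input I))) C' \<and>
     of_nat (N * N) * clustering_cost I C' \<le> of_nat ((N + 2) * (N + 1)) * clustering_cost I C"
proof -
  define n where "n = length (users I)"
  define D where "D = denom (map raw (users I))"
  define us where "us = map (scaled (2 * N) D) (map raw (users I))"
  define fs where "fs = concat (map (\<lambda>u. map (mid u) us) us)"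
  define m where "m = length fs"
  define \<rho> where "\<rho> = gather N us fs (min_size I)"
  define uss where "uss = filter (\<lambda>A. A \<noteq> []) (map (\<lambda>k. map fst (filter (\<lambda>q. snd q = k) (zip [0..<length \<rho>] \<rho>))) [0..<m])"
  define S where "S = rat_of_nat (D * (2 * N))"
  have len: "length us = n" "length \<rho> = n" by (simp_all add: us_def \<rho>_def n_def)
  have "0 < D" unfolding D_def by (rule denom_pos)
  then have S: "0 < S" using N by (simp add: S_def)
  have pos: "0 \<le> snd p" if "p \<in> set (users I)" for p
    using I that by (auto simp: clustering_problem_def spider_def)
  have dvdD: "snd (snd (raw p)) dvd D" if "p \<in> set (users I)" for p
    unfolding D_def by (rule denom_dvd) (use that in auto)
  have dist: "rat_of_nat (idist (us ! u) (us ! w)) = spider_dist (users I ! u) (users I ! w) * S"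
    if "u < n" "w < n" for u w
    using that unfolding us_def S_def n_def by (simp add: idist_scaled pos dvdD del: of_nat_mult)
  have out: "clustering_alg N (clustering_input I) = uss"
    by (simp add: clustering_alg_def clustering_input_def uss_def \<rho>_def us_def fs_def D_def m_def Let_def)
  have dvd2: "2 * N dvd snd p" if "p \<in> set us" for p using that by (auto simp: us_def intro: dvd_scaled)
  have dvd: "\<forall>p\<in>set us \<union> set fs. N dvd snd p"
  proof
    fix p assume "p \<in> set us \<union> set fs"
    then consider "p \<in> set us" | u w where "u \<in> set us" "w \<in> set us" "p = mid u w"
      by (auto simp: fs_def)
    then show "N dvd snd p"
    proof cases
      case 1
      from dvd2[OF 1] show ?thesis by (rule dvd_mult_right)
    next
      case 2
      show ?thesis unfolding 2(3) by (rule dvd_mid[OF dvd2[OF 2(1)] dvd2[OF 2(2)]])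
    qed
  qed
  \<comment> \<open>A radius is half a diameter; the factor 2 returns with the triangle inequality.
    Rounding down is safe because scaled distances are integers.\<close>
  define d where "d = nat \<lfloor>clustering_cost I C * S / 2\<rfloor>"
  have cost0: "0 \<le> clustering_cost I C" by (rule clustering_cost_nonneg[OF C])
  have dS: "rat_of_nat d * 2 \<le> clustering_cost I C * S"
  proof -
    have "rat_of_nat d \<le> clustering_cost I C * S / 2"
      unfolding d_def by (rule of_nat_floor) (use cost0 S in simp)
    then show ?thesis by simp
  qed
  have "\<exists>k<m. \<forall>v\<in>A. idist (us ! v) (fs ! k) \<le> d" if A: "A \<in> C" for A
  proof -
    have P: "partition_on {..<n} C" using C by (simp add: clusterings_def n_def)
    have sub: "A \<subseteq> {..<n}" "A \<noteq> {}" using P A by (auto simp: partition_on_def)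
    let ?D = "(\<lambda>(u, w). idist (us ! u) (us ! w)) ` (A \<times> A)"
    have fin: "finite ?D" "?D \<noteq> {}" using sub finite_subset[OF sub(1)] by auto
    \<comment> \<open>A diametral pair of the cluster: the cost bounds its distance, and the whole
      cluster lies within half of it from the midpoint.\<close>
    from Max_in[OF fin] obtain u w where uw: "u \<in> A" "w \<in> A" "Max ?D = idist (us ! u) (us ! w)" by auto
    have max: "idist (us ! v) (us ! v') \<le> idist (us ! u) (us ! w)" if "v \<in> A" "v' \<in> A" for v v'
      unfolding uw(3)[symmetric] using that by (intro Max_ge fin(1)) auto
    have unwn: "u < n" "w < n" using sub uw by auto
    then have mem: "us ! u \<in> set us" "us ! w \<in> set us" by (simp_all add: len)
    then have "mid (us ! u) (us ! w) \<in> set fs" by (auto simp: fs_def)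
    then obtain k where k: "k < m" "fs ! k = mid (us ! u) (us ! w)" by (auto simp: m_def in_set_conv_nth)
    have ev: "even (snd (us ! u))" "even (snd (us ! w))" using dvd2[OF mem(1)] dvd2[OF mem(2)] by (meson dvd_mult_left)+
    have "idist (us ! v) (fs ! k) \<le> d" if v: "v \<in> A" for v
    proof -
      have "2 * idist (us ! v) (fs ! k) \<le> idist (us ! u) (us ! w)"
        unfolding k(2) by (rule idist_mid[OF ev max[OF v uw(1)] max[OF v uw(2)]])
      then have "rat_of_nat (2 * idist (us ! v) (fs ! k)) \<le> rat_of_nat (idist (us ! u) (us ! w))"
        by (simp only: of_nat_le_iff)
      also have "\<dots> \<le> clustering_cost I C * S"
        unfolding dist[OF unwn] using clustering_cost_ge[OF C A uw(1,2)] S by (simp add: mult_right_mono)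
      finally have "rat_of_nat (idist (us ! v) (fs ! k)) \<le> clustering_cost I C * S / 2" by simp
      then show ?thesis unfolding d_def by (simp add: le_nat_iff le_floor_iff)
    qed
    with k(1) show ?thesis by blast
  qed
  from gathers_of_clusters[OF C this]
  obtain \<sigma> where \<sigma>: "gathers (length us) (length fs) (min_size I) \<sigma>"
    and d: "\<And>u. u < length us \<Longrightarrow> idist (us ! u) (fs ! \<sigma> u) \<le> d"
    by (auto simp: len n_def m_def)
  have g: "gathers n m (min_size I) ((!) \<rho>)"
  proof (cases "n = 0")
    case True
    then show ?thesis by (simp add: gathers_def)
  next
    case False
    then show ?thesis using gather_approx(1)[OF N dvd \<sigma> d, of 0] by (simp add: len m_def \<rho>_def)
  qed
  define C' where "C' = set ` set uss"
  have C': "C' \<in> clusterings I" and clust: "\<And>A. A \<in> C' \<Longrightarrow> \<exists>k<m. A = {u. u < n \<and> \<rho> ! u = k}"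
    using clusters_of_gathers[OF _ _ uss_def, of I] g len by (simp_all add: C'_def n_def)
  have "denotes clustering_problem I (enc (clustering_alg N (clustering_input I))) C'"
  proof -
    have "enc uss = encode_list (map (encode_list \<circ> map Atom) uss)"
      by (simp add: enc_list_def[abs_def] enc_nat_def o_def)
    then show ?thesis by (auto simp: clustering_problem_def out C'_def)
  qed
  moreover have "of_nat (N * N) * clustering_cost I C' \<le> of_nat ((N + 2) * (N + 1)) * clustering_cost I C"
  proof (cases "clustering_cost I C' = 0")
    case True
    then show ?thesis using cost0 by simp
  next
    case False
    from clustering_cost_attained[OF C' False] obtain A u w where A: "A \<in> C'" "u \<in> A" "w \<in> A"
      and cost: "clustering_cost I C' = spider_dist (users I ! u) (users I ! w)" by metis
    from clust[OF A(1)] A obtain k where k: "u < n" "w < n" "\<rho> ! u = k" "\<rho> ! w = k" by auto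
    have b: "N * N * idist (us ! v) (fs ! (\<rho> ! v)) \<le> (N + 2) * (N + 1) * d" if "v < n" for v
      using gather_approx(2)[OF N dvd \<sigma> d, of v] that by (simp add: len \<rho>_def)
    \<comment> \<open>Both users share the facility \<open>k\<close>, so the radius bound applies to
      each of them.\<close>
    have "N * N * idist (us ! u) (us ! w) \<le> N * N * (idist (us ! u) (fs ! k) + idist (us ! w) (fs ! k))"
      using idist_triangle[of "us ! u" "us ! w" "fs ! k"] idist_commute[of "fs ! k"] by (intro mult_left_mono) auto
    also have "\<dots> \<le> (N + 2) * (N + 1) * (d * 2)"
      using b[OF k(1)] b[OF k(2)] unfolding k(3,4) distrib_left by linarith
    finally have "rat_of_nat (N * N * idist (us ! u) (us ! w)) \<le> rat_of_nat ((N + 2) * (N + 1) * (d * 2))"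
      by (simp only: of_nat_le_iff)
    then have "of_nat (N * N) * (clustering_cost I C' * S) \<le> of_nat ((N + 2) * (N + 1)) * (rat_of_nat d * 2)"
      using dist[OF k(1,2)] by (simp only: of_nat_mult cost of_nat_numeral)
    also have "\<dots> \<le> of_nat ((N + 2) * (N + 1)) * (clustering_cost I C * S)"
      by (rule mult_left_mono[OF dS]) simp
    finally show ?thesis using S by (simp only: mult.assoc[symmetric] mult_le_cancel_right)
  qed
  ultimately show ?thesis using C' by blast
qed

lemma has_PTAS_clustering: "has_PTAS clustering_problem"
proof (rule has_PTASI[where g = clustering_input and f = clustering_alg])
  show "encode clustering_problem I = enc (clustering_input I)" for I
    by (simp add: clustering_problem_def encode_clustering_instance_def clustering_input_def encode_list_def
        enc_list_def encode_point o_def)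
  show "polytime (clustering_alg N)" for N by (rule polytime_clustering_alg)
  fix I assume I: "I \<in> instances clustering_problem" and ne: "feasible clustering_problem I \<noteq> {}"
  from OPT_attained[OF _ ne] obtain C where C: "C \<in> clusterings I" "clustering_cost I C = OPT clustering_problem I"
    by (auto simp: clustering_problem_def finite_clusterings)
  then show "0 \<le> OPT clustering_problem I" using clustering_cost_nonneg by metis
  show "\<exists>s\<in>feasible clustering_problem I. denotes clustering_problem I (enc (clustering_alg N (clustering_input I))) s \<and>
        of_nat (N * N) * cost clustering_problem I s \<le> of_nat ((N + 2) * (N + 1)) * OPT clustering_problem I"
    if "2 < N" for N
    using clustering_approx[OF that I C(1)] unfolding C(2)[symmetric] by (simp add: clustering_problem_def)
qed

theorem theorem3:
  shows "has_PTAS clustering_problem \<and> has_PTAS gathering_problem"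
  by (simp add: has_PTAS_clustering has_PTAS_gathering)

end
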